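(* Let $\mathfrak H$ be a Hilbert space, $A$ a nonnegative self-adjoint operator in $\mathfrak H$, and let $\{m_n\}_{n\in\mathbb N_0}$ be a nondecreasing sequence of positive numbers such that (i) for every $\alpha>0$ there is $c=c(\alpha)>0$ with $m_n\ge c\alpha^n$ for all $n$, and (ii) there exist $c>0$, $h>1$ with $m_{n+1}\le ch^nm_n$ for all $n\in\mathbb N_0$. Let $\tau(\lambda)=\sum_{n=0}^\infty\lambda^n/m_n$. Then for every weak solution $y\in S$: (a) $y\in C^\infty(\mathbb R_+,\mathfrak H)$ iff for every $\alpha>0$, $\mathcal E_r(y)=O(r^{-\alpha})$ as $r\to\infty$; (b) $y\in C_{\{m_n\}}$ iff there exists $\alpha>0$ with $\mathcal E_r(y)=O(1/\tau(\alpha r))$ as $r\to\infty$; (c) $y\in C_{(m_n)}$ iff for every $\alpha>0$, $\mathcal E_r(y)=O(1/\tau(\alpha r))$ as $r\to\infty$.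
   Context: $e^{-At}=\int_0^\infty e^{-\lambda t}dE(\lambda)$, $E$ the spectral measure of $A$. A weak solution of $y'+Ay=0$ on $\mathbb R_+=[0,\infty)$ is a continuous $y:\mathbb R_+\to\mathfrak H$ with $\int_0^ty(s)ds\in\mathcal D(A)$ and $y(t)=-A\int_0^ty(s)ds+y(0)$ for all $t\ge0$. $S$ is the set of weak solutions (each of the form $e^{-At}f$, $f\in\mathfrak H$), normed by $\|y\|_S=\sup_{t\ge0}\|y(t)\|$. $S_0\subset S$: weak solutions extending to entire $\mathfrak H$-valued functions of exponential type, type $\sigma(y)=\inf\{\alpha>0:\exists c,\ \|y(z)\|\le ce^{\alpha|z|}\}$. $\mathcal E_r(y)=\inf\{\|y-y_0\|_S:y_0\in S_0,\ \sigma(y_0)\le r\}$. $C^\infty(\mathbb R_+,\mathfrak H)$: infinitely differentiable functions on $\mathbb R_+$. For $\alpha>0$, $C^\alpha_{m_n}=\{y\in C^\infty(\mathbb R_+,\mathfrak H):\exists c>0\ \forall k\in\mathbb N_0,\ \sup_{t\ge0}\|y^{(k)}(t)\|\le cm_k\alpha^k\}$; $C_{\{m_n\}}=\bigcup_{\alpha>0}C^\alpha_{m_n}$ and $C_{(m_n)}=\bigcap_{\alpha>0}C^\alpha_{m_n}$. *)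

theory Defs
  imports "HOL-Analysis.Analysis" "HOL-Library.Landau_Symbols"
begin

text \<open>A complex Hilbert space is modelled as a real Hilbert space (type class
  real_inner + complete_space) together with a complex structure J
  (multiplication by the imaginary unit): J is real-linear, J (J x) = - x and
  J is orthogonal.  The complex inner product is then inner x y + i inner x (J y).\<close>

definition complex_structure :: "('a::real_inner \<Rightarrow> 'a) \<Rightarrow> bool" where
  "complex_structure J \<longleftrightarrow> linear J \<and> (\<forall>x. J (J x) = - x) \<and>
     (\<forall>x y. inner (J x) (J y) = inner x y)"

definition scaleJ :: "('a::real_vector \<Rightarrow> 'a) \<Rightarrow> complex \<Rightarrow> 'a \<Rightarrow> 'a" where
  "scaleJ J c x = Re c *\<^sub>R x + Im c *\<^sub>R J x"

definition adjoint_dom :: "'a::real_inner set \<Rightarrow> ('a \<Rightarrow> 'a) \<Rightarrow> 'a set" where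
  "adjoint_dom D A = {y. \<exists>z. \<forall>x\<in>D. inner (A x) y = inner x z}"

definition nonneg_selfadjoint ::
  "('a::real_inner \<Rightarrow> 'a) \<Rightarrow> 'a set \<Rightarrow> ('a \<Rightarrow> 'a) \<Rightarrow> bool" where
  "nonneg_selfadjoint J D A \<longleftrightarrow>
     subspace D \<and> (\<forall>x\<in>D. J x \<in> D) \<and>
     (\<forall>x\<in>D. \<forall>y\<in>D. A (x + y) = A x + A y) \<and>
     (\<forall>x\<in>D. \<forall>r. A (r *\<^sub>R x) = r *\<^sub>R A x) \<and>
     (\<forall>x\<in>D. A (J x) = J (A x)) \<and>
     closure D = UNIV \<and>
     adjoint_dom D A = D \<and>
     (\<forall>x\<in>D. \<forall>y\<in>D. inner (A x) y = inner x (A y)) \<and>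
     (\<forall>x\<in>D. inner (A x) x \<ge> 0)"

text \<open>Weak solution of y' + A y = 0 on [0,\<infinity>).\<close>
definition weak_solution :: "'a::{real_inner,complete_space} set \<Rightarrow> ('a \<Rightarrow> 'a) \<Rightarrow> (real \<Rightarrow> 'a) \<Rightarrow> bool" where
  "weak_solution D A y \<longleftrightarrow> continuous_on {0..} y \<and>
     (\<forall>t\<ge>0. integral {0..t} y \<in> D \<and> y t = - A (integral {0..t} y) + y 0)"

definition S_norm :: "(real \<Rightarrow> 'a::real_normed_vector) \<Rightarrow> real" where
  "S_norm y = (SUP t\<in>{0..}. norm (y t))"

definition entire_ext :: "('a::real_normed_vector \<Rightarrow> 'a) \<Rightarrow> (real \<Rightarrow> 'a) \<Rightarrow> (complex \<Rightarrow> 'a) \<Rightarrow> bool" where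
  "entire_ext J y Y \<longleftrightarrow>
     (\<forall>z. \<exists>d. ((\<lambda>h. scaleJ J (inverse h) (Y (z + h) - Y z)) \<longlongrightarrow> d) (at 0)) \<and>
     (\<forall>t\<ge>0. Y (complex_of_real t) = y t)"

definition exp_type_set :: "(complex \<Rightarrow> 'a::real_normed_vector) \<Rightarrow> real set" where
  "exp_type_set Y = {\<alpha>. \<alpha> > 0 \<and> (\<exists>c. \<forall>z. norm (Y z) \<le> c * exp (\<alpha> * cmod z))}"

text \<open>Type \<sigma> of an entire function of exponential type (meaningful when exp_type_set Y is nonempty).\<close>
definition exp_type :: "(complex \<Rightarrow> 'a::real_normed_vector) \<Rightarrow> real" where
  "exp_type Y = Inf (exp_type_set Y)"

text \<open>y0 \<in> S_0 with \<sigma>(y0) \<le> r (the entire extension is unique, so \<sigma> is well defined).\<close>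
definition in_S0_type ::
  "('a::{real_inner,complete_space} \<Rightarrow> 'a) \<Rightarrow> 'a set \<Rightarrow> ('a \<Rightarrow> 'a) \<Rightarrow> (real \<Rightarrow> 'a) \<Rightarrow> real \<Rightarrow> bool" where
  "in_S0_type J D A y0 r \<longleftrightarrow> weak_solution D A y0 \<and>
     (\<exists>Y. entire_ext J y0 Y \<and> exp_type_set Y \<noteq> {} \<and> exp_type Y \<le> r)"

definition best_approx ::
  "('a::{real_inner,complete_space} \<Rightarrow> 'a) \<Rightarrow> 'a set \<Rightarrow> ('a \<Rightarrow> 'a) \<Rightarrow> real \<Rightarrow> (real \<Rightarrow> 'a) \<Rightarrow> real" where
  "best_approx J D A r y = Inf {S_norm (\<lambda>t. y t - y0 t) | y0. in_S0_type J D A y0 r}"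

definition deriv_seq :: "(real \<Rightarrow> 'a::real_normed_vector) \<Rightarrow> (nat \<Rightarrow> real \<Rightarrow> 'a) \<Rightarrow> bool" where
  "deriv_seq y Dy \<longleftrightarrow> (\<forall>t\<ge>0. Dy 0 t = y t) \<and>
     (\<forall>k t. t \<ge> 0 \<longrightarrow> (Dy k has_vector_derivative Dy (Suc k) t) (at t within {0..}))"

definition C_inf :: "(real \<Rightarrow> 'a::real_normed_vector) \<Rightarrow> bool" where
  "C_inf y \<longleftrightarrow> (\<exists>Dy. deriv_seq y Dy)"

definition C_alpha :: "(nat \<Rightarrow> real) \<Rightarrow> real \<Rightarrow> (real \<Rightarrow> 'a::real_normed_vector) \<Rightarrow> bool" where
  "C_alpha m \<alpha> y \<longleftrightarrow> (\<exists>Dy. deriv_seq y Dy \<and>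
     (\<exists>c>0. \<forall>k t. t \<ge> 0 \<longrightarrow> norm (Dy k t) \<le> c * m k * \<alpha> ^ k))"

definition C_roumieu :: "(nat \<Rightarrow> real) \<Rightarrow> (real \<Rightarrow> 'a::real_normed_vector) \<Rightarrow> bool" where
  "C_roumieu m y \<longleftrightarrow> (\<exists>\<alpha>>0. C_alpha m \<alpha> y)"

definition C_beurling :: "(nat \<Rightarrow> real) \<Rightarrow> (real \<Rightarrow> 'a::real_normed_vector) \<Rightarrow> bool" where
  "C_beurling m y \<longleftrightarrow> (\<forall>\<alpha>>0. C_alpha m \<alpha> y)"

definition tau :: "(nat \<Rightarrow> real) \<Rightarrow> real \<Rightarrow> real" where
  "tau m x = (\<Sum>n. x ^ n / m n)"

end

theory Submission
  imports Defs "HOL-Complex_Analysis.Complex_Analysis"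
begin

text \<open>No spectral measure is constructed. In place of the range of \<open>E [0, r]\<close> take the closed
  subspace \<open>H r\<close> of vectors \<open>f\<close> with \<open>norm (A\<^sup>k f) \<le> r\<^sup>k norm f\<close> for all \<open>k\<close>. Its orthogonal
  projection \<open>P r\<close> commutes with \<open>A\<close>, and \<open>norm (A g) \<ge> r norm g\<close> on its orthogonal complement; the
  latter uses the positive part of \<open>(1 + A)\<^sup>-\<^sup>1 - 1/(1 + r)\<close>, for which only one operator square root
  is needed. Hence \<open>norm (f - P r f) \<le> r\<^sup>-\<^sup>n norm (A\<^sup>n f)\<close>.

  A weak solution is a contraction orbit, and it is of exponential type at most \<open>r\<close> iff its
  initial value lies in \<open>H r\<close> (Cauchy estimates for the scalar functions \<open>\<langle>Y z, v\<rangle>\<close>), so the best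
  approximation is exactly \<open>norm (f - P r f)\<close> for \<open>f = y 0\<close>. Smoothness of \<open>y\<close> amounts to bounds on
  \<open>norm (A\<^sup>n f)\<close>, which are matched with the decay of \<open>norm (f - P r f)\<close> by the inequality above in
  one direction and by a dyadic telescoping sum in the other.\<close>

section \<open>Calculus in complete normed spaces\<close>

text \<open>What makes \<open>exp_vectors r\<close> workable without a functional calculus is
  log-convexity: for symmetric \<open>A\<close> the numbers a_k = \<open>norm ((A ^^ k) f)\<close>
  satisfy a_(k+1)^2 \<le> a_k a_(k+2), so a bound C r^k with an arbitrary constant C already forces
  r^k \<open>norm f\<close>. Hence the set is closed under sums, and constants lost in Cauchy
  estimates disappear. The unbounded operator is handled through the bounded map sending x to
  \<open>A (P r x)\<close>, through which derivatives, integrals and series pass; closedness of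
  \<open>A\<close> then recovers statements about \<open>A\<close> itself. Going from decay back to
  bounds on powers costs one power of r, since the dyadic sum has to converge. Hypothesis (ii) pays
  for it: replacing m_(n+1) by c h^n m_n only changes \<alpha> by the factor h, which is invisible
  to a union or an intersection over all \<alpha>. Hypothesis (i) makes \<open>tau\<close> finite
  and absorbs a term R^n \<open>norm f\<close>, which stems from the range r < R where an O-estimate
  says nothing.\<close>

text \<open>A type variable of sort \<open>{real_inner, complete_space}\<close> is not of class \<open>banach\<close>, so the library
  facts about Banach spaces are transported along an isometric copy that is.\<close>

typedef 'a banach_copy = "UNIV :: 'a set" ..

setup_lifting type_definition_banach_copy

instantiation banach_copy :: (real_normed_vector) real_normed_vector
begin

lift_definition zero_banach_copy :: "'a banach_copy" is 0 .
lift_definition plus_banach_copy :: "'a banach_copy \<Rightarrow> 'a banach_copy \<Rightarrow> 'a banach_copy" is plus .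
lift_definition minus_banach_copy :: "'a banach_copy \<Rightarrow> 'a banach_copy \<Rightarrow> 'a banach_copy" is minus .
lift_definition uminus_banach_copy :: "'a banach_copy \<Rightarrow> 'a banach_copy" is uminus .
lift_definition scaleR_banach_copy :: "real \<Rightarrow> 'a banach_copy \<Rightarrow> 'a banach_copy" is scaleR .
lift_definition norm_banach_copy :: "'a banach_copy \<Rightarrow> real" is norm .
lift_definition sgn_banach_copy :: "'a banach_copy \<Rightarrow> 'a banach_copy" is sgn .
lift_definition dist_banach_copy :: "'a banach_copy \<Rightarrow> 'a banach_copy \<Rightarrow> real" is dist .

definition uniformity_banach_copy :: "('a banach_copy \<times> 'a banach_copy) filter" where
  "uniformity_banach_copy = (INF e\<in>{0<..}. principal {(x, y). dist x y < e})"

definition open_banach_copy :: "'a banach_copy set \<Rightarrow> bool" where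
  "open_banach_copy U \<longleftrightarrow> (\<forall>x\<in>U. eventually (\<lambda>(x', y). x' = x \<longrightarrow> y \<in> U) uniformity)"

instance
  by (standard; (rule uniformity_banach_copy_def open_banach_copy_def)?;
      (transfer; auto simp: algebra_simps dist_norm sgn_div_norm norm_triangle_ineq)?)

end

lemma bounded_linear_Abs_banach_copy: "bounded_linear Abs_banach_copy"
  by (intro bounded_linear_intro[of _ 1])
     (auto simp: plus_banach_copy.abs_eq scaleR_banach_copy.abs_eq norm_banach_copy.abs_eq)

lemma bounded_linear_Rep_banach_copy: "bounded_linear Rep_banach_copy"
  by (intro bounded_linear_intro[of _ 1])
     (auto simp: plus_banach_copy.rep_eq scaleR_banach_copy.rep_eq norm_banach_copy.rep_eq)

instance banach_copy :: ("{real_normed_vector, complete_space}") complete_space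
proof
  fix X :: "nat \<Rightarrow> 'a banach_copy"
  assume "Cauchy X"
  then have "Cauchy (\<lambda>n. Rep_banach_copy (X n))"
    by (rule bounded_linear.Cauchy[OF bounded_linear_Rep_banach_copy])
  then obtain l where "(\<lambda>n. Rep_banach_copy (X n)) \<longlonglongrightarrow> l"
    using Cauchy_convergent convergent_def by blast
  then have "(\<lambda>n. Abs_banach_copy (Rep_banach_copy (X n))) \<longlonglongrightarrow> Abs_banach_copy l"
    by (rule bounded_linear.tendsto[OF bounded_linear_Abs_banach_copy])
  then show "convergent X"
    by (auto simp: Rep_banach_copy_inverse convergent_def)
qed

instance banach_copy :: ("{real_normed_vector, complete_space}") banach ..

lemma Rep_comp_Abs [simp]: "Rep_banach_copy \<circ> (\<lambda>t. Abs_banach_copy (f t)) = f"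
  by (auto simp: Abs_banach_copy_inverse)

lemma summable_norm_cancel_complete:
  fixes f :: "nat \<Rightarrow> 'a::{real_normed_vector, complete_space}"
  assumes "summable (\<lambda>n. norm (f n))"
  shows "summable f"
proof -
  have "summable (\<lambda>n. Abs_banach_copy (f n))"
    by (rule summable_norm_cancel) (simp add: norm_banach_copy.abs_eq assms)
  from bounded_linear.summable[OF bounded_linear_Rep_banach_copy this]
  show ?thesis by (simp add: Abs_banach_copy_inverse)
qed

lemma continuous_on_Abs_banach_copy:
  "continuous_on S f \<Longrightarrow> continuous_on S (\<lambda>t. Abs_banach_copy (f t))"
  by (rule bounded_linear.continuous_on[OF bounded_linear_Abs_banach_copy])

lemma integrable_continuous_complete:
  fixes f :: "real \<Rightarrow> 'a::{real_normed_vector, complete_space}"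
  assumes "continuous_on {a..b} f"
  shows "f integrable_on {a..b}"
  using integrable_linear[OF integrable_continuous_real[OF continuous_on_Abs_banach_copy[OF assms]]
      bounded_linear_Rep_banach_copy] by simp

lemma integral_has_vector_derivative_complete:
  fixes f :: "real \<Rightarrow> 'a::{real_normed_vector, complete_space}"
  assumes "continuous_on {a..b} f" "x \<in> {a..b}"
  shows "((\<lambda>u. integral {a..u} f) has_vector_derivative f x) (at x within {a..b})"
proof -
  let ?g = "\<lambda>t. Abs_banach_copy (f t)"
  have "((\<lambda>u. Rep_banach_copy (integral {a..u} ?g)) has_vector_derivative Rep_banach_copy (?g x))
      (at x within {a..b})"
    using bounded_linear.has_vector_derivative[OF bounded_linear_Rep_banach_copy
      integral_has_vector_derivative[OF continuous_on_Abs_banach_copy[OF assms(1)] assms(2)]] .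
  then have *: "((\<lambda>u. Rep_banach_copy (integral {a..u} ?g)) has_vector_derivative f x)
      (at x within {a..b})"
    by (simp add: Abs_banach_copy_inverse)
  have eq: "Rep_banach_copy (integral {a..u} ?g) = integral {a..u} f" if "u \<in> {a..b}" for u
  proof -
    have "continuous_on {a..u} f"
      using assms(1) that by (auto elim: continuous_on_subset)
    then show ?thesis
      using integral_linear[OF integrable_continuous_real[OF continuous_on_Abs_banach_copy]
          bounded_linear_Rep_banach_copy, of a u f] by simp
  qed
  show ?thesis
    by (rule has_vector_derivative_transform[OF assms(2) _ *]) (simp add: eq)
qed

lemma fundamental_theorem_of_calculus_complete:
  fixes f :: "real \<Rightarrow> 'a::{real_normed_vector, complete_space}"
  assumes "a \<le> b"
    and "\<And>x. x \<in> {a..b} \<Longrightarrow> (f has_vector_derivative f' x) (at x within {a..b})"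
  shows "(f' has_integral (f b - f a)) {a..b}"
proof -
  have "((\<lambda>x. Abs_banach_copy (f' x)) has_integral (Abs_banach_copy (f b) - Abs_banach_copy (f a))) {a..b}"
    by (intro fundamental_theorem_of_calculus assms
      bounded_linear.has_vector_derivative[OF bounded_linear_Abs_banach_copy])
  from has_integral_linear[OF this bounded_linear_Rep_banach_copy]
  show ?thesis
    by (simp add: minus_banach_copy.abs_eq Abs_banach_copy_inverse)
qed

lemma has_derivative_sequence_complete:
  fixes f :: "nat \<Rightarrow> 'a::real_normed_vector \<Rightarrow> 'b::{real_normed_vector, complete_space}"
  assumes "convex S"
    and derf: "\<And>n x. x \<in> S \<Longrightarrow> ((f n) has_derivative (f' n x)) (at x within S)"
    and nle: "\<And>e. e > 0 \<Longrightarrow> \<forall>\<^sub>F n in sequentially. \<forall>x\<in>S. \<forall>h. norm (f' n x h - g' x h) \<le> e * norm h"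
    and lim: "\<And>x. x \<in> S \<Longrightarrow> (\<lambda>n. f n x) \<longlonglongrightarrow> g x"
    and "x \<in> S"
  shows "(g has_derivative g' x) (at x within S)"
proof -
  have "\<exists>k. \<forall>x\<in>S. (\<lambda>n. Abs_banach_copy (f n x)) \<longlonglongrightarrow> k x \<and>
      (k has_derivative (\<lambda>h. Abs_banach_copy (g' x h))) (at x within S)"
  proof (rule has_derivative_sequence[OF \<open>convex S\<close>,
        where f' = "\<lambda>n x h. Abs_banach_copy (f' n x h)"])
    show "((\<lambda>x. Abs_banach_copy (f n x)) has_derivative (\<lambda>h. Abs_banach_copy (f' n x h))) (at x within S)"
      if "x \<in> S" for n x
      by (rule bounded_linear.has_derivative[OF bounded_linear_Abs_banach_copy derf[OF that]])
    show "\<forall>\<^sub>F n in sequentially. \<forall>x\<in>S. \<forall>h.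
        norm (Abs_banach_copy (f' n x h) - Abs_banach_copy (g' x h)) \<le> e * norm h" if "e > 0" for e
      using nle[OF that] by (simp add: minus_banach_copy.abs_eq norm_banach_copy.abs_eq)
    show "x \<in> S" by fact
    show "(\<lambda>n. Abs_banach_copy (f n x)) \<longlonglongrightarrow> Abs_banach_copy (g x)"
      by (rule bounded_linear.tendsto[OF bounded_linear_Abs_banach_copy lim]) fact
  qed
  then obtain k where k: "\<And>x. x \<in> S \<Longrightarrow> (\<lambda>n. Abs_banach_copy (f n x)) \<longlonglongrightarrow> k x"
    "\<And>x. x \<in> S \<Longrightarrow> (k has_derivative (\<lambda>h. Abs_banach_copy (g' x h))) (at x within S)"
    by blast
  \<comment> \<open>The limit function \<open>k\<close> is not prescribed by the theorem on
    sequences of derivatives; uniqueness of limits identifies it with \<open>g\<close>.\<close>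
  have eq: "g x = Rep_banach_copy (k x)" if "x \<in> S" for x
    using bounded_linear.tendsto[OF bounded_linear_Rep_banach_copy k(1)[OF that]] lim[OF that]
    by (simp add: Abs_banach_copy_inverse LIMSEQ_unique)
  have "((\<lambda>x. Rep_banach_copy (k x)) has_derivative g' x) (at x within S)"
    using bounded_linear.has_derivative[OF bounded_linear_Rep_banach_copy k(2)[OF \<open>x \<in> S\<close>]]
    by (simp add: Abs_banach_copy_inverse)
  from has_derivative_transform[OF \<open>x \<in> S\<close> _ this] eq show ?thesis
    by blast
qed

section \<open>Orthogonal projections\<close>

lemma parallelogram_law:
  fixes x y :: "'a::real_inner"
  shows "(norm (x + y))\<^sup>2 + (norm (x - y))\<^sup>2 = 2 * (norm x)\<^sup>2 + 2 * (norm y)\<^sup>2"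
  by (simp add: power2_norm_eq_inner inner_simps inner_commute)

text \<open>A minimising sequence is Cauchy by the parallelogram law, and its limit is a nearest
  point; no multiple of a vector in \<open>H\<close> can improve it, which is orthogonality.\<close>

lemma orthogonal_projection_exists:
  fixes H :: "'a::{real_inner, complete_space} set"
  assumes H: "subspace H" "closed H"
  shows "\<exists>p\<in>H. \<forall>h\<in>H. inner (x - p) h = 0"
proof -
  have ne: "H \<noteq> {}" using H(1) subspace_0 by blast
  define d where "d = infdist x H"
  have d0: "d \<ge> 0" by (simp add: d_def infdist_nonneg)
  have dle: "d \<le> norm (x - h)" if "h \<in> H" for h
    using infdist_le[OF that, of x] by (simp add: d_def dist_norm)
  have "\<exists>h\<in>H. norm (x - h) < d + 1 / (Suc n)" for n
  proof -
    have "infdist x H < d + 1 / Suc n" by (simp add: d_def)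
    then have "(INF a\<in>H. dist x a) < d + 1 / Suc n" by (simp add: infdist_def ne)
    then have "\<exists>a\<in>H. dist x a < d + 1 / Suc n"
      using ne by (subst (asm) cINF_less_iff) auto
    then show ?thesis by (simp add: dist_norm)
  qed
  then obtain h where h: "\<And>n. h n \<in> H" "\<And>n. norm (x - h n) < d + 1 / (Suc n)"
    by metis
  \<comment> \<open>The midpoint lies in \<open>H\<close>, so one diagonal of the parallelogram is
    at least \<open>2 * d\<close>; both sides exceed \<open>d\<close> by at most 1/(N+1), so the
    square of the other diagonal is O(1/N).\<close>
  have bound: "(norm (h m - h n))\<^sup>2 \<le> 4 * (2 * d + 1) / Suc N" if "m \<ge> N" "n \<ge> N" for m n N
  proof -
    have le: "(norm (x - h k))\<^sup>2 \<le> d\<^sup>2 + (2 * d + 1) / Suc N" if "k \<ge> N" for k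
    proof -
      have "norm (x - h k) \<le> d + 1 / Suc N"
        using h(2)[of k] that frac_le[of 1 1 "Suc N" "Suc k"] by simp
      then have "(norm (x - h k))\<^sup>2 \<le> (d + 1 / Suc N)\<^sup>2"
        by (intro power_mono) auto
      also have "\<dots> = d\<^sup>2 + (2 * d + 1 / Suc N) / Suc N"
      proof -
        have "(d + e)\<^sup>2 = d\<^sup>2 + (2 * d + e) * e" for e :: real
          by (simp add: power2_eq_square algebra_simps)
        from this[of "1 / Suc N"] show ?thesis by simp
      qed
      also have "\<dots> \<le> d\<^sup>2 + (2 * d + 1) / Suc N"
        by (intro add_left_mono divide_right_mono) auto
      finally show ?thesis .
    qed
    let ?u = "x - h m" and ?v = "x - h n"
    have "(1/2) *\<^sub>R (h m + h n) \<in> H"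
      using H(1) h(1) by (intro subspace_scale subspace_add) auto
    then have "d \<le> norm (x - (1/2) *\<^sub>R (h m + h n))" by (rule dle)
    moreover have "?u + ?v = 2 *\<^sub>R (x - (1/2) *\<^sub>R (h m + h n))"
      by (simp add: algebra_simps scaleR_2)
    ultimately have "norm (?u + ?v) \<ge> 2 * d" by simp
    then have "(norm (?u + ?v))\<^sup>2 \<ge> 4 * d\<^sup>2"
      using d0 power_mono[of "2*d" "norm (?u + ?v)" 2] by (simp add: power_mult_distrib)
    moreover have "(norm (?u - ?v))\<^sup>2 = (norm (h m - h n))\<^sup>2" by (simp add: norm_minus_commute)
    moreover have "4 * (2 * d + 1) / Suc N = 4 * ((2 * d + 1) / Suc N)" by simp
    ultimately show ?thesis
      using parallelogram_law[of ?u ?v] le[OF that(1)] le[OF that(2)] by linarith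
  qed
  have "Cauchy h"
  proof (rule metric_CauchyI)
    fix e :: real assume e: "e > 0"
    obtain N where N: "4 * (2 * d + 1) / e\<^sup>2 < real N"
      using reals_Archimedean2 by blast
    have "4 * (2 * d + 1) / Suc N < e\<^sup>2"
    proof -
      have "4 * (2 * d + 1) < real N * e\<^sup>2" using N e by (simp add: field_simps)
      also have "\<dots> \<le> real (Suc N) * e\<^sup>2" by (intro mult_right_mono) auto
      finally show ?thesis by (simp add: field_simps)
    qed
    then have "dist (h m) (h n) < e" if "m \<ge> N" "n \<ge> N" for m n
      using bound[OF that] e by (simp add: dist_norm power2_less_imp_less)
    then show "\<exists>M. \<forall>m\<ge>M. \<forall>n\<ge>M. dist (h m) (h n) < e" by blast
  qed
  then obtain p where p: "h \<longlonglongrightarrow> p" using Cauchy_convergent convergent_def by blast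
  have pH: "p \<in> H" using closed_sequentially[OF H(2) h(1) p] .
  have "norm (x - p) \<le> d"
  proof (rule LIMSEQ_le[of "\<lambda>n. norm (x - h n)" _ "\<lambda>n. d + 1 / Suc n"])
    show "(\<lambda>n. norm (x - h n)) \<longlonglongrightarrow> norm (x - p)" by (intro tendsto_intros p)
    show "(\<lambda>n. d + 1 / Suc n) \<longlonglongrightarrow> d"
      using tendsto_add[OF tendsto_const LIMSEQ_Suc[OF lim_1_over_n], of d] by simp
    show "\<exists>N. \<forall>n\<ge>N. norm (x - h n) \<le> d + 1 / Suc n" using h(2) less_imp_le by blast
  qed
  have min: "norm (x - p) \<le> norm (x - k)" if "k \<in> H" for k
    using \<open>norm (x - p) \<le> d\<close> dle[OF that] by simp
  have "inner (x - p) k = 0" if k: "k \<in> H" for k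
  proof (cases "k = 0")
    case False
    \<comment> \<open>The coefficient that minimises the distance along \<open>k\<close>; it would
      lower the squared distance by \<open>(inner (x - p) k)\<^sup>2 / inner k k\<close>.\<close>
    let ?t = "inner (x - p) k / inner k k"
    have "p + ?t *\<^sub>R k \<in> H" using H(1) pH k by (intro subspace_add subspace_scale)
    then have "(norm (x - p))\<^sup>2 \<le> (norm (x - p - ?t *\<^sub>R k))\<^sup>2"
      using min by (simp add: algebra_simps power_mono)
    also have "\<dots> = (norm (x - p))\<^sup>2 - (inner (x - p) k)\<^sup>2 / inner k k"
      using False unfolding power2_norm_eq_inner
      by (simp only: inner_diff_left inner_diff_right inner_scaleR_left inner_scaleR_right)
         (simp add: inner_commute power2_eq_square field_simps)
    finally have "(inner (x - p) k)\<^sup>2 / inner k k \<le> 0" by simp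
    then show ?thesis using False
      by (smt (verit) divide_pos_pos inner_gt_zero_iff zero_less_power2)
  qed simp
  then show ?thesis using pH by blast
qed

definition proj :: "'a::real_inner set \<Rightarrow> 'a \<Rightarrow> 'a" where
  "proj H x = (SOME p. p \<in> H \<and> (\<forall>h\<in>H. inner (x - p) h = 0))"

context
  fixes H :: "'a::{real_inner, complete_space} set"
  assumes H: "subspace H" "closed H"
begin

lemma proj_mem: "proj H x \<in> H"
  and inner_diff_proj: "h \<in> H \<Longrightarrow> inner (x - proj H x) h = 0"
  using someI_ex[of "\<lambda>p. p \<in> H \<and> (\<forall>h\<in>H. inner (x - p) h = 0)", folded proj_def]
    orthogonal_projection_exists[OF H, of x] by blast+

lemma proj_unique:
  assumes "p \<in> H" "\<And>h. h \<in> H \<Longrightarrow> inner (x - p) h = 0"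
  shows "proj H x = p"
proof -
  have d: "proj H x - p \<in> H" using H(1) assms(1) proj_mem by (intro subspace_diff)
  have "inner (proj H x - p) (proj H x - p) = 
    inner (x - p) (proj H x - p) - inner (x - proj H x) (proj H x - p)"
    by (simp add: inner_diff_left)
  then show ?thesis using d assms(2) inner_diff_proj by simp
qed

lemma proj_id: "x \<in> H \<Longrightarrow> proj H x = x"
  by (rule proj_unique) auto

lemma norm_proj_pythagoras: "(norm x)\<^sup>2 = (norm (proj H x))\<^sup>2 + (norm (x - proj H x))\<^sup>2"
  using inner_diff_proj[OF proj_mem, of x x]
  by (simp add: power2_norm_eq_inner inner_diff_left inner_diff_right inner_commute)

lemma norm_proj_le: "norm (proj H x) \<le> norm x"
  using norm_proj_pythagoras[of x] by (rule_tac power2_le_imp_le) simp_all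

lemma norm_diff_proj_le: "norm (x - proj H x) \<le> norm x"
  using norm_proj_pythagoras[of x] by (rule_tac power2_le_imp_le) simp_all

lemma proj_add: "proj H (x + y) = proj H x + proj H y"
  using H(1) proj_mem inner_diff_proj
  by (intro proj_unique subspace_add)
     (simp_all add: add_diff_add inner_add_left)

lemma proj_scaleR: "proj H (c *\<^sub>R x) = c *\<^sub>R proj H x"
  using H(1) proj_mem inner_diff_proj
  by (intro proj_unique subspace_scale) (simp_all add: scaleR_diff_right[symmetric])

lemma bounded_linear_proj: "bounded_linear (proj H)"
  by (rule bounded_linear_intro[of _ 1]) (auto simp: proj_add proj_scaleR norm_proj_le)

lemma proj_diff: "proj H (x - y) = proj H x - proj H y"
  by (rule linear_diff[OF bounded_linear.linear[OF bounded_linear_proj]])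

lemma inner_proj_commute: "inner (proj H x) y = inner x (proj H y)"
  using inner_diff_proj[OF proj_mem, of x y] inner_diff_proj[OF proj_mem, of y x]
    inner_commute[of x "proj H y"] inner_commute[of "proj H x" "proj H y"] inner_commute[of "proj H x" y]
  by (simp add: inner_diff_left)

lemma norm_diff_proj_minimal:
  assumes "h \<in> H"
  shows "norm (x - proj H x) \<le> norm (x - h)"
proof -
  have "x - proj H x = (x - h) - proj H (x - h)"
    by (simp add: proj_diff proj_id[OF assms])
  then show ?thesis by (simp only: norm_diff_proj_le)
qed

end

section \<open>Bounded symmetric operators\<close>

text \<open>Nonnegativity of the form at \<open>q *\<^sub>R x - C x\<close>, with the upper bound at
  \<open>C x\<close>, gives \<open>(norm (C x))\<^sup>2 \<le> q * inner (C x) x\<close>. Working on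
  an invariant subspace \<open>L\<close> allows its use both on the spectral subspace and on its
  complement.\<close>

lemma norm_le_of_form_bound:
  fixes C :: "'a::real_inner \<Rightarrow> 'a"
  assumes C: "linear C" "\<And>x y. inner (C x) y = inner x (C y)"
    and L: "subspace L" "\<And>x. x \<in> L \<Longrightarrow> C x \<in> L"
    and pos: "\<And>x. x \<in> L \<Longrightarrow> 0 \<le> inner (C x) x"
    and le: "\<And>x. x \<in> L \<Longrightarrow> inner (C x) x \<le> q * (norm x)\<^sup>2"
    and q: "q > 0" and x: "x \<in> L"
  shows "norm (C x) \<le> q * norm x"
proof -
  let ?y = "C x" let ?z = "q *\<^sub>R x - C x"
  have y: "?y \<in> L" and z: "?z \<in> L"
    using L x by (auto intro: subspace_diff subspace_scale)
  have "C ?z = q *\<^sub>R ?y - C ?y"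
    using C(1) by (simp add: linear_diff linear_scale)
  then have "inner (C ?z) ?z = q * q * inner ?y x - 2 * q * inner ?y ?y + inner (C ?y) ?y"
    using C(2)[of ?y x]
    by (simp only: inner_diff_left inner_diff_right inner_scaleR_left inner_scaleR_right)
       (simp add: algebra_simps)
  with pos[OF z] le[OF y] have "0 \<le> q * (q * inner ?y x - (norm ?y)\<^sup>2)"
    by (simp add: power2_norm_eq_inner algebra_simps)
  then have "(norm ?y)\<^sup>2 \<le> q * inner ?y x" using q by (simp add: zero_le_mult_iff)
  also have "\<dots> \<le> q * (q * (norm x)\<^sup>2)" using le[OF x] q by simp
  finally have "(norm ?y)\<^sup>2 \<le> (q * norm x)\<^sup>2" by (simp add: power2_eq_square algebra_simps)
  then show ?thesis using q by (rule_tac power2_le_imp_le) simp_all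
qed

section \<open>The Taylor series of sqrt(1 - x) and operator square roots\<close>

definition sqrt_coeff :: "nat \<Rightarrow> real" where
  "sqrt_coeff n = (-1) ^ n * ((1/2) gchoose n)"

lemma sqrt_coeff_0 [simp]: "sqrt_coeff 0 = 1"
  by (simp add: sqrt_coeff_def)

lemma gbinomial_Suc_rec: "(a gchoose Suc n) = (a gchoose n) * (a - of_nat n) / of_nat (Suc n)"
  for a :: real
  using gbinomial_mult_1[of a n] by (simp add: field_simps)

lemma sqrt_coeff_Suc_nonpos: "sqrt_coeff (Suc n) \<le> 0"
proof (induction n)
  case (Suc n)
  have "sqrt_coeff (Suc (Suc n)) = sqrt_coeff (Suc n) * ((real (Suc n) - 1/2) / real (Suc (Suc n)))"
    unfolding sqrt_coeff_def gbinomial_Suc_rec[of _ "Suc n"] by (simp add: field_simps)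
  also have "\<dots> \<le> 0" using Suc by (intro mult_nonpos_nonneg) auto
  finally show ?case .
qed (simp add: sqrt_coeff_def)

text \<open>Partial sums are the coefficients of the product with 1/(1 - x), that is of (1 -
  x)^(-1/2), and those are nonnegative.\<close>

lemma sum_sqrt_coeff_nonneg: "0 \<le> (\<Sum>k\<le>n. sqrt_coeff k)"
proof -
  have nn: "0 \<le> (-1) ^ n * ((1/2 - 1 :: real) gchoose n)" for n
  proof (induction n)
    case (Suc n)
    have "(-1) ^ Suc n * ((1/2 - 1 :: real) gchoose Suc n) =
        (-1) ^ n * ((1/2 - 1) gchoose n) * ((1/2 + real n) / real (Suc n))"
      unfolding gbinomial_Suc_rec[of _ n] by (simp add: field_simps)
    then show ?case using Suc by simp
  qed simp
  show ?thesis
    using nn[of n] gbinomial_sum_lower_neg[of "1/2::real" n]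
    by (simp add: sqrt_coeff_def mult.commute)
qed

text \<open>All coefficients after the first are nonpositive, so this is 1 minus a nonnegative
  partial sum. The sharp value 1 later yields positivity of the square root.\<close>

lemma sum_abs_sqrt_coeff_le: "(\<Sum>k<n. \<bar>sqrt_coeff (Suc k)\<bar>) \<le> 1"
proof -
  have "(\<Sum>k<n. \<bar>sqrt_coeff (Suc k)\<bar>) = - (\<Sum>k<n. sqrt_coeff (Suc k))"
    using sqrt_coeff_Suc_nonpos by (simp add: sum_negf[symmetric])
  also have "\<dots> = 1 - (\<Sum>k\<le>n. sqrt_coeff k)"
    by (simp add: sum.atMost_shift)
  finally show ?thesis using sum_sqrt_coeff_nonneg[of n] by simp
qed

lemma summable_abs_sqrt_coeff: "summable (\<lambda>n. \<bar>sqrt_coeff n\<bar>)"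
proof -
  have "summable (\<lambda>n. \<bar>sqrt_coeff (Suc n)\<bar>)"
    by (rule summableI_nonneg_bounded[of _ 1]) (use sum_abs_sqrt_coeff_le in auto)
  then show ?thesis by (subst (asm) summable_Suc_iff)
qed

lemma suminf_abs_sqrt_coeff_Suc_le: "(\<Sum>n. \<bar>sqrt_coeff (Suc n)\<bar>) \<le> 1"
  using summable_abs_sqrt_coeff summable_Suc_iff[of "\<lambda>n. \<bar>sqrt_coeff n\<bar>"]
  by (intro suminf_le_const sum_abs_sqrt_coeff_le) simp

text \<open>The square of the series is 1 - x: Vandermonde's identity with 1/2 + 1/2 = 1.\<close>

lemma sqrt_coeff_convolution:
  "(\<Sum>i\<le>n. sqrt_coeff i * sqrt_coeff (n - i)) = (if n = 0 then 1 else if n = 1 then -1 else 0)"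
proof -
  have "(\<Sum>i\<le>n. sqrt_coeff i * sqrt_coeff (n - i)) =
      (\<Sum>i\<le>n. (-1) ^ n * (((1/2) gchoose i) * ((1/2) gchoose (n - i))))"
  proof (rule sum.cong)
    fix i assume "i \<in> {..n}"
    then have "(-1 :: real) ^ n = (-1) ^ i * (-1) ^ (n - i)"
      by (simp add: power_add[symmetric])
    then show "sqrt_coeff i * sqrt_coeff (n - i) =
        (-1) ^ n * (((1/2) gchoose i) * ((1/2) gchoose (n - i)))"
      by (simp add: sqrt_coeff_def)
  qed simp
  also have "\<dots> = (-1) ^ n * (1 gchoose n)"
    using gbinomial_Vandermonde[of "1/2::real" "1/2" n]
    by (simp add: sum_distrib_left[symmetric] atLeast0AtMost)
  also have "\<dots> = (-1) ^ n * real (1 choose n)"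
    using binomial_gbinomial[of 1 n, where 'a=real] by simp
  finally show ?thesis by (simp add: binomial_eq_0)
qed

text \<open>One matrix coefficient of the square of a power series in an operator:
  \<open>b n\<close> will be \<open>inner ((X ^^ n) x) v\<close>. The majorant B |a i| |a j| permits
  regrouping the double sum along i + j = n.\<close>

lemma suminf_shifted_product:
  fixes a b :: "nat \<Rightarrow> real"
  assumes a: "summable (\<lambda>n. \<bar>a n\<bar>)" and b: "\<And>n. \<bar>b n\<bar> \<le> B"
  shows "(\<Sum>i. a i * (\<Sum>j. a j * b (i + j))) = (\<Sum>n. (\<Sum>i\<le>n. a i * a (n - i)) * b n)"
    and "summable (\<lambda>i. a i * (\<Sum>j. a j * b (i + j)))"
proof -
  define f where "f = (\<lambda>(i, j). a i * a j * b (i + j))"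
  have B0: "B \<ge> 0" using b[of 0] by linarith
  have a_on: "(\<lambda>n. \<bar>a n\<bar>) summable_on UNIV"
    using norm_summable_imp_summable_on[of "\<lambda>n. \<bar>a n\<bar>"] a by simp
  have prod: "(\<lambda>(i, j). \<bar>a i\<bar> * \<bar>a j\<bar>) summable_on UNIV \<times> UNIV"
    by (rule summable_on_SigmaI[where g = "\<lambda>i. \<bar>a i\<bar> * (\<Sum>\<^sub>\<infinity>j. \<bar>a j\<bar>)"])
       (auto intro!: has_sum_cmult_right summable_on_cmult_left a_on has_sum_infsum)
  have fabs: "f summable_on UNIV \<times> UNIV"
  proof (rule abs_summable_summable, rule summable_on_comparison_test)
    show "(\<lambda>p. B * (case p of (i, j) \<Rightarrow> \<bar>a i\<bar> * \<bar>a j\<bar>)) summable_on UNIV \<times> UNIV"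
      using prod by (rule summable_on_cmult_right)
    show "norm (f p) \<le> B * (case p of (i, j) \<Rightarrow> \<bar>a i\<bar> * \<bar>a j\<bar>)" for p
      using mult_left_mono[OF b[of "fst p + snd p"], of "\<bar>a (fst p)\<bar> * \<bar>a (snd p)\<bar>"]
      by (simp add: f_def case_prod_unfold abs_mult mult.commute)
  qed auto
  have inner_sum: "(\<Sum>j. a i * a j * b (i + j)) = (\<Sum>\<^sub>\<infinity>j. f (i, j))"
    and inner_sm: "summable (\<lambda>j. a j * b (i + j))" for i
  proof -
    have *: "summable (\<lambda>j. \<bar>a j * b (i + j)\<bar>)"
      using b by (intro summable_comparison_test'[OF summable_mult[OF a, of B]])
        (auto simp: abs_mult mult.commute[of B] intro: mult_left_mono)
    then show "summable (\<lambda>j. a j * b (i + j))" by (rule summable_rabs_cancel)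
    have "summable (\<lambda>j. norm (f (i, j)))"
      using summable_mult[OF *, of "\<bar>a i\<bar>"] by (simp add: f_def abs_mult mult.assoc)
    from norm_summable_imp_summable_on[OF this]
    have "(\<lambda>j. f (i, j)) sums (\<Sum>\<^sub>\<infinity>j. f (i, j))"
      using has_sum_imp_sums has_sum_infsum by blast
    then show "(\<Sum>j. a i * a j * b (i + j)) = (\<Sum>\<^sub>\<infinity>j. f (i, j))"
      using sums_unique by (fastforce simp: f_def)
  qed
  have eq: "a i * (\<Sum>j. a j * b (i + j)) = (\<Sum>\<^sub>\<infinity>j. f (i, j))" for i
    using inner_sum[of i] suminf_mult[OF inner_sm[of i], of "a i"] by (simp add: mult.assoc)
  have sum_rows: "(\<lambda>i. \<Sum>\<^sub>\<infinity>j. f (i, j)) summable_on UNIV"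
    using summable_on_Sigma_banach[of "\<lambda>i j. f (i, j)" UNIV "\<lambda>_. UNIV"] fabs by simp
  have rows: "(\<lambda>i. a i * (\<Sum>j. a j * b (i + j))) sums (\<Sum>\<^sub>\<infinity>p\<in>UNIV \<times> UNIV. f p)"
    using has_sum_imp_sums[OF has_sum_infsum[OF sum_rows]] infsum_Sigma_banach[OF fabs]
    by (simp add: eq)
  \<comment> \<open>The triangle of pairs (n, i) with i \<le> n corresponds bijectively to all pairs
    (i, j) by j = n - i.\<close>
  let ?D = "Sigma UNIV (\<lambda>n::nat. {..n})"
  let ?g = "\<lambda>(n, i). a i * a (n - i) * b n"
  have inj: "inj_on (\<lambda>(n, i). (i, n - i)) ?D" by (auto simp: inj_on_def)
  have img: "(\<lambda>(n, i). (i, n - i)) ` ?D = UNIV \<times> UNIV"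
  proof -
    have "(i, j) \<in> (\<lambda>(n, i). (i, n - i)) ` ?D" for i j :: nat
      by (rule image_eqI[of _ _ "(i + j, i)"]) auto
    then show ?thesis by auto
  qed
  have comp: "(f \<circ> (\<lambda>(n, i). (i, n - i))) p = ?g p" if "p \<in> ?D" for p
    using that by (auto simp: f_def)
  have gsum: "?g summable_on ?D"
  proof -
    have "(f \<circ> (\<lambda>(n, i). (i, n - i))) summable_on ?D"
      using summable_on_reindex[OF inj, of f] fabs img by simp
    then show ?thesis
      using summable_on_cong[of ?D "f \<circ> (\<lambda>(n, i). (i, n - i))" ?g] comp by blast
  qed
  have ginf: "infsum ?g ?D = (\<Sum>\<^sub>\<infinity>p\<in>UNIV \<times> UNIV. f p)"
    using infsum_reindex[OF inj, of f] infsum_cong[of ?D "f \<circ> (\<lambda>(n, i). (i, n - i))" ?g] comp img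
    by simp
  have fin: "(\<Sum>\<^sub>\<infinity>i\<in>{..n}. ?g (n, i)) = (\<Sum>i\<le>n. a i * a (n - i)) * b n" for n
    by (simp add: infsum_finite sum_distrib_right)
  have "(\<lambda>n. \<Sum>\<^sub>\<infinity>i\<in>{..n}. ?g (n, i)) summable_on UNIV"
    using summable_on_Sigma_banach[of "\<lambda>n i. ?g (n, i)" UNIV "\<lambda>n. {..n}"] gsum by simp
  from has_sum_imp_sums[OF has_sum_infsum[OF this]]
  have "(\<lambda>n. (\<Sum>i\<le>n. a i * a (n - i)) * b n) sums infsum ?g ?D"
    using infsum_Sigma_banach[OF gsum] fin by simp
  then show "(\<Sum>i. a i * (\<Sum>j. a j * b (i + j))) = (\<Sum>n. (\<Sum>i\<le>n. a i * a (n - i)) * b n)"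
    using rows ginf by (simp add: sums_iff)
  show "summable (\<lambda>i. a i * (\<Sum>j. a j * b (i + j)))" using rows by (rule sums_summable)
qed

lemma norm_suminf_le_suminf_norm:
  fixes f :: "nat \<Rightarrow> 'a::{real_normed_vector, complete_space}"
  assumes "summable (\<lambda>n. norm (f n))"
  shows "norm (suminf f) \<le> (\<Sum>n. norm (f n))"
proof (rule LIMSEQ_le)
  show "(\<lambda>n. norm (\<Sum>i<n. f i)) \<longlonglongrightarrow> norm (suminf f)"
    using summable_norm_cancel_complete[OF assms] by (intro tendsto_norm summable_LIMSEQ)
  show "(\<lambda>n. \<Sum>i<n. norm (f i)) \<longlonglongrightarrow> (\<Sum>n. norm (f n))"
    using assms by (rule summable_LIMSEQ)
qed (auto intro: norm_sum)

text \<open>The square root of \<open>1 - X\<close> is the binomial series in \<open>X\<close>, whose coefficients are absolutely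
  summable; this avoids a continuous functional calculus.\<close>

lemma sqrt_operator:
  fixes X :: "'a::{real_inner, complete_space} \<Rightarrow> 'a"
  assumes X: "bounded_linear X" and sym: "\<And>x y. inner (X x) y = inner x (X y)"
    and contr: "\<And>x. norm (X x) \<le> norm x"
  obtains S where "bounded_linear S" "\<And>x y. inner (S x) y = inner x (S y)"
    "\<And>x. 0 \<le> inner (S x) x" "\<And>x. S (S x) = x - X x"
    "\<And>T x. bounded_linear T \<Longrightarrow> (\<And>x. T (X x) = X (T x)) \<Longrightarrow> T (S x) = S (T x)"
proof
  let ?a = sqrt_coeff
  define S where "S = (\<lambda>x. \<Sum>n. ?a n *\<^sub>R (X ^^ n) x)"
  have nX: "norm ((X ^^ n) x) \<le> norm x" for n x
    by (induction n) (auto intro: order_trans[OF contr])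
  have symX: "inner ((X ^^ n) x) y = inner x ((X ^^ n) y)" for n x y
    proof (induction n arbitrary: y)
    case (Suc n)
    then show ?case by (simp add: sym funpow_swap1[of X n y])
  qed simp
  have lin: "bounded_linear (X ^^ n)" for n
  proof (induction n)
    case (Suc n)
    then show ?case using bounded_linear_compose[OF X Suc] by (simp add: o_def)
  qed (simp add: id_def bounded_linear_ident)
  have smn: "summable (\<lambda>n. norm (?a n *\<^sub>R (X ^^ n) x))" for x
    by (rule summable_comparison_test'[OF summable_mult2[OF summable_abs_sqrt_coeff, of "norm x"]])
       (auto intro!: mult_left_mono nX)
  then have sm: "summable (\<lambda>n. ?a n *\<^sub>R (X ^^ n) x)" for x
    by (rule summable_norm_cancel_complete)
  have inS: "inner (S x) v = (\<Sum>n. ?a n * inner ((X ^^ n) x) v)"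
    and smi: "summable (\<lambda>n. ?a n * inner ((X ^^ n) x) v)" for x v
    using bounded_linear.suminf[OF bounded_linear_inner_left[of v] sm[of x]]
      bounded_linear.summable[OF bounded_linear_inner_left[of v] sm[of x]]
    by (simp_all add: S_def)
  show "bounded_linear S"
  proof (rule bounded_linear_intro)
    show "S (x + y) = S x + S y" for x y
      unfolding S_def by (subst suminf_add[OF sm sm])
        (simp add: bounded_linear.axioms(1)[OF lin] linear_add[OF bounded_linear.linear[OF lin]] scaleR_add_right)
    show "S (c *\<^sub>R x) = c *\<^sub>R S x" for c x
      unfolding S_def by (subst suminf_scaleR_right[OF sm])
        (simp add: linear_scale[OF bounded_linear.linear[OF lin]] mult.commute)
    show "norm (S x) \<le> norm x * (\<Sum>n. \<bar>?a n\<bar>)" for x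
    proof -
      have "norm (S x) \<le> (\<Sum>n. norm (?a n *\<^sub>R (X ^^ n) x))"
        unfolding S_def by (rule norm_suminf_le_suminf_norm[OF smn])
      also have "\<dots> \<le> (\<Sum>n. norm x * \<bar>?a n\<bar>)"
        using smn summable_mult[OF summable_abs_sqrt_coeff]
        by (rule suminf_le[rotated]) (simp add: mult.commute[of "norm x"] mult_left_mono nX)
      also have "\<dots> = norm x * (\<Sum>n. \<bar>?a n\<bar>)"
        by (rule suminf_mult[OF summable_abs_sqrt_coeff])
      finally show ?thesis .
    qed
  qed
  show symS: "inner (S x) y = inner x (S y)" for x y
  proof -
    have "inner (S x) y = inner (S y) x"
      unfolding inS by (simp add: symX[of _ x y] inner_commute[of x])
    then show ?thesis by (simp add: inner_commute)
  qed
  \<comment> \<open>The term of index 0 is \<open>(norm x)\<^sup>2\<close>; the remaining terms can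
    cancel at most that much, because their absolute coefficients sum to at most 1.\<close>
  show "0 \<le> inner (S x) x" for x
  proof -
    have sm1: "summable (\<lambda>n. \<bar>?a (Suc n)\<bar>)"
      using summable_abs_sqrt_coeff summable_Suc_iff[of "\<lambda>n. \<bar>?a n\<bar>"] by simp
    have sm2: "summable (\<lambda>n. ?a (Suc n) * inner ((X ^^ Suc n) x) x)"
      using smi[of x x] summable_Suc_iff[of "\<lambda>n. ?a n * inner ((X ^^ n) x) x"] by simp
    have "- ((\<Sum>n. \<bar>?a (Suc n)\<bar>) * (norm x)\<^sup>2) = (\<Sum>n. - (\<bar>?a (Suc n)\<bar> * (norm x)\<^sup>2))"
      by (simp add: suminf_minus[OF summable_mult2[OF sm1]] suminf_mult2[OF sm1])
    also have "\<dots> \<le> (\<Sum>n. ?a (Suc n) * inner ((X ^^ Suc n) x) x)"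
    proof (rule suminf_le[OF _ summable_minus[OF summable_mult2[OF sm1]] sm2])
      fix n
      have "\<bar>inner ((X ^^ Suc n) x) x\<bar> \<le> (norm x)\<^sup>2"
        using Cauchy_Schwarz_ineq2[of "(X ^^ Suc n) x" x] mult_right_mono[OF nX[of "Suc n" x], of "norm x"]
        by (simp add: power2_eq_square)
      then have "\<bar>?a (Suc n) * inner ((X ^^ Suc n) x) x\<bar> \<le> \<bar>?a (Suc n)\<bar> * (norm x)\<^sup>2"
        unfolding abs_mult by (intro mult_left_mono) auto
      then show "- (\<bar>?a (Suc n)\<bar> * (norm x)\<^sup>2) \<le> ?a (Suc n) * inner ((X ^^ Suc n) x) x"
        by linarith
    qed
    also have "\<dots> = inner (S x) x - (norm x)\<^sup>2"
      using suminf_split_head[OF smi[of x x]] by (simp add: inS power2_norm_eq_inner)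
    finally have "(norm x)\<^sup>2 * (1 - (\<Sum>n. \<bar>?a (Suc n)\<bar>)) \<le> inner (S x) x"
      by (simp add: algebra_simps)
    moreover have "0 \<le> (norm x)\<^sup>2 * (1 - (\<Sum>n. \<bar>?a (Suc n)\<bar>))"
      using suminf_abs_sqrt_coeff_Suc_le by (intro mult_nonneg_nonneg) auto
    ultimately show ?thesis by linarith
  qed
  show "S (S x) = x - X x" for x
  proof -
    \<comment> \<open>Testing against \<open>v\<close> turns the operator identity into a scalar
      double series, in which the convolution leaves only the indices 0 and 1.\<close>
    have "inner (S (S x)) v = inner (x - X x) v" for v
    proof -
      let ?b = "\<lambda>n. inner ((X ^^ n) x) v"
      have b: "\<bar>?b n\<bar> \<le> norm x * norm v" for n
        using Cauchy_Schwarz_ineq2[of "(X ^^ n) x" v] mult_right_mono[OF nX[of n x], of "norm v"]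
        by simp
      have "inner ((X ^^ i) (S x)) v = (\<Sum>j. ?a j * ?b (i + j))" for i
      proof -
      have "inner ((X ^^ j) x) ((X ^^ i) v) = ?b (i + j)" for j
        by (simp only: symX[of i "(X ^^ j) x" v, symmetric] funpow_add o_apply)
      then show ?thesis by (simp only: symX[of i "S x"] inS)
    qed
      then have "inner (S (S x)) v = (\<Sum>i. ?a i * (\<Sum>j. ?a j * ?b (i + j)))"
        by (simp add: inS[of "S x"])
      also have "\<dots> = (\<Sum>n. (\<Sum>i\<le>n. ?a i * ?a (n - i)) * ?b n)"
        by (rule suminf_shifted_product(1)[OF summable_abs_sqrt_coeff b])
      also have "\<dots> = (\<Sum>n\<in>{0, 1}. (\<Sum>i\<le>n. ?a i * ?a (n - i)) * ?b n)"
        by (rule suminf_finite) (auto simp: sqrt_coeff_convolution)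
      also have "\<dots> = inner (x - X x) v"
        by (simp only: sqrt_coeff_convolution) (simp add: inner_diff_left)
      finally show ?thesis .
    qed
    then show ?thesis using vector_eq_rdot by blast
  qed
  show "T (S x) = S (T x)" if T: "bounded_linear T" "\<And>x. T (X x) = X (T x)" for T x
  proof -
    have "T ((X ^^ n) x) = (X ^^ n) (T x)" for n
      by (induction n) (auto simp: T(2))
    then show ?thesis
      unfolding S_def
      by (subst bounded_linear.suminf[OF T(1) sm])
         (simp add: linear_scale[OF bounded_linear.linear[OF T(1)]])
  qed
qed

text \<open>\<open>M\<close> is |T| + T for T = B - \<beta>, twice the positive part of T. From T M
  = |T| M the form of T is nonnegative on the range of \<open>M\<close>, while M x = 0 means T x = -
  |T| x.\<close>

lemma spectral_cut:
  fixes B :: "'a::{real_inner, complete_space} \<Rightarrow> 'a"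
  assumes B: "bounded_linear B" and sym: "\<And>x y. inner (B x) y = inner x (B y)"
    and contr: "\<And>x. norm (B x) \<le> norm x"
    and \<beta>: "0 \<le> \<beta>" "\<beta> \<le> 1"
  obtains M where "bounded_linear M" "\<And>x y. inner (M x) y = inner x (M y)"
    "\<And>x. B (M x) = M (B x)"
    "\<And>x. \<beta> * (norm (M x))\<^sup>2 \<le> inner (B (M x)) (M x)"
    "\<And>x. M x = 0 \<Longrightarrow> inner (B x) x \<le> \<beta> * (norm x)\<^sup>2"
proof -
  define T where "T = (\<lambda>x. B x - \<beta> *\<^sub>R x)"
  have T: "bounded_linear T"
    unfolding T_def by (intro bounded_linear_sub B bounded_linear_scaleR_right)
  have linT: "linear T" using T by (rule bounded_linear.linear)
  have linB: "linear B" using B by (rule bounded_linear.linear)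
  have symT: "inner (T x) y = inner x (T y)" for x y
    by (simp add: T_def inner_diff_left inner_diff_right sym)
  have nT: "norm (T x) \<le> 2 * norm x" for x
  proof -
    have "norm (T x) \<le> norm (B x) + \<beta> * norm x"
      using norm_triangle_ineq4[of "B x" "\<beta> *\<^sub>R x"] \<beta> by (simp add: T_def)
    also have "\<dots> \<le> norm x + 1 * norm x"
      using \<beta> by (intro add_mono contr mult_right_mono) auto
    finally show ?thesis by simp
  qed
  \<comment> \<open>Chosen so that 1 - X is a quarter of T squared. Since T has norm at most 2, the
    factor 1/4 keeps \<open>X\<close> a contraction; the root \<open>S\<close> is |T|/2, whence the
    factor 2 in \<open>M\<close>.\<close>
  define X where "X = (\<lambda>x. x - (1/4) *\<^sub>R T (T x))"
  have X: "bounded_linear X"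
    unfolding X_def
    by (intro bounded_linear_sub bounded_linear_ident
        bounded_linear_compose[OF bounded_linear_scaleR_right] bounded_linear_compose[OF T] T)
  have symX: "inner (X x) y = inner x (X y)" for x y
    by (simp add: X_def inner_diff_left inner_diff_right symT)
  have nX: "norm (X x) \<le> norm x" for x
  proof -
    have "(norm (X x))\<^sup>2 = (norm x)\<^sup>2 - (1/2) * (norm (T x))\<^sup>2 + (1/16) * (norm (T (T x)))\<^sup>2"
      using symT[of x "T x"] symT[of "T x" x]
      by (simp add: X_def power2_norm_eq_inner inner_diff_left inner_diff_right diff_divide_distrib)
    moreover have "(norm (T (T x)))\<^sup>2 \<le> (2 * norm (T x))\<^sup>2"
      by (intro power_mono nT) auto
    moreover have "(2::real)\<^sup>2 = 4" by simp
    ultimately have "(norm (X x))\<^sup>2 \<le> (norm x)\<^sup>2"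
      using zero_le_power2[of "norm (T x)"]
      by (simp only: power_mult_distrib)
    then show ?thesis by (rule power2_le_imp_le) simp
  qed
  obtain S where S: "bounded_linear S" "\<And>x y. inner (S x) y = inner x (S y)"
    "\<And>x. 0 \<le> inner (S x) x" "\<And>x. S (S x) = x - X x"
    "\<And>T x. bounded_linear T \<Longrightarrow> (\<And>x. T (X x) = X (T x)) \<Longrightarrow> T (S x) = S (T x)"
    using sqrt_operator[OF X symX nX] by blast
  have linS: "linear S" using S(1) by (rule bounded_linear.linear)
  have BT: "B (T x) = T (B x)" for x
    by (simp add: T_def linear_diff[OF linB] linear_scale[OF linB])
  have TX: "T (X x) = X (T x)" for x
    by (simp add: X_def linear_diff[OF linT] linear_scale[OF linT])
  have BX: "B (X x) = X (B x)" for x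
    by (simp add: X_def linear_diff[OF linB] linear_scale[OF linB] BT)
  define M where "M = (\<lambda>x. 2 *\<^sub>R S x + T x)"
  have TM: "T (M x) = 2 *\<^sub>R S (M x)" for x
  proof -
    have "4 *\<^sub>R S (S x) = T (T x)" by (simp add: S(4) X_def)
    then show ?thesis
      using S(5)[OF T TX, of x]
      by (simp add: M_def linear_add[OF linT] linear_add[OF linS] linear_scale[OF linT]
          linear_scale[OF linS] scaleR_add_right)
  qed
  show ?thesis
  proof (rule that)
    show "bounded_linear M"
      unfolding M_def
      by (intro bounded_linear_add T bounded_linear_compose[OF bounded_linear_scaleR_right] S(1))
    show "inner (M x) y = inner x (M y)" for x y
      by (simp add: M_def inner_add_left inner_add_right S(2) symT)
    show "B (M x) = M (B x)" for x
      using S(5)[OF B BX, of x]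
      by (simp add: M_def linear_add[OF linB] linear_scale[OF linB] BT)
    show "\<beta> * (norm (M x))\<^sup>2 \<le> inner (B (M x)) (M x)" for x
    proof -
      have "0 \<le> inner (T (M x)) (M x)" using S(3)[of "M x"] by (simp add: TM)
      then show ?thesis by (simp add: T_def inner_diff_left power2_norm_eq_inner)
    qed
    show "inner (B x) x \<le> \<beta> * (norm x)\<^sup>2" if "M x = 0" for x
    proof -
      have "T x = - (2 *\<^sub>R S x)" using that by (simp add: M_def eq_neg_iff_add_eq_0 add.commute)
      then have "inner (T x) x \<le> 0" using S(3)[of x] by simp
      then show ?thesis by (simp add: T_def inner_diff_left power2_norm_eq_inner)
    qed
  qed
qed

section \<open>Spectral subspaces of a nonnegative self-adjoint operator\<close>

text \<open>Log-convexity makes successive ratios nondecreasing, so a first ratio above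
  \<open>r\<close> would force geometric growth faster than C r^k.\<close>

lemma log_convex_growth:
  fixes a :: "nat \<Rightarrow> real"
  assumes nn: "\<And>k. 0 \<le> a k" and conv: "\<And>k. (a (Suc k))\<^sup>2 \<le> a k * a (Suc (Suc k))"
    and le: "\<And>k. a k \<le> C * r ^ k" and r: "0 \<le> r"
  shows "a 1 \<le> r * a 0"
proof (rule ccontr)
  assume "\<not> ?thesis"
  then have gt: "r * a 0 < a 1" by simp
  have "a 0 \<noteq> 0"
  proof
    assume "a 0 = 0"
    with conv[of 0] have "a 1 = 0" by simp
    with gt \<open>a 0 = 0\<close> show False by simp
  qed
  with nn[of 0] have a0: "a 0 > 0" by simp
  define q where "q = a 1 / a 0"
  have q: "q > r" using gt a0 by (simp add: q_def field_simps)
  have step: "0 < a k \<and> q * a k \<le> a (Suc k)" for k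
  proof (induction k)
    case 0 then show ?case using a0 by (simp add: q_def)
  next
    case (Suc k)
    then have pos: "0 < a (Suc k)" using q r by (smt (verit) mult_pos_pos)
    have "(q * a k) * a (Suc k) \<le> a (Suc k) * a (Suc k)"
      using Suc pos by (intro mult_right_mono) auto
    also have "\<dots> \<le> a k * a (Suc (Suc k))" using conv[of k] by (simp add: power2_eq_square)
    finally have "a k * (q * a (Suc k)) \<le> a k * a (Suc (Suc k))" by (simp add: algebra_simps)
    then show ?case using Suc pos by simp
  qed
  have pow: "q ^ k * a 0 \<le> a k" for k
  proof (induction k)
    case (Suc k)
    have "q ^ Suc k * a 0 = q * (q ^ k * a 0)" by simp
    also have "\<dots> \<le> q * a k" using Suc q r by (intro mult_left_mono) auto
    also have "\<dots> \<le> a (Suc k)" using step by blast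
    finally show ?case .
  qed simp
  show False
  proof (cases "r = 0")
    case True
    have "q * a 0 > 0" using a0 q True by simp
    then show False using pow[of 1] le[of 1] True by simp
  next
    case False
    then have r0: "r > 0" using r by simp
    then have "1 < q / r" using q by simp
    then obtain k where k: "C / a 0 < (q / r) ^ k" using real_arch_pow by blast
    have "q ^ k * a 0 \<le> C * r ^ k" using pow[of k] le[of k] by linarith
    then have "(q / r) ^ k \<le> C / a 0" using r0 a0 by (simp add: power_divide field_simps)
    with k show False by simp
  qed
qed

lemma subspace_closure_normed:
  fixes S :: "'a::real_normed_vector set"
  assumes S: "subspace S"
  shows "subspace (closure S)"
proof (rule subspaceI)
  show "0 \<in> closure S" using subspace_0[OF S] closure_subset by blast
  fix x assume "x \<in> closure S"
  then obtain f where f: "\<And>n. f n \<in> S" "f \<longlonglongrightarrow> x" unfolding closure_sequential by blast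
  show "c *\<^sub>R x \<in> closure S" for c
    unfolding closure_sequential
    using f subspace_scale[OF S] by (intro exI[of _ "\<lambda>n. c *\<^sub>R f n"]) (auto intro: tendsto_intros)
  fix y assume "y \<in> closure S"
  then obtain g where g: "\<And>n. g n \<in> S" "g \<longlonglongrightarrow> y" unfolding closure_sequential by blast
  show "x + y \<in> closure S"
    unfolding closure_sequential
    using f g subspace_add[OF S] by (intro exI[of _ "\<lambda>n. f n + g n"]) (auto intro: tendsto_intros)
qed

text \<open>Symmetry together with \<open>adjoint\<close> is self-adjointness. Only the real inner
  product enters; the complex structure is added where entire functions appear.\<close>

locale nonneg_self_adjoint =
  fixes D :: "'a::{real_inner, complete_space} set" and A :: "'a \<Rightarrow> 'a"
  assumes subspace_D: "subspace D"
    and A_add: "\<And>x y. x \<in> D \<Longrightarrow> y \<in> D \<Longrightarrow> A (x + y) = A x + A y"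
    and A_scaleR: "\<And>x c. x \<in> D \<Longrightarrow> A (c *\<^sub>R x) = c *\<^sub>R A x"
    and dense: "closure D = UNIV"
    and adjoint: "adjoint_dom D A = D"
    and A_sym: "\<And>x y. x \<in> D \<Longrightarrow> y \<in> D \<Longrightarrow> inner (A x) y = inner x (A y)"
    and A_nonneg: "\<And>x. x \<in> D \<Longrightarrow> 0 \<le> inner (A x) x"
begin

section \<open>Closedness and the resolvent at -1\<close>

lemma A_diff: "x \<in> D \<Longrightarrow> y \<in> D \<Longrightarrow> A (x - y) = A x - A y"
  using A_add[of x "(-1) *\<^sub>R y"] A_scaleR[of y "-1"] subspace_scale[OF subspace_D, of y "-1"] by simp

lemma A_zero [simp]: "A 0 = 0"
  using A_scaleR[OF subspace_0[OF subspace_D], of 0] by simp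

lemma eq_0_of_orthogonal_domain:
  assumes "\<And>d. d \<in> D \<Longrightarrow> inner d w = 0"
  shows "w = 0"
proof -
  have "closed {x. inner x w = 0}"
    by (intro closed_Collect_eq continuous_intros)
  then have "closure D \<subseteq> {x. inner x w = 0}"
    using assms by (intro closure_minimal) auto
  then have "w \<in> {x. inner x w = 0}" using dense by blast
  then show ?thesis by simp
qed

text \<open>\<open>A\<close> equals its adjoint, and adjoints are closed:
  \<open>inner (A d) x = inner d z\<close> survives limits for each fixed \<open>d\<close> in
  \<open>D\<close>.\<close>

lemma A_closed:
  assumes u: "\<And>n. u n \<in> D" "u \<longlonglongrightarrow> x" "(\<lambda>n. A (u n)) \<longlonglongrightarrow> z"
  shows "x \<in> D" "A x = z"
proof -
  have eq: "inner (A d) x = inner d z" if d: "d \<in> D" for d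
  proof (rule LIMSEQ_unique)
    show "(\<lambda>n. inner (A d) (u n)) \<longlonglongrightarrow> inner (A d) x" by (intro tendsto_intros u)
    show "(\<lambda>n. inner (A d) (u n)) \<longlonglongrightarrow> inner d z"
      by (simp add: A_sym[OF d u(1)]) (intro tendsto_intros u)
  qed
  then have "x \<in> adjoint_dom D A" unfolding adjoint_dom_def by blast
  then show x: "x \<in> D" by (simp add: adjoint)
  have "A x - z = 0"
  proof (rule eq_0_of_orthogonal_domain)
    fix d assume "d \<in> D"
    then show "inner d (A x - z) = 0"
      using eq A_sym[of d x] x by (simp add: inner_diff_right)
  qed
  then show "A x = z" by simp
qed

lemma norm_le_one_plus_A:
  assumes "x \<in> D"
  shows "norm x \<le> norm (x + A x)"
proof (rule power2_le_imp_le)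
  have "(norm (x + A x))\<^sup>2 = (norm x)\<^sup>2 + 2 * inner (A x) x + (norm (A x))\<^sup>2"
    by (simp add: power2_norm_eq_inner inner_add_left inner_add_right inner_commute)
  then show "(norm x)\<^sup>2 \<le> (norm (x + A x))\<^sup>2" using A_nonneg[OF assms] by simp
qed simp

text \<open>The range is closed because 1 + A does not shrink norms and \<open>A\<close> is closed.
  A residue \<open>y\<close> orthogonal to the range satisfies A y = - y weakly, so self-adjointness
  puts it into \<open>D\<close> and nonnegativity makes it 0.\<close>

lemma one_plus_A_surj: "\<exists>x\<in>D. x + A x = w"
proof -
  define R where "R = (\<lambda>x. x + A x) ` D"
  have sub: "subspace R"
  proof (rule subspaceI)
    show "0 \<in> R" unfolding R_def using subspace_0[OF subspace_D] by (intro image_eqI[of _ _ 0]) auto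
    fix x assume "x \<in> R"
    then obtain x' where x': "x' \<in> D" "x = x' + A x'" by (auto simp: R_def)
    show "c *\<^sub>R x \<in> R" for c
      unfolding R_def using x' subspace_scale[OF subspace_D]
      by (intro image_eqI[of _ _ "c *\<^sub>R x'"]) (auto simp: A_scaleR scaleR_add_right)
    fix y assume "y \<in> R"
    then obtain y' where y': "y' \<in> D" "y = y' + A y'" by (auto simp: R_def)
    show "x + y \<in> R"
      unfolding R_def using x' y' subspace_add[OF subspace_D]
      by (intro image_eqI[of _ _ "x' + y'"]) (auto simp: A_add)
  qed
  have "closed R"
    unfolding closed_sequential_limits
  proof (intro allI impI)
    fix f l assume "(\<forall>n. f n \<in> R) \<and> f \<longlonglongrightarrow> l"
    then have f: "\<And>n. f n \<in> R" and l: "f \<longlonglongrightarrow> l" by auto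
    from f have "\<exists>u. u \<in> D \<and> f n = u + A u" for n by (auto simp: R_def)
    then obtain u where u: "\<And>n. u n \<in> D" "\<And>n. f n = u n + A (u n)" by metis
    have "norm (u m - u n) \<le> norm (f m - f n)" for m n
      using norm_le_one_plus_A[OF subspace_diff[OF subspace_D u(1)[of m] u(1)[of n]]]
      by (simp add: A_diff u algebra_simps)
    then have "Cauchy u"
      using LIMSEQ_imp_Cauchy[OF l] unfolding Cauchy_def dist_norm by (meson le_less_trans)
    then obtain x where x: "u \<longlonglongrightarrow> x" using Cauchy_convergent convergent_def by blast
    have "(\<lambda>n. f n - u n) \<longlonglongrightarrow> l - x" by (intro tendsto_diff l x)
    then have "(\<lambda>n. A (u n)) \<longlonglongrightarrow> l - x" by (simp add: u(2))
    from A_closed[OF u(1) x this] show "l \<in> R" unfolding R_def by (intro image_eqI[of _ _ x]) auto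
  qed
  define y where "y = w - proj R w"
  have orth: "inner y (d + A d) = 0" if "d \<in> D" for d
    using inner_diff_proj[OF sub \<open>closed R\<close>, of "d + A d" w] that by (auto simp: y_def R_def)
  have "inner (A d) y = inner d (- y)" if "d \<in> D" for d
    using orth[OF that] by (simp add: inner_add_right inner_commute eq_neg_iff_add_eq_0 add.commute)
  then have y: "y \<in> D" using adjoint unfolding adjoint_dom_def by blast
  have "inner y (y + A y) = 0" using orth y by blast
  then have "(norm y)\<^sup>2 \<le> 0"
    using A_nonneg[OF y] by (simp add: inner_add_right inner_commute power2_norm_eq_inner)
  then have "w \<in> R" using proj_mem[OF sub \<open>closed R\<close>, of w] by (simp add: y_def)
  then show ?thesis by (auto simp: R_def)
qed

lemma resolvent:
  obtains B where "bounded_linear B" "\<And>x y. inner (B x) y = inner x (B y)"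
    "\<And>x. 0 \<le> inner (B x) x" "\<And>x. norm (B x) \<le> norm x"
    "\<And>x. B x \<in> D" "\<And>x. B x + A (B x) = x" "\<And>x. x \<in> D \<Longrightarrow> B (x + A x) = x"
proof -
  obtain B where B: "\<And>x. B x \<in> D" "\<And>x. B x + A (B x) = x"
    using one_plus_A_surj by metis
  have inj: "x = y" if "x \<in> D" "y \<in> D" "x + A x = y + A y" for x y
  proof -
    have "(x - y) + A (x - y) = 0" using that by (simp add: A_diff algebra_simps)
    then show ?thesis using norm_le_one_plus_A[OF subspace_diff[OF subspace_D that(1,2)]] by simp
  qed
  have inv: "B (x + A x) = x" if "x \<in> D" for x
    using inj[OF B(1) that B(2)] .
  have nB: "norm (B x) \<le> norm x" for x
    using norm_le_one_plus_A[OF B(1), of x] by (simp add: B(2))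
  have add: "B (x + y) = B x + B y" for x y
  proof (rule inj)
    show "B x + B y \<in> D" by (intro subspace_add subspace_D B)
    have "B x + B y + A (B x + B y) = (B x + A (B x)) + (B y + A (B y))"
      by (simp add: A_add B(1))
    then show "B (x + y) + A (B (x + y)) = B x + B y + A (B x + B y)" by (simp only: B(2))
  qed (rule B)
  have scale: "B (c *\<^sub>R x) = c *\<^sub>R B x" for c x
  proof (rule inj)
    show "c *\<^sub>R B x \<in> D" by (intro subspace_scale subspace_D B)
    have "c *\<^sub>R B x + A (c *\<^sub>R B x) = c *\<^sub>R (B x + A (B x))"
      by (simp add: A_scaleR B(1) scaleR_add_right)
    then show "B (c *\<^sub>R x) + A (B (c *\<^sub>R x)) = c *\<^sub>R B x + A (c *\<^sub>R B x)" by (simp only: B(2))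
  qed (rule B)
  have "inner (B x) y = inner x (B y)" for x y
    using A_sym[OF B(1)[of x] B(1)[of y]] B(2)[of x] B(2)[of y]
    by (metis inner_add_left inner_add_right)
  moreover have "0 \<le> inner (B x) x" for x
    using A_nonneg[OF B(1)[of x]] inner_ge_zero[of "B x"] B(2)[of x]
    by (metis add_nonneg_nonneg inner_add_left inner_commute)
  moreover have "bounded_linear B"
    by (rule bounded_linear_intro[of _ 1]) (auto simp: add scale nB)
  ultimately show ?thesis using that nB B inv by blast
qed

text \<open>For spectral measure \<open>E\<close> of \<open>A\<close> this is the range of \<open>E [0, r]\<close>.\<close>

definition exp_vectors :: "real \<Rightarrow> 'a set" where
  "exp_vectors r = {f. \<forall>k. (A ^^ k) f \<in> D \<and> norm ((A ^^ k) f) \<le> r ^ k * norm f}"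

lemma exp_vectors_domain: "f \<in> exp_vectors r \<Longrightarrow> f \<in> D"
  using spec[of "\<lambda>k. (A ^^ k) f \<in> D \<and> norm ((A ^^ k) f) \<le> r ^ k * norm f" 0]
  by (simp add: exp_vectors_def)

lemma norm_A_exp_vectors_le: "f \<in> exp_vectors r \<Longrightarrow> norm (A f) \<le> r * norm f"
  using spec[of "\<lambda>k. (A ^^ k) f \<in> D \<and> norm ((A ^^ k) f) \<le> r ^ k * norm f" 1]
  by (simp add: exp_vectors_def)

text \<open>By symmetry \<open>(norm ((A ^^ Suc k) f))\<^sup>2\<close> is the inner product of the
  neighbouring powers, so Cauchy-Schwarz makes the norms log-convex.\<close>

lemma A_funpow_norm_step:
  assumes dom: "\<And>k. (A ^^ k) f \<in> D" and le: "\<And>k. norm ((A ^^ k) f) \<le> C * r ^ k" and r: "0 \<le> r"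
  shows "norm (A f) \<le> r * norm f"
proof -
  have "(norm ((A ^^ Suc k) f))\<^sup>2 \<le> norm ((A ^^ k) f) * norm ((A ^^ Suc (Suc k)) f)" for k
  proof -
    have "(norm ((A ^^ Suc k) f))\<^sup>2 = inner ((A ^^ k) f) ((A ^^ Suc (Suc k)) f)"
      using A_sym[OF dom[of k] dom[of "Suc k"]] by (simp add: power2_norm_eq_inner)
    also have "\<dots> \<le> norm ((A ^^ k) f) * norm ((A ^^ Suc (Suc k)) f)"
      by (rule norm_cauchy_schwarz)
    finally show ?thesis .
  qed
  from log_convex_growth[of "\<lambda>k. norm ((A ^^ k) f)", OF _ this le r] show ?thesis by simp
qed

text \<open>The constant \<open>C\<close> is arbitrary: the one-step bound applies to every
  \<open>(A ^^ k) f\<close>, with constant \<open>C * r ^ k\<close>, and iterating it produces the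
  constant \<open>norm f\<close>. Closure under addition depends on this, since a sum only comes
  with the constant \<open>norm x + norm y\<close>.\<close>

lemma exp_vectorsI:
  assumes dom: "\<And>k. (A ^^ k) f \<in> D" and le: "\<And>k. norm ((A ^^ k) f) \<le> C * r ^ k" and r: "0 \<le> r"
  shows "f \<in> exp_vectors r"
proof -
  have step: "norm (A ((A ^^ k) f)) \<le> r * norm ((A ^^ k) f)" for k
  proof (rule A_funpow_norm_step[OF _ _ r])
    show "(A ^^ j) ((A ^^ k) f) \<in> D" for j using dom[of "j + k"] by (simp add: funpow_add)
    show "norm ((A ^^ j) ((A ^^ k) f)) \<le> (C * r ^ k) * r ^ j" for j
      using le[of "j + k"] by (simp add: funpow_add power_add mult_ac)
  qed
  have "norm ((A ^^ k) f) \<le> r ^ k * norm f" for k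
  proof (induction k)
    case (Suc k)
    have "norm ((A ^^ Suc k) f) \<le> r * norm ((A ^^ k) f)" using step[of k] by simp
    also have "\<dots> \<le> r * (r ^ k * norm f)" using Suc r by (rule mult_left_mono)
    finally show ?case by simp
  qed simp
  then show ?thesis using dom by (simp add: exp_vectors_def)
qed

lemma exp_vectors_A:
  assumes "f \<in> exp_vectors r" "0 \<le> r"
  shows "A f \<in> exp_vectors r"
proof (rule exp_vectorsI[OF _ _ assms(2)])
  fix k
  show "(A ^^ k) (A f) \<in> D" "norm ((A ^^ k) (A f)) \<le> (r * norm f) * r ^ k"
    using spec[of "\<lambda>k. (A ^^ k) f \<in> D \<and> norm ((A ^^ k) f) \<le> r ^ k * norm f" "Suc k"] assms(1)
    by (simp_all add: exp_vectors_def funpow_swap1 mult_ac)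
qed

lemma exp_vectors_funpow: "f \<in> exp_vectors r \<Longrightarrow> 0 \<le> r \<Longrightarrow> (A ^^ k) f \<in> exp_vectors r"
  by (induction k) (auto simp: exp_vectors_A)

lemma funpow_A_add:
  assumes "\<And>j. j < k \<Longrightarrow> (A ^^ j) x \<in> D" "\<And>j. j < k \<Longrightarrow> (A ^^ j) y \<in> D"
  shows "(A ^^ k) (x + y) = (A ^^ k) x + (A ^^ k) y"
  using assms by (induction k) (auto simp: A_add)

lemma funpow_A_scaleR:
  assumes "\<And>j. j < k \<Longrightarrow> (A ^^ j) x \<in> D"
  shows "(A ^^ k) (c *\<^sub>R x) = c *\<^sub>R (A ^^ k) x"
  using assms by (induction k) (auto simp: A_scaleR)

lemma exp_vectorsD: "f \<in> exp_vectors r \<Longrightarrow> (A ^^ k) f \<in> D"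
  "f \<in> exp_vectors r \<Longrightarrow> norm ((A ^^ k) f) \<le> r ^ k * norm f"
  by (auto simp: exp_vectors_def)

lemma subspace_exp_vectors:
  assumes r: "0 \<le> r"
  shows "subspace (exp_vectors r)"
proof (rule subspaceI)
  have z: "(A ^^ k) 0 = 0" for k by (induction k) auto
  show "0 \<in> exp_vectors r" using subspace_0[OF subspace_D] by (auto simp: exp_vectors_def z)
  fix x assume x: "x \<in> exp_vectors r"
  show "c *\<^sub>R x \<in> exp_vectors r" for c
    using exp_vectorsD[OF x] subspace_scale[OF subspace_D]
    by (auto simp: exp_vectors_def funpow_A_scaleR mult.left_commute intro: mult_left_mono)
  fix y assume y: "y \<in> exp_vectors r"
  show "x + y \<in> exp_vectors r"
  proof (rule exp_vectorsI[OF _ _ r])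
    fix k
    have eq: "(A ^^ k) (x + y) = (A ^^ k) x + (A ^^ k) y"
      using x y by (intro funpow_A_add exp_vectorsD(1))
    show "(A ^^ k) (x + y) \<in> D"
      unfolding eq by (intro subspace_add subspace_D exp_vectorsD(1)[OF x] exp_vectorsD(1)[OF y])
    have "norm ((A ^^ k) (x + y)) \<le> norm ((A ^^ k) x) + norm ((A ^^ k) y)"
      unfolding eq by (rule norm_triangle_ineq)
    also have "\<dots> \<le> r ^ k * norm x + r ^ k * norm y"
      by (intro add_mono exp_vectorsD(2) x y)
    finally show "norm ((A ^^ k) (x + y)) \<le> (norm x + norm y) * r ^ k"
      by (simp add: algebra_simps)
  qed
qed

text \<open>On this subspace \<open>A\<close> is bounded, so images of a convergent sequence are
  Cauchy; closedness of \<open>A\<close> identifies their limits, one power at a time.\<close>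

lemma closed_exp_vectors:
  assumes r: "0 \<le> r"
  shows "closed (exp_vectors r)"
  unfolding closed_sequential_limits
proof (intro allI impI)
  fix f l assume "(\<forall>n. f n \<in> exp_vectors r) \<and> f \<longlonglongrightarrow> l"
  then have f: "\<And>n. f n \<in> exp_vectors r" and l: "f \<longlonglongrightarrow> l" by auto
  have step: "x \<in> D \<and> (\<lambda>n. A (u n)) \<longlonglongrightarrow> A x"
    if u: "\<And>n. u n \<in> exp_vectors r" and x: "u \<longlonglongrightarrow> x" for u x
  proof -
    have ud: "u n \<in> D" for n using u exp_vectors_domain by blast
    have le: "norm (A (u m) - A (u n)) \<le> r * norm (u m - u n)" for m n
      using norm_A_exp_vectors_le[OF subspace_diff[OF subspace_exp_vectors[OF r] u u], of m n]
      by (simp add: A_diff ud)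
    have "Cauchy (\<lambda>n. A (u n))"
    proof (rule metric_CauchyI)
      fix e :: real assume e: "e > 0"
      \<comment> \<open>Dividing by \<open>r + 1\<close> instead of \<open>r\<close> covers r =
        0.\<close>
      then have "e / (r + 1) > 0" using r by simp
      then obtain N where N: "\<And>m n. m \<ge> N \<Longrightarrow> n \<ge> N \<Longrightarrow> norm (u m - u n) < e / (r + 1)"
        using LIMSEQ_imp_Cauchy[OF x] unfolding Cauchy_def dist_norm by metis
      have "norm (A (u m) - A (u n)) < e" if "m \<ge> N" "n \<ge> N" for m n
      proof -
        have "norm (A (u m) - A (u n)) \<le> r * norm (u m - u n)" by (rule le)
        also have "\<dots> \<le> (r + 1) * norm (u m - u n)" by (intro mult_right_mono) auto
        also have "\<dots> < e" using N[OF that] r by (simp add: field_simps)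
        finally show ?thesis .
      qed
      then show "\<exists>M. \<forall>m\<ge>M. \<forall>n\<ge>M. dist (A (u m)) (A (u n)) < e"
        unfolding dist_norm by blast
    qed
    then obtain z where z: "(\<lambda>n. A (u n)) \<longlonglongrightarrow> z" using Cauchy_convergent convergent_def by blast
    from A_closed[OF ud x z] z show ?thesis by simp
  qed
  have lim: "(\<lambda>n. (A ^^ k) (f n)) \<longlonglongrightarrow> (A ^^ k) l" for k
  proof (induction k)
    case (Suc k)
    with step[of "\<lambda>n. (A ^^ k) (f n)", OF exp_vectors_funpow[OF f r]] show ?case by simp
  qed (use l in simp)
  have "(A ^^ k) l \<in> D" for k
    using step[of "\<lambda>n. (A ^^ k) (f n)", OF exp_vectors_funpow[OF f r] lim] by blast
  moreover have "norm ((A ^^ k) l) \<le> r ^ k * norm l" for k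
  proof (rule LIMSEQ_le)
    show "(\<lambda>n. norm ((A ^^ k) (f n))) \<longlonglongrightarrow> norm ((A ^^ k) l)" by (intro tendsto_norm lim)
    show "(\<lambda>n. r ^ k * norm (f n)) \<longlonglongrightarrow> r ^ k * norm l" by (intro tendsto_intros l)
  qed (use exp_vectorsD(2)[OF f] in blast)
  ultimately show "l \<in> exp_vectors r" by (simp add: exp_vectors_def)
qed

section \<open>Projections onto the spectral subspaces and the spectral gap\<close>

abbreviation P :: "real \<Rightarrow> 'a \<Rightarrow> 'a" where
  "P r \<equiv> proj (exp_vectors r)"

lemma exp_vectors_mono: "0 \<le> r \<Longrightarrow> r \<le> s \<Longrightarrow> exp_vectors r \<subseteq> exp_vectors s"
  unfolding exp_vectors_def by (auto intro: order_trans[OF _ mult_right_mono[OF power_mono]])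

context
  fixes r :: real
  assumes r0: "0 \<le> r"
begin

lemmas P_mem = proj_mem[OF subspace_exp_vectors[OF r0] closed_exp_vectors[OF r0]]
lemmas inner_diff_P = inner_diff_proj[OF subspace_exp_vectors[OF r0] closed_exp_vectors[OF r0]]
lemmas P_id = proj_id[OF subspace_exp_vectors[OF r0] closed_exp_vectors[OF r0]]
lemmas norm_P_le = norm_proj_le[OF subspace_exp_vectors[OF r0] closed_exp_vectors[OF r0]]
lemmas norm_diff_P_le = norm_diff_proj_le[OF subspace_exp_vectors[OF r0] closed_exp_vectors[OF r0]]
lemmas bounded_linear_P = bounded_linear_proj[OF subspace_exp_vectors[OF r0] closed_exp_vectors[OF r0]]
lemmas P_add = proj_add[OF subspace_exp_vectors[OF r0] closed_exp_vectors[OF r0]]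
lemmas P_diff = proj_diff[OF subspace_exp_vectors[OF r0] closed_exp_vectors[OF r0]]
lemmas P_scaleR = proj_scaleR[OF subspace_exp_vectors[OF r0] closed_exp_vectors[OF r0]]
lemmas inner_P_commute = inner_proj_commute[OF subspace_exp_vectors[OF r0] closed_exp_vectors[OF r0]]
lemmas norm_diff_P_minimal = norm_diff_proj_minimal[OF subspace_exp_vectors[OF r0] closed_exp_vectors[OF r0]]

lemma P_domain: "P r x \<in> D"
  using P_mem exp_vectors_domain by blast

text \<open>The difference \<open>?w\<close> of both sides lies in the subspace, and so does
  \<open>A ?w\<close>; moving \<open>A\<close> and \<open>P r\<close> across the inner product shows
  that \<open>?w\<close> is orthogonal to itself.\<close>

lemma P_A: "g \<in> D \<Longrightarrow> P r (A g) = A (P r g)"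
proof -
  assume g: "g \<in> D"
  let ?w = "P r (A g) - A (P r g)"
  have w: "?w \<in> exp_vectors r"
    by (intro subspace_diff subspace_exp_vectors exp_vectors_A P_mem r0)
  then have wd: "?w \<in> D" and Aw: "A ?w \<in> exp_vectors r"
    using exp_vectors_domain exp_vectors_A r0 by blast+
  have "inner (P r (A g)) ?w = inner g (A ?w)"
    by (simp add: inner_P_commute P_id w A_sym g wd)
  also have "\<dots> = inner (A (P r g)) ?w"
    using inner_P_commute[of g "A ?w"] P_id[OF Aw] A_sym[OF P_domain wd] by simp
  finally have "inner ?w ?w = 0" by (simp add: inner_diff_left)
  then show ?thesis by simp
qed

text \<open>The bounded substitute for \<open>A\<close>: integrals, derivatives and series pass
  through it.\<close>

lemma bounded_linear_A_P: "bounded_linear (\<lambda>x. A (P r x))"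
proof (rule bounded_linear_intro)
  show "norm (A (P r x)) \<le> norm x * r" for x
    using norm_A_exp_vectors_le[OF P_mem, of x] mult_left_mono[OF norm_P_le r0, of x]
    by (simp add: mult.commute)
qed (simp_all add: P_add P_scaleR A_add A_scaleR P_domain)

text \<open>The positive part \<open>M\<close> of \<open>B - 1/(1+r)\<close>, where \<open>B = (1+A)\<^sup>-\<^sup>1\<close>, has range in \<open>exp_vectors r\<close>;
  on the orthogonal complement it vanishes, so \<open>B \<le> 1/(1+r)\<close> there.\<close>

lemma spectral_gap:
  assumes r1: "1 \<le> r" and g: "g \<in> D" and orth: "\<And>h. h \<in> exp_vectors r \<Longrightarrow> inner g h = 0"
  shows "r * norm g \<le> norm (A g)"
proof -
  obtain B where B: "bounded_linear B" "\<And>x y. inner (B x) y = inner x (B y)"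
    "\<And>x. 0 \<le> inner (B x) x" "\<And>x. norm (B x) \<le> norm x"
    "\<And>x. B x \<in> D" "\<And>x. B x + A (B x) = x" "\<And>x. x \<in> D \<Longrightarrow> B (x + A x) = x"
    using resolvent by blast
  have linB: "linear B" using B(1) by (rule bounded_linear.linear)
  \<comment> \<open>The image of r under the map from \<lambda> to 1/(1 + \<lambda>) that carries
    \<open>A\<close> to \<open>B\<close>; it reverses order, so B above \<beta> means A below
    r.\<close>
  define \<beta> where "\<beta> = 1 / (1 + r)"
  have \<beta>: "0 < \<beta>" "\<beta> < 1" using r1 by (auto simp: \<beta>_def)
  obtain M where M: "bounded_linear M" "\<And>x y. inner (M x) y = inner x (M y)"
    "\<And>x. B (M x) = M (B x)"
    "\<And>x. \<beta> * (norm (M x))\<^sup>2 \<le> inner (B (M x)) (M x)"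
    "\<And>x. M x = 0 \<Longrightarrow> inner (B x) x \<le> \<beta> * (norm x)\<^sup>2"
    using spectral_cut[OF B(1,2,4), of \<beta>] \<beta> by (metis less_imp_le)
  define L where "L = closure (range M)"
  have subL: "subspace L"
    unfolding L_def by (intro subspace_closure_normed linear_subspace_image[OF bounded_linear.linear[OF M(1)]]) simp
  have BL: "B x \<in> L" if "x \<in> L" for x
  proof -
    have "B ` closure (range M) \<subseteq> closure (B ` range M)"
      by (rule closure_bounded_linear_image_subset[OF B(1)])
    also have "\<dots> \<subseteq> L" unfolding L_def by (intro closure_mono) (auto simp: M(3))
    finally show ?thesis using that by (auto simp: L_def)
  qed
  have formL: "\<beta> * (norm x)\<^sup>2 \<le> inner (B x) x" if "x \<in> L" for x
  proof -
    have "closed {x. \<beta> * (norm x)\<^sup>2 \<le> inner (B x) x}"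
      by (intro closed_Collect_le continuous_intros bounded_linear.continuous_on[OF B(1)])
    then have "L \<subseteq> {x. \<beta> * (norm x)\<^sup>2 \<le> inner (B x) x}"
      unfolding L_def by (intro closure_minimal) (auto simp: M(4))
    then show ?thesis using that by auto
  qed
  \<comment> \<open>On \<open>L\<close> the operator 1 - B is a strict contraction, so the fixed
    point theorem inverts \<open>B\<close> there. Writing w = B v with v in \<open>L\<close> shows w
    in \<open>D\<close> and A w = v - w in \<open>L\<close>.\<close>
  define C where "C = (\<lambda>x. x - B x)"
  have nC: "norm (C x) \<le> (1 - \<beta>) * norm x" if "x \<in> L" for x
  proof (rule norm_le_of_form_bound[OF _ _ subL])
    show "linear C" unfolding C_def by (intro linear_compose_sub linear_id[unfolded id_def] linB)
    show "inner (C x) y = inner x (C y)" for x y by (simp add: C_def inner_diff_left inner_diff_right B(2))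
    show "C x \<in> L" if "x \<in> L" for x unfolding C_def using that BL by (intro subspace_diff subL)
    show "0 \<le> inner (C x) x" for x
      using Cauchy_Schwarz_ineq2[of "B x" x] mult_right_mono[OF B(4)[of x], of "norm x"]
      by (simp add: C_def inner_diff_left power2_norm_eq_inner[symmetric] power2_eq_square)
    show "inner (C x) x \<le> (1 - \<beta>) * (norm x)\<^sup>2" if "x \<in> L" for x
      using formL[OF that] by (simp add: C_def inner_diff_left power2_norm_eq_inner algebra_simps)
  qed (use \<beta> that in auto)
  have L: "w \<in> D \<and> A w \<in> L \<and> norm (A w) \<le> r * norm w" if w: "w \<in> L" for w
  proof -
    have "\<exists>!v\<in>L. w + C v = v"
    proof (rule Banach_fix[of L "1 - \<beta>"])
      show "complete L" by (simp add: L_def complete_eq_closed)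
      show "L \<noteq> {}" using w by blast
      show "(\<lambda>v. w + C v) ` L \<subseteq> L"
        using w BL by (auto simp: C_def intro!: subspace_add[OF subL] subspace_diff[OF subL])
      fix x y assume xy: "x \<in> L" "y \<in> L"
      have "C x - C y = C (x - y)" by (simp add: C_def linear_diff[OF linB])
      then show "dist (w + C x) (w + C y) \<le> (1 - \<beta>) * dist x y"
        using nC[OF subspace_diff[OF subL xy]] by (simp add: dist_norm)
    qed (use \<beta> in auto)
    then obtain v where v: "v \<in> L" "B v = w" by (auto simp: C_def)
    have wD: "w \<in> D" and vw: "v = w + A w" using B(5,6)[of v] v(2) by auto
    have AwL: "A w \<in> L" using subspace_diff[OF subL v(1) w] by (simp add: vw)
    have n1: "(norm v)\<^sup>2 = (norm w)\<^sup>2 + 2 * inner (A w) w + (norm (A w))\<^sup>2"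
      and n2: "inner w v = (norm w)\<^sup>2 + inner (A w) w"
      by (simp_all add: vw power2_norm_eq_inner inner_add_left inner_add_right inner_commute)
    \<comment> \<open>The form bound at v = w + A w. Cauchy-Schwarz, applicable since r - 1 \<ge> 0,
      turns it into a quadratic inequality for \<open>norm (A w)\<close> with roots
      \<open>r * norm w\<close> and \<open>- norm w\<close>.\<close>
    have "(norm v)\<^sup>2 \<le> (1 + r) * inner w v"
      using formL[OF v(1)] r1 by (simp add: v(2) \<beta>_def field_simps)
    then have "(norm (A w))\<^sup>2 \<le> r * (norm w)\<^sup>2 + (r - 1) * inner (A w) w"
      unfolding n1 n2 by (simp add: algebra_simps)
    also have "\<dots> \<le> r * (norm w)\<^sup>2 + (r - 1) * (norm (A w) * norm w)"
      using r1 by (intro add_left_mono mult_left_mono norm_cauchy_schwarz) auto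
    finally have "(norm (A w) - r * norm w) * (norm (A w) + norm w) \<le> 0"
      by (simp add: algebra_simps power2_eq_square)
    moreover have "norm (A w) + norm w > 0" if "norm (A w) - r * norm w > 0"
    proof -
      have "0 \<le> r * norm w" using r1 by simp
      then show ?thesis using that by (smt (verit) norm_ge_zero)
    qed
    ultimately have "norm (A w) \<le> r * norm w" by (smt (verit) mult_pos_pos)
    then show ?thesis using wD AwL by blast
  qed
  have powL: "(A ^^ k) w \<in> L \<and> norm ((A ^^ k) w) \<le> norm w * r ^ k" if "w \<in> L" for w k
  proof (induction k)
    case (Suc k)
    then have "norm (A ((A ^^ k) w)) \<le> r * norm ((A ^^ k) w)" using L by blast
    also have "\<dots> \<le> r * (norm w * r ^ k)" using Suc r1 by (intro mult_left_mono) auto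
    finally show ?case using Suc L by (simp add: mult.left_commute)
  qed (use that in simp)
  have LH: "w \<in> exp_vectors r" if "w \<in> L" for w
    using powL[OF that] L r0 by (intro exp_vectorsI) blast+
  have MH: "M x \<in> exp_vectors r" for x
    by (intro LH) (auto simp: L_def closure_subset[THEN subsetD])
  \<comment> \<open>The orthogonal complement, equivalently the kernel of \<open>P r\<close>. It is
    invariant under \<open>B\<close>, and the symmetric \<open>M\<close> vanishes on it because the
    range of \<open>M\<close> lies in \<open>exp_vectors r\<close>.\<close>
  define K where "K = {x. \<forall>h\<in>exp_vectors r. inner x h = 0}"
  have subK: "subspace K"
    by (auto simp: K_def subspace_def inner_add_left)
  have PK: "P r x = 0" if "x \<in> K" for x
    using that P_mem[of x] inner_diff_P[OF P_mem, of x x]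
    by (simp add: K_def inner_diff_left)
  have KP: "x \<in> K" if "P r x = 0" for x
    using inner_diff_P[of _ x] that by (simp add: K_def)
  have BK: "B x \<in> K" if x: "x \<in> K" for x
  proof (rule KP)
    have "P r (B x) + A (P r (B x)) = P r (B x + A (B x))"
      by (simp add: P_add P_A B(5))
    also have "\<dots> = 0" using PK[OF x] by (simp add: B(6))
    finally show "P r (B x) = 0" using norm_le_one_plus_A[OF P_domain, of "B x"] by simp
  qed
  have MK: "M x = 0" if "x \<in> K" for x
  proof -
    have "inner (M x) (M x) = inner x (M (M x))" by (rule M(2))
    also have "\<dots> = 0" using that MH by (auto simp: K_def)
    finally show ?thesis by simp
  qed
  have "norm (B x) \<le> \<beta> * norm x" if "x \<in> K" for x
    by (rule norm_le_of_form_bound[OF linB B(2) subK BK B(3) M(5)[OF MK] \<beta>(1) that])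
  moreover have gK: "g \<in> K" using orth by (simp add: K_def)
  moreover have "g + A g \<in> K"
    by (rule KP) (simp add: P_add P_A g PK[OF gK])
  \<comment> \<open>Since \<open>B (g + A g) = g\<close>, the norm bound for \<open>B\<close> on
    \<open>K\<close> is applied at \<open>g + A g\<close>.\<close>
  ultimately have "norm g \<le> \<beta> * norm (g + A g)" using B(7)[OF g] by metis
  also have "\<dots> \<le> \<beta> * (norm g + norm (A g))"
    using \<beta> by (intro mult_left_mono norm_triangle_ineq) auto
  finally have "(1 + r) * norm g \<le> norm g + norm (A g)"
    using r1 by (simp add: \<beta>_def field_simps)
  then show ?thesis by (simp add: algebra_simps)
qed

end

end

section \<open>Weak solutions\<close>

text \<open>Quotients from the right use only points of the half-line, so t = 0 needs no separate
  treatment, and a sequence suffices for \<open>A_closed\<close>.\<close>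

lemma has_vector_derivative_imp_sequence:
  fixes f :: "real \<Rightarrow> 'a::real_normed_vector"
  assumes f: "(f has_vector_derivative d) (at t within {0..})" and t: "0 \<le> t"
  shows "(\<lambda>n. real (Suc n) *\<^sub>R (f (t + 1 / Suc n) - f t)) \<longlonglongrightarrow> d"
proof -
  let ?s = "\<lambda>n. t + 1 / Suc n"
  have "?s \<longlonglongrightarrow> t"
    using tendsto_add[OF tendsto_const LIMSEQ_Suc[OF lim_1_over_n], of t] by simp
  then have s: "filterlim ?s (at t within {0..}) sequentially"
    using t by (simp add: filterlim_at del: of_nat_Suc)
  have "((\<lambda>y. (1 / norm (y - t)) *\<^sub>R (f y - (f t + (y - t) *\<^sub>R d))) \<longlongrightarrow> 0) (at t within {0..})"
    using f by (simp add: has_vector_derivative_def has_derivative_within)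
  from filterlim_compose[OF this s]
  have "(\<lambda>n. real (Suc n) *\<^sub>R (f (?s n) - f t) - d) \<longlonglongrightarrow> 0"
    by (simp add: scaleR_diff_right scaleR_add_right algebra_simps del: of_nat_Suc)
  then show ?thesis by (rule LIM_zero_cancel)
qed

lemma at_within_atLeast_eq_atLeastAtMost:
  fixes t :: real
  assumes "t < b"
  shows "at t within {0..b} = at t within {0..}"
  using assms by (intro at_within_nhd[of _ "{..<b}"]) auto

lemma has_vector_derivative_integral_atLeast:
  fixes f :: "real \<Rightarrow> 'a::{real_normed_vector, complete_space}"
  assumes "continuous_on {0..} f" "0 \<le> t"
  shows "((\<lambda>u. integral {0..u} f) has_vector_derivative f t) (at t within {0..})"
proof -
  have "continuous_on {0..t + 1} f" using assms(1) by (rule continuous_on_subset) auto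
  from integral_has_vector_derivative_complete[OF this, of t] assms(2)
  show ?thesis by (simp add: at_within_atLeast_eq_atLeastAtMost)
qed

lemma integrable_on_of_continuous_atLeast:
  fixes f :: "real \<Rightarrow> 'a::{real_normed_vector, complete_space}"
  assumes "continuous_on {0..} f"
  shows "f integrable_on {0..t}"
  by (rule integrable_continuous_complete, rule continuous_on_subset[OF assms]) auto

lemma has_integral_of_derivative_atLeast:
  fixes f :: "real \<Rightarrow> 'a::{real_normed_vector, complete_space}"
  assumes "\<And>s. 0 \<le> s \<Longrightarrow> (f has_vector_derivative f' s) (at s within {0..})" "0 \<le> t"
  shows "(f' has_integral (f t - f 0)) {0..t}"
proof (rule fundamental_theorem_of_calculus_complete[OF assms(2)])
  fix x assume "x \<in> {0..t}"
  then show "(f has_vector_derivative f' x) (at x within {0..t})"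
    using has_vector_derivative_within_subset[OF assms(1)] by auto
qed

lemma weak_solution_cong:
  assumes "\<And>t. 0 \<le> t \<Longrightarrow> y t = z t"
  shows "weak_solution D A y \<longleftrightarrow> weak_solution D A z"
proof -
  have "continuous_on {0..} y \<longleftrightarrow> continuous_on {0..} z"
    by (rule continuous_on_cong) (auto simp: assms)
  moreover have "integral {0..t} y = integral {0..t} z" for t
    by (rule integral_cong) (auto simp: assms)
  ultimately show ?thesis by (simp add: weak_solution_def assms)
qed

context nonneg_self_adjoint
begin

text \<open>\<open>A\<close> carries the component of \<open>(A ^^ k) f\<close> orthogonal to
  \<open>exp_vectors r\<close> to that of \<open>(A ^^ Suc k) f\<close>, and the spectral gap gains
  a factor \<open>r\<close> each time.\<close>

lemma jackson:
  assumes r: "1 \<le> r" and f: "\<And>k. k < n \<Longrightarrow> (A ^^ k) f \<in> D"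
  shows "r ^ n * norm (f - P r f) \<le> norm ((A ^^ n) f)"
proof -
  have r0: "0 \<le> r" using r by simp
  define g where "g = (\<lambda>k. (A ^^ k) f - P r ((A ^^ k) f))"
  have "r ^ k * norm (g 0) \<le> norm (g k)" if "k \<le> n" for k
    using that
  proof (induction k)
    case (Suc k)
    have d: "(A ^^ k) f \<in> D" using f Suc.prems by simp
    have gd: "g k \<in> D" unfolding g_def by (intro subspace_diff subspace_D d P_domain r0)
    have Ag: "A (g k) = g (Suc k)"
      by (simp add: g_def A_diff d P_domain[OF r0] P_A[OF r0 d])
    have "r ^ Suc k * norm (g 0) = r * (r ^ k * norm (g 0))" by simp
    also have "\<dots> \<le> r * norm (g k)" using Suc r0 by (intro mult_left_mono) auto
    also have "\<dots> \<le> norm (g (Suc k))"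
      using spectral_gap[OF r0 r gd] inner_diff_P[OF r0] unfolding Ag by (simp add: g_def)
    finally show ?case .
  qed simp
  from this[of n] norm_diff_P_le[OF r0, of "(A ^^ n) f"] show ?thesis by (simp add: g_def)
qed

text \<open>Replaces the strong convergence of E [0, n] to the identity: \<open>jackson\<close> with
  exponent 1 on the dense domain, then minimality of the projection.\<close>

lemma P_tendsto: "(\<lambda>n. P (real n) f) \<longlonglongrightarrow> f"
proof (rule metric_LIMSEQ_I)
  fix e :: real assume e: "e > 0"
  have "f \<in> closure D" by (simp add: dense)
  then obtain d where d: "d \<in> D" "norm (f - d) < e / 2"
    unfolding closure_approachable using e by (metis dist_norm half_gt_zero norm_minus_commute)
  obtain N where N: "N > 0" "2 * norm (A d) / e < real N"
    using reals_Archimedean2[of "max 0 (2 * norm (A d) / e)"] by auto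
  have "dist (P (real n) f) f < e" if n: "n \<ge> N" for n
  proof -
    have n1: "1 \<le> real n" and n0: "0 \<le> real n" using n N(1) by auto
    have "real n * norm (d - P n d) \<le> norm (A d)"
      using jackson[OF n1, of 1 d] d(1) by simp
    moreover have "norm (A d) < real n * (e / 2)"
    proof -
      have "norm (A d) < real N * (e / 2)" using N(2) e by (simp add: field_simps)
      also have "\<dots> \<le> real n * (e / 2)" using n e by (intro mult_right_mono) auto
      finally show ?thesis .
    qed
    ultimately have "norm (d - P n d) < e / 2" using n1 by (smt (verit) mult_left_le_imp_le)
    moreover have "norm (f - P n f) \<le> norm (f - P n d)"
      by (rule norm_diff_P_minimal[OF n0 P_mem[OF n0]])
    moreover have "norm (f - P n d) \<le> norm (f - d) + norm (d - P n d)"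
      using norm_triangle_ineq[of "f - d" "d - P n d"] by simp
    ultimately show ?thesis using d(2) by (simp add: dist_norm norm_minus_commute)
  qed
  then show "\<exists>no. \<forall>n\<ge>no. dist (P (real n) f) f < e" by blast
qed

text \<open>The derivative of the squared norm is \<open>- 2 * inner (A (u s)) (u s)\<close>, which
  is nonpositive.\<close>

lemma norm_nonincreasing:
  assumes u: "\<And>s. 0 \<le> s \<Longrightarrow> u s \<in> D"
    "\<And>s. 0 \<le> s \<Longrightarrow> (u has_vector_derivative - A (u s)) (at s within {0..})" and t: "0 \<le> t"
  shows "norm (u t) \<le> norm (u 0)"
proof -
  have der: "((\<lambda>s. inner (u s) (u s)) has_derivative
      (\<lambda>h. inner (u s) (h *\<^sub>R (- A (u s))) + inner (h *\<^sub>R (- A (u s))) (u s))) (at s within {0..t})"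
    if "0 \<le> s" "s \<le> t" for s
  proof -
    have "(u has_derivative (\<lambda>h. h *\<^sub>R (- A (u s)))) (at s within {0..t})"
      using has_vector_derivative_within_subset[OF u(2)[OF that(1)], of "{0..t}"]
      by (auto simp: has_vector_derivative_def)
    from has_derivative_inner[OF this this] show ?thesis .
  qed
  from mvt_very_simple[OF t der] obtain s where s: "s \<in> {0..t}" and
    "inner (u t) (u t) - inner (u 0) (u 0) =
      inner (u s) ((t - 0) *\<^sub>R (- A (u s))) + inner ((t - 0) *\<^sub>R (- A (u s))) (u s)"
    by blast
  then have "inner (u t) (u t) - inner (u 0) (u 0) = - (2 * t * inner (A (u s)) (u s))"
    by (simp add: inner_commute)
  moreover have "0 \<le> 2 * t * inner (A (u s)) (u s)"
    using t s A_nonneg[OF u(1)] by simp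
  ultimately show ?thesis by (simp add: norm_eq_sqrt_inner)
qed

lemma weak_solutionD:
  assumes "weak_solution D A y"
  shows "continuous_on {0..} y" "0 \<le> t \<Longrightarrow> integral {0..t} y \<in> D"
    "0 \<le> t \<Longrightarrow> y t = - A (integral {0..t} y) + y 0"
  using assms unfolding weak_solution_def by blast+

text \<open>After projection the integral equation contains only the bounded operator
  \<open>A (P r x)\<close> and can be differentiated; a weak solution becomes a strong one.\<close>

lemma P_weak_solution_derivative:
  assumes y: "weak_solution D A y" and r: "0 \<le> r" and t: "0 \<le> t"
  shows "((\<lambda>s. P r (y s)) has_vector_derivative - A (P r (y t))) (at t within {0..})"
proof -
  have eq: "P r (y s) = - A (P r (integral {0..s} y)) + P r (y 0)" if "0 \<le> s" for s
  proof -
    have "P r (y s) = P r (y 0 - A (integral {0..s} y))"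
      using weak_solutionD(3)[OF y that] by simp
    then show ?thesis by (simp add: P_diff[OF r] P_A[OF r weak_solutionD(2)[OF y that]])
  qed
  have *: "((\<lambda>s. - A (P r (integral {0..s} y)) + P r (y 0)) has_vector_derivative
      - A (P r (y t)) + 0) (at t within {0..})"
    by (intro has_vector_derivative_add has_vector_derivative_minus has_vector_derivative_const
        bounded_linear.has_vector_derivative[OF bounded_linear_A_P[OF r]]
        has_vector_derivative_integral_atLeast weak_solutionD(1)[OF y] t)
  have "((\<lambda>s. P r (y s)) has_vector_derivative - A (P r (y t)) + 0) (at t within {0..})"
    by (rule has_vector_derivative_transform[OF _ _ *]) (use t eq in blast)+
  then show ?thesis by simp
qed

lemma weak_solution_contraction:
  assumes y: "weak_solution D A y" and t: "0 \<le> t"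
  shows "norm (y t) \<le> norm (y 0)"
proof (rule LIMSEQ_le_const2)
  show "(\<lambda>n. norm (P (real n) (y t))) \<longlonglongrightarrow> norm (y t)"
    by (intro tendsto_norm P_tendsto)
  have "norm (P (real n) (y t)) \<le> norm (y 0)" for n
    using norm_nonincreasing[OF P_domain P_weak_solution_derivative[OF y] t, of "real n"]
      norm_P_le[of "real n" "y 0"] by simp
  then show "\<exists>N. \<forall>n\<ge>N. norm (P (real n) (y t)) \<le> norm (y 0)" by blast
qed

lemma weak_solution_diff:
  assumes y: "weak_solution D A y" and z: "weak_solution D A z"
  shows "weak_solution D A (\<lambda>t. y t - z t)"
  unfolding weak_solution_def
proof (intro conjI allI impI)
  show "continuous_on {0..} (\<lambda>t. y t - z t)"
    by (intro continuous_on_diff weak_solutionD(1)[OF y] weak_solutionD(1)[OF z])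
  fix t :: real assume t: "0 \<le> t"
  have eq: "integral {0..t} (\<lambda>t. y t - z t) = integral {0..t} y - integral {0..t} z"
    by (intro integral_diff integrable_on_of_continuous_atLeast weak_solutionD(1)[OF y]
        weak_solutionD(1)[OF z])
  note d = weak_solutionD(2)[OF y t] weak_solutionD(2)[OF z t]
  show "integral {0..t} (\<lambda>t. y t - z t) \<in> D"
    unfolding eq by (intro subspace_diff subspace_D d)
  show "y t - z t = - A (integral {0..t} (\<lambda>t. y t - z t)) + (y 0 - z 0)"
    using weak_solutionD(3)[OF y t] weak_solutionD(3)[OF z t]
    unfolding eq A_diff[OF d] by (simp add: algebra_simps)
qed

text \<open>The supremum is attained at t = 0 by contraction, which reduces approximation of
  solutions to approximation of initial values in the Hilbert space.\<close>

lemma S_norm_diff_weak_solutions: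
  assumes "weak_solution D A y" "weak_solution D A z"
  shows "S_norm (\<lambda>t. y t - z t) = norm (y 0 - z 0)"
  unfolding S_norm_def
  using weak_solution_contraction[OF weak_solution_diff[OF assms]]
  by (intro cSup_eq_maximum) auto

text \<open>On the values of \<open>u\<close> the projection is the identity, so \<open>A\<close>
  may be replaced by the bounded \<open>A (P r x)\<close> and commuted with the integral.\<close>

lemma weak_solutionI_exp_vectors:
  assumes r: "0 \<le> r" and u: "\<And>t. 0 \<le> t \<Longrightarrow> u t \<in> exp_vectors r"
    "\<And>t. 0 \<le> t \<Longrightarrow> (u has_vector_derivative - A (u t)) (at t within {0..})"
  shows "weak_solution D A u"
  unfolding weak_solution_def
proof (intro conjI allI impI)
  show cont: "continuous_on {0..} u"
    unfolding continuous_on_eq_continuous_within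
    using has_vector_derivative_continuous[OF u(2)] by auto
  fix t :: real assume t: "0 \<le> t"
  have int: "u integrable_on {0..t}" by (rule integrable_on_of_continuous_atLeast[OF cont])
  have "integral {0..t} u = integral {0..t} (P r \<circ> u)"
    by (rule integral_cong) (simp add: P_id[OF r u(1)])
  also have "\<dots> = P r (integral {0..t} u)"
    by (rule integral_linear[OF int bounded_linear_P[OF r]])
  finally have mem: "integral {0..t} u \<in> exp_vectors r" using P_mem[OF r] by metis
  then show "integral {0..t} u \<in> D" by (rule exp_vectors_domain)
  have "u t - u 0 = integral {0..t} (\<lambda>s. - A (u s))"
    using has_integral_of_derivative_atLeast[OF u(2) t] by (rule integral_unique[symmetric])
  also have "\<dots> = - integral {0..t} ((\<lambda>x. A (P r x)) \<circ> u)"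
    by (subst integral_neg[symmetric]) (auto intro: integral_cong simp: P_id[OF r u(1)])
  also have "\<dots> = - A (P r (integral {0..t} u))"
    by (simp add: integral_linear[OF int bounded_linear_A_P[OF r]])
  finally show "u t = - A (integral {0..t} u) + u 0"
    by (simp add: P_id[OF r mem] algebra_simps)
qed

text \<open>Difference quotients of the integral of \<open>z\<close> tend to \<open>z t\<close>, and
  by the integral equation \<open>A\<close> maps them to negated quotients of \<open>z\<close>;
  \<open>A_closed\<close> concludes.\<close>

lemma weak_solution_derivative:
  assumes z: "weak_solution D A z"
    and z': "\<And>t. 0 \<le> t \<Longrightarrow> (z has_vector_derivative z' t) (at t within {0..})"
    and t: "0 \<le> t"
  shows "z t \<in> D" "A (z t) = - z' t"
proof -
  let ?I = "\<lambda>s. integral {0..s} z"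
  let ?w = "\<lambda>n. real (Suc n) *\<^sub>R (?I (t + 1 / Suc n) - ?I t)"
  have d: "?I (t + 1 / Suc n) \<in> D" "?I t \<in> D" for n
    using weak_solutionD(2)[OF z] t by auto
  have wD: "?w n \<in> D" for n
    by (intro subspace_scale subspace_diff subspace_D d)
  have AI: "A (?I s) = z 0 - z s" if "0 \<le> s" for s
    using weak_solutionD(3)[OF z that] by (simp add: algebra_simps)
  have Aw: "A (?w n) = - (real (Suc n) *\<^sub>R (z (t + 1 / Suc n) - z t))" for n
    using AI[of "t + 1 / Suc n"] AI[OF t] t
    by (simp add: A_scaleR[OF subspace_diff[OF subspace_D d]] A_diff[OF d] scaleR_minus_right[symmetric]
        del: of_nat_Suc scaleR_minus_right)
  have "?w \<longlonglongrightarrow> z t"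
    by (rule has_vector_derivative_imp_sequence[OF has_vector_derivative_integral_atLeast[OF
        weak_solutionD(1)[OF z] t] t])
  moreover have "(\<lambda>n. A (?w n)) \<longlonglongrightarrow> - z' t"
    unfolding Aw by (intro tendsto_minus has_vector_derivative_imp_sequence z' t)
  ultimately show "z t \<in> D" "A (z t) = - z' t" using A_closed[of ?w, OF wD] by blast+
qed

lemma derivative_weak_solution:
  assumes z: "weak_solution D A z"
    and z': "\<And>t. 0 \<le> t \<Longrightarrow> (z has_vector_derivative z' t) (at t within {0..})"
    and cont: "continuous_on {0..} z'"
  shows "weak_solution D A z'"
  unfolding weak_solution_def
proof (intro conjI allI impI cont)
  fix t :: real assume t: "0 \<le> t"
  have eq: "integral {0..t} z' = z t - z 0"
    using has_integral_of_derivative_atLeast[OF z' t] by (rule integral_unique)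
  note zt = weak_solution_derivative[OF z z' t] and z0 = weak_solution_derivative[OF z z' order_refl]
  show "integral {0..t} z' \<in> D" unfolding eq by (intro subspace_diff subspace_D zt z0)
  show "z' t = - A (integral {0..t} z') + z' 0"
    unfolding eq by (simp add: A_diff zt z0)
qed

text \<open>Every derivative is again a weak solution, so its value at 0 lies in \<open>D\<close>
  and \<open>A\<close> yields minus the next derivative.\<close>

lemma deriv_seq_weak_solution:
  assumes y: "weak_solution D A y" and Dy: "deriv_seq y Dy"
  shows "weak_solution D A (Dy k)" "(A ^^ k) (y 0) \<in> D" "Dy k 0 = (-1) ^ k *\<^sub>R (A ^^ k) (y 0)"
proof -
  have der: "(Dy k has_vector_derivative Dy (Suc k) t) (at t within {0..})" if "0 \<le> t" for k t
    using Dy that by (simp add: deriv_seq_def)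
  have cont: "continuous_on {0..} (Dy k)" for k
    unfolding continuous_on_eq_continuous_within
    using has_vector_derivative_continuous[OF der] by auto
  have D0: "Dy 0 t = y t" if "0 \<le> t" for t using Dy that by (simp add: deriv_seq_def)
  have weak: "weak_solution D A (Dy k)" for k
  proof (induction k)
    case 0
    show ?case using y weak_solution_cong[of "Dy 0" y D A] D0 by simp
  next
    case (Suc k)
    then show ?case using derivative_weak_solution der cont by blast
  qed
  then show "weak_solution D A (Dy k)" .
  have dom: "Dy k 0 \<in> D" "A (Dy k 0) = - Dy (Suc k) 0" for k
    using weak_solution_derivative[OF weak der order_refl] by blast+
  have main: "(A ^^ k) (y 0) = (-1) ^ k *\<^sub>R Dy k 0" for k
  proof (induction k)
    case (Suc k)
    then show ?case by (simp add: A_scaleR dom)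
  qed (simp add: D0)
  show "(A ^^ k) (y 0) \<in> D" unfolding main by (intro subspace_scale subspace_D dom)
  show "Dy k 0 = (-1) ^ k *\<^sub>R (A ^^ k) (y 0)"
    by (simp add: main power_mult_distrib[symmetric])
qed

lemma funpow_P:
  assumes r: "0 \<le> r"
  shows "bounded_linear (\<lambda>x. (A ^^ k) (P r x))" "(\<And>j. j < k \<Longrightarrow> (A ^^ j) x \<in> D) \<Longrightarrow> (A ^^ k) (P r x) = P r ((A ^^ k) x)"
proof -
  show "bounded_linear (\<lambda>x. (A ^^ k) (P r x))"
  proof (induction k)
    case (Suc k)
    have "(A ^^ Suc k) (P r x) = A (P r ((A ^^ k) (P r x)))" for x
      by (simp add: P_id[OF r exp_vectors_funpow[OF P_mem[OF r] r]])
    then show ?case using bounded_linear_compose[OF bounded_linear_A_P[OF r] Suc] by simp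
  qed (simp add: bounded_linear_P[OF r])
  show "(A ^^ k) (P r x) = P r ((A ^^ k) x)" if "\<And>j. j < k \<Longrightarrow> (A ^^ j) x \<in> D"
    using that by (induction k) (auto simp: P_A[OF r])
qed

text \<open>The truncations \<open>u n k\<close> are strong solutions, and so are their differences.
  Contraction therefore upgrades convergence of the initial values
  \<open>P n ((A ^^ k) (y 0))\<close> to convergence uniform in t, which permits differentiating the
  limit.\<close>

lemma smooth_weak_solution:
  assumes y: "weak_solution D A y" and dom: "\<And>k. (A ^^ k) (y 0) \<in> D"
  shows "deriv_seq y (\<lambda>k t. (-1) ^ k *\<^sub>R (A ^^ k) (y t))"
    and "0 \<le> t \<Longrightarrow> norm ((A ^^ k) (y t)) \<le> norm ((A ^^ k) (y 0))"
proof -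
  define u where "u = (\<lambda>n k t. (A ^^ k) (P (real n) (y t)))"
  have u_mem: "u n k t \<in> exp_vectors n" for n k t
    unfolding u_def by (intro exp_vectors_funpow P_mem) auto
  have uD: "u n k t \<in> D" for n k t using u_mem exp_vectors_domain by blast
  have Au: "A (u n k t) = u n (Suc k) t" for n k t by (simp add: u_def)
  have u0: "u n k 0 = P n ((A ^^ k) (y 0))" for n k
    unfolding u_def by (rule funpow_P(2)) (auto simp: dom)
  have uder: "(u n k has_vector_derivative - u n (Suc k) t) (at t within {0..})" if t: "0 \<le> t" for n k t
  proof -
    let ?L = "\<lambda>x. (A ^^ k) (P (real n) x)"
    have L: "bounded_linear ?L" by (rule funpow_P) simp
    \<comment> \<open>Inserting the projection twice lets the bounded \<open>?L\<close> act on the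
      curve \<open>P (real n) (y s)\<close>, whose derivative is known.\<close>
    have idem: "?L (P (real n) x) = ?L x" for x by (simp add: P_id P_mem)
    have "((\<lambda>s. ?L (P (real n) (y s))) has_vector_derivative ?L (- A (P (real n) (y t)))) (at t within {0..})"
      by (intro bounded_linear.has_vector_derivative[OF L] P_weak_solution_derivative[OF y _ t]) simp
    moreover have "?L (- A (P (real n) (y t))) = - u n (Suc k) t"
      using P_id[OF _ exp_vectors_A[OF P_mem], of "real n" "y t"]
      by (simp add: linear_neg[OF bounded_linear.linear[OF L]] u_def funpow_swap1)
    ultimately show ?thesis by (simp add: idem u_def)
  qed
  have diff: "norm (u n k t - u m k t) \<le> norm (u n k 0 - u m k 0)" if t: "0 \<le> t" for n m k t
  proof (rule norm_nonincreasing[of "\<lambda>t. u n k t - u m k t", OF _ _ t])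
    show "u n k s - u m k s \<in> D" for s by (intro subspace_diff subspace_D uD)
    show "((\<lambda>t. u n k t - u m k t) has_vector_derivative - A (u n k s - u m k s)) (at s within {0..})"
      if "0 \<le> s" for s
      using has_vector_derivative_diff[OF uder[OF that, of n k] uder[OF that, of m k]]
      by (simp add: A_diff uD Au)
  qed
  have u0lim: "(\<lambda>n. u n k 0) \<longlonglongrightarrow> (A ^^ k) (y 0)" for k
    unfolding u0 by (rule P_tendsto)
  have cau: "Cauchy (\<lambda>n. u n k t)" if t: "0 \<le> t" for k t
    using LIMSEQ_imp_Cauchy[OF u0lim[of k]] diff[OF t, of _ k] unfolding Cauchy_def dist_norm
    by (meson le_less_trans)
  have lim: "(\<lambda>n. u n k t) \<longlonglongrightarrow> (A ^^ k) (y t)" if t: "0 \<le> t" for k t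
  proof (induction k)
    case 0 show ?case by (simp add: u_def P_tendsto)
  next
    case (Suc k)
    obtain z where z: "(\<lambda>n. u n (Suc k) t) \<longlonglongrightarrow> z"
      using cau[OF t, of "Suc k"] Cauchy_convergent convergent_def by blast
    then have "(\<lambda>n. A (u n k t)) \<longlonglongrightarrow> z" by (simp add: Au)
    from A_closed(2)[of "\<lambda>n. u n k t", OF uD Suc this] z show ?case by simp
  qed
  show bound: "norm ((A ^^ k) (y t)) \<le> norm ((A ^^ k) (y 0))" if t: "0 \<le> t" for k t
  proof (rule LIMSEQ_le)
    show "(\<lambda>n. norm (u n k t)) \<longlonglongrightarrow> norm ((A ^^ k) (y t))" by (intro tendsto_norm lim t)
    show "(\<lambda>n. norm (u n k 0)) \<longlonglongrightarrow> norm ((A ^^ k) (y 0))" by (intro tendsto_norm lim) simp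
    have "norm (u n k t) \<le> norm (u n k 0)" for n
      using norm_nonincreasing[of "u n k", OF uD _ t] uder Au by simp
    then show "\<exists>N. \<forall>n\<ge>N. norm (u n k t) \<le> norm (u n k 0)" by blast
  qed
  have unif: "norm (u n k t - (A ^^ k) (y t)) \<le> norm (u n k 0 - (A ^^ k) (y 0))" if t: "0 \<le> t" for n k t
  proof (rule LIMSEQ_le)
    show "(\<lambda>m. norm (u n k t - u m k t)) \<longlonglongrightarrow> norm (u n k t - (A ^^ k) (y t))"
      by (intro tendsto_intros lim t)
    show "(\<lambda>m. norm (u n k 0 - u m k 0)) \<longlonglongrightarrow> norm (u n k 0 - (A ^^ k) (y 0))"
      by (intro tendsto_intros u0lim)
  qed (use diff[OF t] in blast)
  have der: "((\<lambda>t. (A ^^ k) (y t)) has_vector_derivative - ((A ^^ Suc k) (y t))) (at t within {0..})"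
    if t: "0 \<le> t" for k t
    unfolding has_vector_derivative_def
  proof (rule has_derivative_sequence_complete[where f = "\<lambda>n. u n k"
        and f' = "\<lambda>n x h. h *\<^sub>R (- u n (Suc k) x)"
        and g' = "\<lambda>x h. h *\<^sub>R (- ((A ^^ Suc k) (y x)))"])
    show "(u n k has_derivative (\<lambda>h. h *\<^sub>R - u n (Suc k) x)) (at x within {0..})" if "x \<in> {0..}" for n x
      using uder[of x n k] that by (simp add: has_vector_derivative_def)
    show "(\<lambda>n. u n k x) \<longlonglongrightarrow> (A ^^ k) (y x)" if "x \<in> {0..}" for x
      using lim that by simp
    fix e :: real assume "e > 0"
    from tendstoD[OF u0lim[of "Suc k"] this]
    show "\<forall>\<^sub>F n in sequentially. \<forall>x\<in>{0..}. \<forall>h.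
        norm (h *\<^sub>R - u n (Suc k) x - h *\<^sub>R - (A ^^ Suc k) (y x)) \<le> e * norm h"
    proof (rule eventually_mono, intro ballI allI)
      fix n and x h :: real
      assume n: "dist (u n (Suc k) 0) ((A ^^ Suc k) (y 0)) < e" and x: "x \<in> {0..}"
      have "norm (h *\<^sub>R - u n (Suc k) x - h *\<^sub>R - (A ^^ Suc k) (y x)) =
          norm (h *\<^sub>R (- (u n (Suc k) x - (A ^^ Suc k) (y x))))"
        by (simp only: scaleR_diff_right[symmetric]) simp
      also have "\<dots> = \<bar>h\<bar> * norm (u n (Suc k) x - (A ^^ Suc k) (y x))"
        by (simp only: norm_scaleR norm_minus_cancel)
      also have "\<dots> \<le> \<bar>h\<bar> * e"
        using unif[of x n "Suc k"] x n by (intro mult_left_mono) (auto simp: dist_norm)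
      finally show "norm (h *\<^sub>R - u n (Suc k) x - h *\<^sub>R - (A ^^ Suc k) (y x)) \<le> e * norm h"
        by (simp add: mult.commute)
    qed
  qed (use t in auto)
  show "deriv_seq y (\<lambda>k t. (-1) ^ k *\<^sub>R (A ^^ k) (y t))"
    unfolding deriv_seq_def
  proof (intro conjI allI impI)
    fix k and t :: real assume t: "0 \<le> t"
    have "((\<lambda>t. (-1) ^ k *\<^sub>R (A ^^ k) (y t)) has_vector_derivative
        (-1) ^ k *\<^sub>R (- ((A ^^ Suc k) (y t)))) (at t within {0..})"
      by (rule bounded_linear.has_vector_derivative[OF bounded_linear_scaleR_right der[OF t]])
    then show "((\<lambda>t. (-1) ^ k *\<^sub>R (A ^^ k) (y t)) has_vector_derivative
        (-1) ^ Suc k *\<^sub>R (A ^^ Suc k) (y t)) (at t within {0..})" by simp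
  qed simp
qed

end

section \<open>Solutions of exponential type\<close>

text \<open>The remainder is a polynomial in \<open>w\<close> and \<open>k\<close> with nonnegative
  coefficients, hence majorised by its value at the moduli. The induction uses Q_(n+1) = (w + k) Q_n
  + n k^2 w^(n-1); at n = 0 the truncated exponent is harmless because of the factor n.\<close>

lemma norm_power_add_remainder_le:
  fixes w k :: complex
  shows "norm ((w + k) ^ n - w ^ n - of_nat n * k * w ^ (n - 1)) \<le>
    (norm w + norm k) ^ n - norm w ^ n - of_nat n * norm k * norm w ^ (n - 1)"
proof (induction n)
  case (Suc n)
  let ?Q = "\<lambda>w k :: complex. (w + k) ^ n - w ^ n - of_nat n * k * w ^ (n - 1)"
  let ?R = "\<lambda>w k :: real. (w + k) ^ n - w ^ n - of_nat n * k * w ^ (n - 1)"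
  have "(w + k) ^ Suc n - w ^ Suc n - of_nat (Suc n) * k * w ^ (Suc n - 1) =
      (w + k) * ?Q w k + of_nat n * k\<^sup>2 * w ^ (n - 1)"
    by (cases n) (simp_all add: algebra_simps power2_eq_square)
  also have "norm \<dots> \<le> norm (w + k) * norm (?Q w k) + norm (of_nat n * k\<^sup>2 * w ^ (n - 1))"
    by (metis norm_mult norm_triangle_ineq)
  also have "\<dots> \<le> (norm w + norm k) * ?R (norm w) (norm k) + of_nat n * (norm k)\<^sup>2 * norm w ^ (n - 1)"
    using Suc by (intro add_mono mult_mono norm_triangle_ineq) (auto simp: norm_mult norm_power)
  also have "\<dots> = (norm w + norm k) ^ Suc n - norm w ^ Suc n - of_nat (Suc n) * norm k * norm w ^ (Suc n - 1)"
    by (cases n) (simp_all add: algebra_simps power2_eq_square)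
  finally show ?case .
qed simp

lemma of_nat_Suc_mult_divide_fact: "of_nat (Suc n) * x / fact (Suc n) = x / (fact n :: 'a::field_char_0)"
  unfolding fact_Suc by (simp del: of_nat_Suc)

lemma exp_remainder_sums:
  fixes a b r :: real
  shows "(\<lambda>n. ((a + b) ^ n - a ^ n - of_nat n * b * a ^ (n - 1)) * r ^ n / fact n)
    sums (exp (r * (a + b)) - exp (r * a) - r * b * exp (r * a))"
proof -
  have e: "(\<lambda>n. x ^ n * r ^ n / fact n) sums exp (r * x)" for x
    using exp_converges[of "r * x"] by (simp add: power_mult_distrib divide_inverse mult_ac)
  have "(\<lambda>n. r * b * (a ^ n * r ^ n / fact n)) sums (r * b * exp (r * a))"
    by (rule sums_mult[OF e])
  also have "(\<lambda>n. r * b * (a ^ n * r ^ n / fact n)) =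
      (\<lambda>n. of_nat (Suc n) * b * a ^ (Suc n - 1) * r ^ Suc n / fact (Suc n))"
    unfolding mult.assoc of_nat_Suc_mult_divide_fact by (auto simp: fun_eq_iff mult_ac)
  finally have "(\<lambda>n. of_nat n * b * a ^ (n - 1) * r ^ n / fact n) sums (r * b * exp (r * a))"
    by (subst (asm) sums_Suc_iff) simp
  from sums_diff[OF sums_diff[OF e[of "a + b"] e[of a]] this]
  show ?thesis by (simp only: left_diff_distrib diff_divide_distrib)
qed

text \<open>A Stirling-type bound n! \<le> e n (n/e)^n, from (n/(n+1))^(n+1) \<le> 1/e. The surplus
  factor n is absorbed when the exponential rate is raised slightly.\<close>

lemma fact_mult_exp_le: "1 \<le> n \<Longrightarrow> fact n * exp (real n) \<le> exp 1 * real n * real n ^ n"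
proof (induction n rule: nat_induct_at_least)
  case (Suc n)
  have "real n / real (Suc n) \<le> exp (- 1 / real (Suc n))"
    using exp_ge_add_one_self[of "- 1 / real (Suc n)"] by (simp add: field_simps)
  then have "(real n / real (Suc n)) ^ Suc n \<le> exp (- 1 / real (Suc n)) ^ Suc n"
    by (intro power_mono) auto
  also have "\<dots> = exp (- 1)" by (simp add: exp_of_nat_mult[symmetric] del: of_nat_Suc power_Suc)
  finally have *: "exp 1 * real n ^ Suc n \<le> real (Suc n) ^ Suc n"
    by (simp add: power_divide exp_minus field_simps del: of_nat_Suc power_Suc)
  have "fact (Suc n) * exp (real (Suc n)) = real (Suc n) * exp 1 * (fact n * exp (real n))"
    by (simp add: exp_add algebra_simps)
  also have "\<dots> \<le> real (Suc n) * exp 1 * (exp 1 * real n * real n ^ n)"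
    using Suc by (intro mult_left_mono) auto
  also have "\<dots> = real (Suc n) * exp 1 * (exp 1 * real n ^ Suc n)" by simp
  also have "\<dots> \<le> real (Suc n) * exp 1 * real (Suc n) ^ Suc n"
    using * by (intro mult_left_mono) auto
  finally show ?case by (simp add: mult_ac)
qed simp

locale complex_nonneg_self_adjoint = nonneg_self_adjoint D A
  for D :: "'a::{real_inner, complete_space} set" and A +
  fixes J :: "'a \<Rightarrow> 'a"
  assumes J: "complex_structure J"
    and J_domain: "x \<in> D \<Longrightarrow> J x \<in> D"
    and A_J: "x \<in> D \<Longrightarrow> A (J x) = J (A x)"
begin

lemma linear_J: "linear J" and J_J [simp]: "J (J x) = - x"
  and inner_J_J [simp]: "inner (J x) (J y) = inner x y"
  using J by (auto simp: complex_structure_def)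

lemma norm_J [simp]: "norm (J x) = norm x"
  by (simp add: norm_eq_sqrt_inner)

lemma inner_J_left: "inner (J x) y = - inner x (J y)"
  using inner_J_J[of "J x" y] by simp

lemma inner_J_self: "inner x (J x) = 0"
  using inner_J_left[of x x] by (simp add: inner_commute)

lemmas J_simps = linear_add[OF linear_J] linear_diff[OF linear_J] linear_scale[OF linear_J]

lemma bounded_linear_J: "bounded_linear J"
  by (rule bounded_linear_intro[of _ 1]) (simp_all add: J_simps)

lemma norm_scaleJ: "norm (scaleJ J c x) = cmod c * norm x"
proof (rule power2_eq_imp_eq)
  have "(norm (scaleJ J c x))\<^sup>2 = ((Re c)\<^sup>2 + (Im c)\<^sup>2) * inner x x"
    unfolding scaleJ_def power2_norm_eq_inner
    by (simp add: inner_add_left inner_add_right inner_J_left inner_J_self power2_eq_square algebra_simps)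
  also have "\<dots> = (cmod c * norm x)\<^sup>2"
    by (simp add: power_mult_distrib cmod_power2 power2_norm_eq_inner)
  finally show "(norm (scaleJ J c x))\<^sup>2 = (cmod c * norm x)\<^sup>2" .
qed auto

lemma scaleJ_diff_left: "scaleJ J (c - d) x = scaleJ J c x - scaleJ J d x"
  and scaleJ_diff_right: "scaleJ J c (x - y) = scaleJ J c x - scaleJ J c y"
  and scaleJ_scaleJ: "scaleJ J c (scaleJ J d x) = scaleJ J (c * d) x"
  and scaleJ_of_real: "scaleJ J (of_real t) x = t *\<^sub>R x"
  by (auto simp: scaleJ_def J_simps algebra_simps)

lemma bounded_linear_scaleJ: "bounded_linear (scaleJ J c)"
  unfolding scaleJ_def
  by (intro bounded_linear_add bounded_linear_scaleR_right
      bounded_linear_compose[OF bounded_linear_scaleR_right bounded_linear_J])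

lemma exp_vectors_J:
  assumes "x \<in> exp_vectors r"
  shows "J x \<in> exp_vectors r"
proof -
  have "(A ^^ k) (J x) = J ((A ^^ k) x)" for k
    using exp_vectorsD(1)[OF assms] by (induction k) (auto simp: A_J)
  then show ?thesis using assms J_domain by (auto simp: exp_vectors_def)
qed

lemma A_scaleJ: "x \<in> D \<Longrightarrow> A (scaleJ J c x) = scaleJ J c (A x)"
  by (simp add: scaleJ_def A_add A_scaleR A_J J_domain subspace_scale[OF subspace_D])

lemma exp_vectors_scaleJ:
  "0 \<le> r \<Longrightarrow> x \<in> exp_vectors r \<Longrightarrow> scaleJ J c x \<in> exp_vectors r"
  unfolding scaleJ_def by (intro subspace_add subspace_scale subspace_exp_vectors exp_vectors_J)

section \<open>The entire orbit of a vector of exponential type\<close>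

text \<open>\<open>exp_series g z\<close> is \<open>e\<^bsup>-zA\<^esup> g\<close> for \<open>g\<close> in some \<open>exp_vectors r\<close>.\<close>

definition exp_series :: "'a \<Rightarrow> complex \<Rightarrow> 'a" where
  "exp_series g z = (\<Sum>n. scaleJ J ((- z) ^ n / fact n) ((A ^^ n) g))"

context
  fixes r :: real and g :: 'a
  assumes r: "0 \<le> r" and g: "g \<in> exp_vectors r"
begin

lemma norm_exp_series_term_le:
  "norm (scaleJ J ((- z) ^ n / fact n) ((A ^^ n) g)) \<le> (r * cmod z) ^ n / fact n * norm g"
proof -
  have "norm (scaleJ J ((- z) ^ n / fact n) ((A ^^ n) g)) \<le> cmod z ^ n / fact n * (r ^ n * norm g)"
    using exp_vectorsD(2)[OF g, of n]
    by (simp add: norm_scaleJ norm_divide norm_power mult_left_mono divide_right_mono)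
  then show ?thesis by (simp add: power_mult_distrib mult_ac)
qed

lemma exp_bound_sums: "(\<lambda>n. (r * cmod z) ^ n / fact n * norm g) sums (exp (r * cmod z) * norm g)"
  using sums_mult2[OF exp_converges[of "r * cmod z"]] by (simp add: divide_inverse mult.commute)

lemma summable_norm_exp_series: "summable (\<lambda>n. norm (scaleJ J ((- z) ^ n / fact n) ((A ^^ n) g)))"
  by (rule summable_comparison_test'[OF sums_summable[OF exp_bound_sums[of z]]])
     (simp only: real_norm_def abs_norm_cancel norm_exp_series_term_le)

lemmas summable_exp_series = summable_norm_cancel_complete[OF summable_norm_exp_series]

lemma norm_exp_series_le: "norm (exp_series g z) \<le> norm g * exp (r * cmod z)"
proof -
  have "norm (exp_series g z) \<le> (\<Sum>n. norm (scaleJ J ((- z) ^ n / fact n) ((A ^^ n) g)))"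
    unfolding exp_series_def by (rule norm_suminf_le_suminf_norm[OF summable_norm_exp_series])
  also have "\<dots> \<le> (\<Sum>n. (r * cmod z) ^ n / fact n * norm g)"
    by (rule suminf_le[OF norm_exp_series_term_le summable_norm_exp_series
          sums_summable[OF exp_bound_sums]])
  also have "\<dots> = exp (r * cmod z) * norm g" using exp_bound_sums by (rule sums_unique[symmetric])
  finally show ?thesis by (simp add: mult.commute)
qed

lemma exp_series_mem: "exp_series g z \<in> exp_vectors r"
proof (rule closed_sequentially[OF closed_exp_vectors[OF r]])
  show "(\<lambda>N. \<Sum>n<N. scaleJ J ((- z) ^ n / fact n) ((A ^^ n) g)) \<longlonglongrightarrow> exp_series g z"
    unfolding exp_series_def by (rule summable_LIMSEQ[OF summable_exp_series])
  show "(\<Sum>n<N. scaleJ J ((- z) ^ n / fact n) ((A ^^ n) g)) \<in> exp_vectors r" for N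
    by (intro subspace_sum subspace_exp_vectors r exp_vectors_scaleJ exp_vectors_funpow g)
qed

lemma exp_series_0: "exp_series g 0 = g"
proof -
  have "exp_series g 0 = (\<Sum>n\<in>{0}. scaleJ J ((- 0) ^ n / fact n) ((A ^^ n) g))"
    unfolding exp_series_def by (rule suminf_finite) (auto simp: scaleJ_def power_0_left)
  then show ?thesis by (simp add: scaleJ_def)
qed

text \<open>Terms and sum stay in \<open>exp_vectors r\<close>, so \<open>A\<close> acts on them
  like the bounded \<open>A (P r x)\<close> and may be applied termwise.\<close>

lemma A_exp_series_sums:
  "(\<lambda>n. scaleJ J ((- z) ^ n / fact n) ((A ^^ Suc n) g)) sums A (exp_series g z)"
proof -
  have "(\<lambda>n. A (P r (scaleJ J ((- z) ^ n / fact n) ((A ^^ n) g)))) sums A (P r (exp_series g z))"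
    unfolding exp_series_def
    by (rule bounded_linear.sums[OF bounded_linear_A_P[OF r] summable_sums[OF summable_exp_series]])
  moreover have "A (P r (scaleJ J c ((A ^^ n) g))) = scaleJ J c ((A ^^ Suc n) g)" for c n
    using P_id[OF r exp_vectors_scaleJ[OF r exp_vectors_funpow[OF g r]], of c n]
    by (simp add: A_scaleJ exp_vectorsD(1)[OF g])
  ultimately show ?thesis by (simp add: P_id[OF r exp_series_mem])
qed

text \<open>Termwise majorisation by scalars reduces the vector-valued remainder to that of the real
  exponential, which is quadratic in \<open>cmod h\<close> near 0.\<close>

lemma norm_exp_series_remainder_le:
  "norm (exp_series g (z + h) - exp_series g z - scaleJ J h (- A (exp_series g z))) \<le>
    norm g * exp (r * cmod z) * (exp (r * cmod h) - 1 - r * cmod h)"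
proof -
  let ?d = "\<lambda>n. ((- z + - h) ^ n - (- z) ^ n - of_nat n * (- h) * (- z) ^ (n - 1)) / fact n"
  let ?R = "\<lambda>n. ((cmod z + cmod h) ^ n - cmod z ^ n - of_nat n * cmod h * cmod z ^ (n - 1)) * r ^ n / fact n"
  have "(\<lambda>n. scaleJ J (- h) (scaleJ J ((- z) ^ n / fact n) ((A ^^ Suc n) g))) sums
      scaleJ J (- h) (A (exp_series g z))"
    by (rule bounded_linear.sums[OF bounded_linear_scaleJ A_exp_series_sums])
  also have "(\<lambda>n. scaleJ J (- h) (scaleJ J ((- z) ^ n / fact n) ((A ^^ Suc n) g))) =
      (\<lambda>n. scaleJ J (of_nat (Suc n) * (- h) * (- z) ^ (Suc n - 1) / fact (Suc n)) ((A ^^ Suc n) g))"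
    unfolding scaleJ_scaleJ mult.assoc of_nat_Suc_mult_divide_fact by (simp only: diff_Suc_1 times_divide_eq_right)
  finally have s: "(\<lambda>n. scaleJ J (of_nat n * (- h) * (- z) ^ (n - 1) / fact n) ((A ^^ n) g)) sums
      scaleJ J (- h) (A (exp_series g z))"
    by (subst (asm) sums_Suc_iff) (simp add: scaleJ_def)
  have e: "(\<lambda>n. scaleJ J ((- z) ^ n / fact n) ((A ^^ n) g)) sums exp_series g z" for z
    unfolding exp_series_def by (rule summable_sums[OF summable_exp_series])
  have "(\<lambda>n. scaleJ J (?d n) ((A ^^ n) g)) sums
      (exp_series g (z + h) - exp_series g z - scaleJ J (- h) (A (exp_series g z)))"
    using sums_diff[OF sums_diff[OF e[of "z + h"] e[of z]] s]
    by (simp only: scaleJ_diff_left diff_divide_distrib minus_add_distrib)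
  moreover have "scaleJ J (- h) (A (exp_series g z)) = scaleJ J h (- A (exp_series g z))"
    by (simp add: scaleJ_def linear_neg[OF linear_J])
  ultimately have sum: "exp_series g (z + h) - exp_series g z - scaleJ J h (- A (exp_series g z)) =
      (\<Sum>n. scaleJ J (?d n) ((A ^^ n) g))"
    by (simp add: sums_iff)
  have le: "norm (scaleJ J (?d n) ((A ^^ n) g)) \<le> ?R n * norm g" for n
  proof -
    have d: "cmod (?d n) \<le> ((cmod z + cmod h) ^ n - cmod z ^ n - of_nat n * cmod h * cmod z ^ (n - 1)) / fact n"
      using norm_power_add_remainder_le[of "- z" "- h" n]
      by (simp add: norm_divide divide_right_mono)
    have "norm (scaleJ J (?d n) ((A ^^ n) g)) \<le>
        ((cmod z + cmod h) ^ n - cmod z ^ n - of_nat n * cmod h * cmod z ^ (n - 1)) / fact n * (r ^ n * norm g)"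
      unfolding norm_scaleJ
      by (rule mult_mono[OF d exp_vectorsD(2)[OF g] order_trans[OF norm_ge_zero d]]) simp
    then show ?thesis by (simp add: field_simps)
  qed
  have R: "(\<lambda>n. ?R n * norm g) sums
      ((exp (r * (cmod z + cmod h)) - exp (r * cmod z) - r * cmod h * exp (r * cmod z)) * norm g)"
    by (rule sums_mult2[OF exp_remainder_sums])
  have sn: "summable (\<lambda>n. norm (scaleJ J (?d n) ((A ^^ n) g)))"
    by (rule summable_comparison_test'[OF sums_summable[OF R]]) (use le in simp)
  have "norm (\<Sum>n. scaleJ J (?d n) ((A ^^ n) g)) \<le> (\<Sum>n. norm (scaleJ J (?d n) ((A ^^ n) g)))"
    by (rule norm_suminf_le_suminf_norm[OF sn])
  also have "\<dots> \<le> (\<Sum>n. ?R n * norm g)"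
    by (rule suminf_le[OF le sn sums_summable[OF R]])
  also have "\<dots> = (exp (r * (cmod z + cmod h)) - exp (r * cmod z) - r * cmod h * exp (r * cmod z)) * norm g"
    using R by (rule sums_unique[symmetric])
  also have "\<dots> = norm g * exp (r * cmod z) * (exp (r * cmod h) - 1 - r * cmod h)"
    by (simp add: distrib_left exp_add algebra_simps)
  finally show ?thesis unfolding sum .
qed

lemma exp_series_differentiable:
  "((\<lambda>h. scaleJ J (inverse h) (exp_series g (z + h) - exp_series g z)) \<longlongrightarrow> - A (exp_series g z)) (at 0)"
proof -
  let ?q = "\<lambda>h. scaleJ J (inverse h) (exp_series g (z + h) - exp_series g z)"
  let ?C = "norm g * exp (r * cmod z) * r\<^sup>2"
  have "\<forall>\<^sub>F h in at 0. norm (?q h - - A (exp_series g z)) \<le> ?C * cmod h"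
  proof -
    \<comment> \<open>This radius ensures \<open>r * cmod h \<le> 1\<close>, the range where the
      exponential remainder is at most the square of its argument.\<close>
    have "\<forall>\<^sub>F h in at (0::complex). dist h 0 < 1 / (r + 1)"
      using r by (intro tendstoD tendsto_ident_at) auto
    moreover have "\<forall>\<^sub>F h in at (0::complex). h \<noteq> 0" by (simp add: eventually_at_filter)
    ultimately show ?thesis
    proof eventually_elim
      case (elim h)
      have "cmod h * (r + 1) < 1" using elim(1) r by (simp add: field_simps)
      moreover have "cmod h * (r + 1) = cmod h + r * cmod h" by (simp add: algebra_simps)
      ultimately have le1: "r * cmod h \<le> 1" using norm_ge_zero[of h] by linarith
      have "scaleJ J (inverse h) (scaleJ J h x) = x" for x
        using elim(2) by (simp add: scaleJ_scaleJ) (simp add: scaleJ_def)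
      then have "?q h - - A (exp_series g z) =
          scaleJ J (inverse h) (exp_series g (z + h) - exp_series g z - scaleJ J h (- A (exp_series g z)))"
        by (simp only: scaleJ_diff_right)
      then have "norm (?q h - - A (exp_series g z)) \<le>
          inverse (cmod h) * (norm g * exp (r * cmod z) * (exp (r * cmod h) - 1 - r * cmod h))"
        using norm_exp_series_remainder_le[of z h]
        by (simp add: norm_scaleJ norm_inverse mult_left_mono)
      also have "\<dots> \<le> inverse (cmod h) * (norm g * exp (r * cmod z) * (r * cmod h)\<^sup>2)"
        using exp_bound[OF _ le1] r by (intro mult_left_mono) auto
      also have "\<dots> = ?C * cmod h" using elim(2) by (simp add: power2_eq_square field_simps)
      finally show ?case .
    qed
  qed
  moreover have "((\<lambda>h. ?C * cmod h) \<longlongrightarrow> 0) (at 0)"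
    by (intro tendsto_mult_right_zero tendsto_norm_zero tendsto_ident_at)
  ultimately have "((\<lambda>h. ?q h - - A (exp_series g z)) \<longlongrightarrow> 0) (at 0)"
    by (rule Lim_null_comparison)
  then show ?thesis by (rule LIM_zero_cancel)
qed

lemma exp_series_has_vector_derivative:
  "((\<lambda>t. exp_series g (of_real t)) has_vector_derivative - A (exp_series g (of_real t))) (at t within S)"
proof -
  let ?f = "\<lambda>t. exp_series g (of_real t)" and ?d = "- A (exp_series g (of_real t))"
  have "filterlim (of_real :: real \<Rightarrow> complex) (at 0) (at 0)"
  proof -
    have "((of_real :: real \<Rightarrow> complex) \<longlongrightarrow> of_real 0) (at 0)" by (intro tendsto_intros)
    then show ?thesis by (simp add: filterlim_at eventually_at_filter)
  qed
  from filterlim_compose[OF exp_series_differentiable this]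
  have "((\<lambda>h. scaleJ J (inverse (of_real h)) (?f (t + h) - ?f t)) \<longlongrightarrow> ?d) (at 0)" by simp
  then have "((\<lambda>h. (1 / h) *\<^sub>R (?f (t + h) - ?f t)) \<longlongrightarrow> ?d) (at 0)"
    unfolding of_real_inverse[symmetric] scaleJ_of_real by (simp add: divide_inverse)
  then have "((\<lambda>h. (1 / h) *\<^sub>R (?f (t + h) - ?f t) - ?d) \<longlongrightarrow> 0) (at 0)"
    by (rule LIM_zero)
  then have "((\<lambda>h. norm ((1 / h) *\<^sub>R (?f (t + h) - ?f t) - ?d)) \<longlongrightarrow> 0) (at 0)"
    by (rule tendsto_norm_zero)
  moreover have "\<forall>\<^sub>F h in at 0. norm ((1 / h) *\<^sub>R (?f (t + h) - ?f t) - ?d) =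
      norm (?f (t + h) - ?f t - h *\<^sub>R ?d) / norm h"
  proof -
    have "norm ((1 / h) *\<^sub>R (?f (t + h) - ?f t) - ?d) = norm (?f (t + h) - ?f t - h *\<^sub>R ?d) / norm h"
      if "h \<noteq> 0" for h
    proof -
      have "(1 / h) *\<^sub>R (?f (t + h) - ?f t) - ?d = (1 / h) *\<^sub>R (?f (t + h) - ?f t - h *\<^sub>R ?d)"
        using that by (simp add: scaleR_diff_right scaleR_add_right)
      then show ?thesis by (simp only: norm_scaleR) simp
    qed
    then show ?thesis by (auto simp: eventually_at_filter)
  qed
  ultimately have "((\<lambda>h. norm (?f (t + h) - ?f t - h *\<^sub>R ?d) / norm h) \<longlongrightarrow> 0) (at 0)"
    by (rule Lim_transform_eventually)
  then have "(?f has_vector_derivative ?d) (at t)"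
    unfolding has_vector_derivative_def has_derivative_at
    using bounded_linear_scaleR_left by blast
  then show ?thesis by (rule has_vector_derivative_at_within)
qed

lemma exp_series_in_S0_type:
  assumes "0 < r"
  shows "in_S0_type J D A (\<lambda>t. exp_series g (of_real t)) r"
  unfolding in_S0_type_def
proof (intro conjI exI)
  show "weak_solution D A (\<lambda>t. exp_series g (of_real t))"
    by (rule weak_solutionI_exp_vectors[OF r exp_series_mem exp_series_has_vector_derivative])
  show "entire_ext J (\<lambda>t. exp_series g (of_real t)) (exp_series g)"
    unfolding entire_ext_def using exp_series_differentiable by blast
  have mem: "r \<in> exp_type_set (exp_series g)"
    unfolding exp_type_set_def using assms norm_exp_series_le by blast
  then show "exp_type_set (exp_series g) \<noteq> {}" by blast
  have "bdd_below (exp_type_set (exp_series g))"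
    by (rule bdd_belowI[of _ 0]) (auto simp: exp_type_set_def)
  then show "exp_type (exp_series g) \<le> r"
    unfolding exp_type_def using mem by (rule cInf_lower[rotated])
qed

end

text \<open>The complex inner product, linear in \<open>x\<close>; with \<open>v\<close> fixed it
  turns a vector-valued entire function into a scalar one.\<close>

definition cinner :: "'a \<Rightarrow> 'a \<Rightarrow> complex" where
  "cinner v x = Complex (inner x v) (inner x (J v))"

lemma norm_cinner_le: "norm (cinner v x) \<le> 2 * norm v * norm x"
proof -
  have "norm (cinner v x) \<le> \<bar>inner x v\<bar> + \<bar>inner x (J v)\<bar>"
    using cmod_le[of "cinner v x"] by (simp add: cinner_def)
  also have "\<dots> \<le> norm x * norm v + norm x * norm (J v)"
    by (intro add_mono Cauchy_Schwarz_ineq2)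
  finally show ?thesis by (simp add: mult_ac)
qed

lemma bounded_linear_cinner: "bounded_linear (cinner v)"
  by (rule bounded_linear_intro[of _ "2 * norm v"])
     (use norm_cinner_le in \<open>auto simp: cinner_def complex_eq_iff inner_add_left mult.commute\<close>)

lemma cinner_scaleJ: "cinner v (scaleJ J c x) = c * cinner v x"
  by (simp add: cinner_def scaleJ_def complex_eq_iff inner_add_left inner_J_left)

lemmas cinner_diff = linear_diff[OF bounded_linear.linear[OF bounded_linear_cinner]]

context
  fixes y :: "real \<Rightarrow> 'a" and Y :: "complex \<Rightarrow> 'a"
  assumes y: "weak_solution D A y" and Y: "entire_ext J y Y"
begin

lemma cinner_entire: "(\<lambda>z. cinner v (Y z)) holomorphic_on UNIV"
proof -
  have "\<exists>d. ((\<lambda>z. cinner v (Y z)) has_field_derivative d) (at z)" for z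
  proof -
    obtain d where "((\<lambda>h. scaleJ J (inverse h) (Y (z + h) - Y z)) \<longlongrightarrow> d) (at 0)"
      using Y unfolding entire_ext_def by blast
    from bounded_linear.tendsto[OF bounded_linear_cinner this, of v]
    have "((\<lambda>h. (cinner v (Y (z + h)) - cinner v (Y z)) / h) \<longlongrightarrow> cinner v d) (at 0)"
      by (simp add: cinner_scaleJ cinner_diff divide_inverse mult.commute)
    then show ?thesis unfolding DERIV_def by blast
  qed
  then show ?thesis by (auto simp: holomorphic_on_def field_differentiable_def)
qed

text \<open>On the half-line this is the equation tested against \<open>v\<close>, which only needs
  \<open>v\<close> in \<open>D\<close>; both sides are entire, so the identity theorem extends it to
  the plane.\<close>

lemma deriv_cinner:
  assumes v: "v \<in> D"
  shows "deriv (\<lambda>z. cinner v (Y z)) = (\<lambda>z. - cinner (A v) (Y z))"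
proof
  fix w
  let ?F = "\<lambda>z. cinner v (Y z)" and ?G = "\<lambda>z. deriv (\<lambda>z. cinner v (Y z)) z + cinner (A v) (Y z)"
  \<comment> \<open>The same right-hand difference quotients are evaluated twice, by the integral
    equation and by the complex derivative.\<close>
  have real: "deriv ?F (of_real t) = - cinner (A v) (y t)" if t: "0 \<le> t" for t
  proof -
    have Yt: "Y (of_real s) = y s" if "0 \<le> s" for s using Y that by (simp add: entire_ext_def)
    have eq: "cinner v (y s) = cinner v (y 0) - cinner (A v) (integral {0..s} y)" if "0 \<le> s" for s
    proof -
      note I = weak_solutionD(2)[OF y that]
      have "y s = y 0 - A (integral {0..s} y)" using weak_solutionD(3)[OF y that] by simp
      then have "cinner v (y s) = cinner v (y 0) - cinner v (A (integral {0..s} y))"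
        by (metis cinner_diff)
      also have "cinner v (A (integral {0..s} y)) = cinner (A v) (integral {0..s} y)"
        using A_sym[OF I v] A_sym[OF I J_domain[OF v]] by (simp add: cinner_def A_J[OF v])
      finally show ?thesis .
    qed
    have *: "((\<lambda>s. cinner v (y 0) - cinner (A v) (integral {0..s} y)) has_vector_derivative
        0 - cinner (A v) (y t)) (at t within {0..})"
      by (intro has_vector_derivative_diff has_vector_derivative_const
          bounded_linear.has_vector_derivative[OF bounded_linear_cinner]
          has_vector_derivative_integral_atLeast weak_solutionD(1)[OF y] t)
    have "((\<lambda>s. cinner v (y s)) has_vector_derivative 0 - cinner (A v) (y t)) (at t within {0..})"
      by (rule has_vector_derivative_transform[OF _ _ *]) (use t eq in blast)+
    from has_vector_derivative_imp_sequence[OF this t]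
    have l1: "(\<lambda>n. real (Suc n) *\<^sub>R (cinner v (y (t + 1 / Suc n)) - cinner v (y t)))
        \<longlonglongrightarrow> - cinner (A v) (y t)" by simp
    have "(?F has_field_derivative deriv ?F (of_real t)) (at (of_real t))"
      using holomorphic_derivI[OF cinner_entire open_UNIV] by simp
    then have "((\<lambda>s. ?F (of_real s)) has_vector_derivative deriv ?F (of_real t)) (at t within {0..})"
      by (intro has_vector_derivative_real_field)
    from has_vector_derivative_imp_sequence[OF this t]
    have "(\<lambda>n. real (Suc n) *\<^sub>R (?F (of_real (t + 1 / Suc n)) - ?F (of_real t))) \<longlonglongrightarrow> deriv ?F (of_real t)" .
    moreover have "?F (of_real (t + 1 / Suc n)) = cinner v (y (t + 1 / Suc n))"
      "?F (of_real t) = cinner v (y t)" for n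
      using Yt[of "t + 1 / Suc n"] Yt[of t] t by (simp_all del: of_real_add of_nat_Suc)
    ultimately have "(\<lambda>n. real (Suc n) *\<^sub>R (cinner v (y (t + 1 / Suc n)) - cinner v (y t)))
        \<longlonglongrightarrow> deriv ?F (of_real t)" by simp
    from LIMSEQ_unique[OF this l1] show ?thesis .
  qed
  have "?G w = 0"
  proof (rule analytic_continuation[of ?G UNIV "of_real ` {0..}" 0])
    show "?G holomorphic_on UNIV"
      by (intro holomorphic_on_add holomorphic_deriv cinner_entire open_UNIV)
    have "(0::complex) islimpt (of_real ` {0..})"
      unfolding islimpt_sequential
    proof (intro exI conjI allI)
      show "complex_of_real (1 / Suc n) \<in> of_real ` {0..} - {0}" for n
        by (intro DiffI imageI) (simp_all del: of_real_divide of_nat_Suc)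
      show "(\<lambda>n. complex_of_real (1 / Suc n)) \<longlonglongrightarrow> 0"
      proof -
        have "(\<lambda>n. complex_of_real (1 / Suc n)) \<longlonglongrightarrow> of_real 0"
          by (intro tendsto_of_real LIMSEQ_Suc[OF lim_1_over_n])
        then show ?thesis by simp
      qed
    qed
    then show "(0::complex) islimpt (of_real ` {0..})" .
    show "?G z = 0" if "z \<in> of_real ` {0..}" for z
      using that real Y by (auto simp: entire_ext_def)
  qed auto
  then show "deriv ?F w = - cinner (A v) (Y w)" by (simp add: eq_neg_iff_add_eq_0)
qed

lemma higher_deriv_cinner:
  assumes "\<And>k. k < n \<Longrightarrow> (A ^^ k) v \<in> D"
  shows "(deriv ^^ n) (\<lambda>z. cinner v (Y z)) = (\<lambda>z. (-1) ^ n * cinner ((A ^^ n) v) (Y z))"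
  using assms
proof (induction n)
  case (Suc n)
  have IH: "(deriv ^^ n) (\<lambda>z. cinner v (Y z)) = (\<lambda>z. (-1) ^ n * cinner ((A ^^ n) v) (Y z))"
    using Suc by simp
  have "deriv (\<lambda>z. (-1) ^ n * cinner ((A ^^ n) v) (Y z)) z = (-1) ^ Suc n * cinner ((A ^^ Suc n) v) (Y z)" for z
    using holomorphic_on_imp_differentiable_at[OF cinner_entire open_UNIV]
      fun_cong[OF deriv_cinner[OF Suc.prems[of n]]]
    by (subst deriv_cmult) auto
  then show ?case by (simp only: funpow.simps o_apply IH)
qed simp

lemma exponential_type_funpow_bound:
  assumes c: "\<And>z. norm (Y z) \<le> c * exp (\<alpha> * cmod z)" and \<alpha>: "0 < \<alpha>" and s: "0 \<le> s" and n: "1 \<le> n"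
  shows "norm ((A ^^ n) (P s (y 0))) \<le> 2 * c * exp 1 * real n * \<alpha> ^ n"
proof -
  \<comment> \<open>Testing against \<open>w\<close> itself turns the scalar Cauchy estimate into \<open>norm w ^ 2 \<le> C * norm w\<close>;
    the radius \<open>n / \<alpha>\<close> minimises \<open>exp (\<alpha> * \<rho>) / \<rho> ^ n\<close>.\<close>
  define w where "w = (A ^^ n) (P s (y 0))"
  have w: "w \<in> exp_vectors s" unfolding w_def by (intro exp_vectors_funpow P_mem s)
  define \<rho> where "\<rho> = real n / \<alpha>"
  have \<rho>: "\<rho> > 0" using n \<alpha> by (simp add: \<rho>_def)
  have c0: "0 \<le> c" using order_trans[OF norm_ge_zero c[of 0]] by simp
  have "norm ((deriv ^^ n) (\<lambda>z. cinner w (Y z)) 0) \<le> fact n * (2 * norm w * (c * exp (\<alpha> * \<rho>))) / \<rho> ^ n"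
  proof (rule Cauchy_inequality)
    show "(\<lambda>z. cinner w (Y z)) holomorphic_on ball 0 \<rho>"
      using cinner_entire holomorphic_on_subset by blast
    show "continuous_on (cball 0 \<rho>) (\<lambda>z. cinner w (Y z))"
      using holomorphic_on_imp_continuous_on[OF cinner_entire] continuous_on_subset by blast
    fix x :: complex assume x: "norm (0 - x) = \<rho>"
    have "norm (cinner w (Y x)) \<le> 2 * norm w * norm (Y x)" by (rule norm_cinner_le)
    also have "\<dots> \<le> 2 * norm w * (c * exp (\<alpha> * \<rho>))"
      using c[of x] x by (intro mult_left_mono) auto
    finally show "norm (cinner w (Y x)) \<le> 2 * norm w * (c * exp (\<alpha> * \<rho>))" .
  qed (rule \<rho>)
  also have "(deriv ^^ n) (\<lambda>z. cinner w (Y z)) 0 = (-1) ^ n * cinner ((A ^^ n) w) (y 0)"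
  proof -
    have "Y 0 = y 0" using Y unfolding entire_ext_def by (metis of_real_0 order_refl)
    then show ?thesis using higher_deriv_cinner[of n w] exp_vectorsD(1)[OF w] by simp
  qed
  finally have "norm (cinner ((A ^^ n) w) (y 0)) \<le> fact n * (2 * norm w * (c * exp (\<alpha> * \<rho>))) / \<rho> ^ n"
    by (simp add: norm_mult norm_power)
  moreover have "\<bar>inner (y 0) ((A ^^ n) w)\<bar> \<le> norm (cinner ((A ^^ n) w) (y 0))"
    using abs_Re_le_cmod[of "cinner ((A ^^ n) w) (y 0)"] by (simp add: cinner_def)
  \<comment> \<open>\<open>y 0\<close> is not yet known to lie in any domain, so \<open>P s\<close>
    is inserted next to it before the powers of \<open>A\<close> move across.\<close>
  moreover have "inner (y 0) ((A ^^ n) w) = (norm w)\<^sup>2"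
  proof -
    have sym: "inner x ((A ^^ k) w) = inner ((A ^^ k) x) w" if "x \<in> exp_vectors s" for x k
      using that
    proof (induction k arbitrary: x)
      case (Suc k)
      have "inner x ((A ^^ Suc k) w) = inner (A x) ((A ^^ k) w)"
        using A_sym[OF exp_vectors_domain[OF Suc.prems] exp_vectorsD(1)[OF w]] by simp
      also have "\<dots> = inner ((A ^^ k) (A x)) w"
        by (rule Suc.IH[OF exp_vectors_A[OF Suc.prems s]])
      finally show ?case by (simp only: funpow_Suc_right o_apply)
    qed simp
    have "inner (y 0) ((A ^^ n) w) = inner (P s (y 0)) ((A ^^ n) w)"
      using inner_P_commute[OF s, of "y 0" "(A ^^ n) w"] by (simp add: P_id[OF s exp_vectors_funpow[OF w s]])
    also have "\<dots> = inner ((A ^^ n) (P s (y 0))) w" by (rule sym[OF P_mem[OF s]])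
    finally show ?thesis by (simp add: w_def[symmetric] power2_norm_eq_inner)
  qed
  ultimately have le: "norm w * norm w \<le> norm w * (2 * c * (fact n * exp (real n) / \<rho> ^ n))"
    using \<alpha> by (simp add: power2_eq_square \<rho>_def mult_ac)
  have "fact n * exp (real n) / \<rho> ^ n \<le> exp 1 * real n * real n ^ n / \<rho> ^ n"
    using \<rho> by (intro divide_right_mono fact_mult_exp_le n) auto
  also have "\<dots> = exp 1 * real n * \<alpha> ^ n" using n \<alpha> by (simp add: \<rho>_def power_divide)
  finally have le2: "2 * c * (fact n * exp (real n) / \<rho> ^ n) \<le> 2 * c * (exp 1 * real n * \<alpha> ^ n)"
    using c0 by (intro mult_left_mono) auto
  show ?thesis
  proof (cases "w = 0")
    case True
    then show ?thesis using c0 \<alpha> by (simp add: w_def)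
  next
    case False
    then have "norm w \<le> 2 * c * (fact n * exp (real n) / \<rho> ^ n)"
      using mult_left_le_imp_le[OF le] by simp
    then show ?thesis using le2 by (simp add: w_def mult_ac)
  qed
qed

text \<open>The infimum defining the type need not be attained, so each \<beta> > r is treated
  first; the resulting bounds all have the constant \<open>norm (y 0)\<close>, hence \<beta> may
  tend to r.\<close>

lemma initial_value_exp_vectors:
  assumes ne: "exp_type_set Y \<noteq> {}" and type: "exp_type Y \<le> r" and r: "0 \<le> r"
  shows "y 0 \<in> exp_vectors r"
proof -
  have mem: "y 0 \<in> exp_vectors \<beta>" if \<beta>: "r < \<beta>" for \<beta>
  proof -
    obtain \<alpha> where \<alpha>: "\<alpha> \<in> exp_type_set Y" "\<alpha> < \<beta>"
      using cInf_lessD[OF ne, of \<beta>] type \<beta> by (auto simp: exp_type_def)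
    then obtain c where \<alpha>0: "0 < \<alpha>" and c: "\<And>z. norm (Y z) \<le> c * exp (\<alpha> * cmod z)"
      by (auto simp: exp_type_set_def)
    have c0: "0 \<le> c" using order_trans[OF norm_ge_zero c[of 0]] by simp
    \<comment> \<open>Bernoulli's inequality gives k x \<le> (\<beta>/\<alpha>)^k, which absorbs the
      linear factor of the Cauchy bound.\<close>
    define x where "x = \<beta> / \<alpha> - 1"
    have x: "x > 0" using \<alpha>(2) \<alpha>0 by (simp add: x_def)
    have Pn: "P s (y 0) \<in> exp_vectors \<beta>" if s: "0 \<le> s" for s
    proof (rule exp_vectorsI)
      show "(A ^^ k) (P s (y 0)) \<in> D" for k by (rule exp_vectorsD(1)[OF P_mem[OF s]])
      show "0 \<le> \<beta>" using r \<beta> by simp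
      show "norm ((A ^^ k) (P s (y 0))) \<le> (norm (P s (y 0)) + 2 * c * exp 1 / x) * \<beta> ^ k" for k
      proof (cases "k = 0")
        case True then show ?thesis using c0 x by simp
      next
        case False
        have "1 + real k * x \<le> (1 + x) ^ k" using x by (intro Bernoulli_inequality) simp
        then have "real k * x \<le> (\<beta> / \<alpha>) ^ k" by (simp add: x_def)
        then have "real k * \<alpha> ^ k \<le> \<beta> ^ k / x" using x \<alpha>0 by (simp add: power_divide field_simps)
        then have "2 * c * exp 1 * (real k * \<alpha> ^ k) \<le> 2 * c * exp 1 * (\<beta> ^ k / x)"
          using c0 by (intro mult_left_mono) auto
        moreover have "0 \<le> norm (P s (y 0)) * \<beta> ^ k" using r \<beta> by simp
        ultimately show ?thesis
          using exponential_type_funpow_bound[OF c \<alpha>0 s, of k] False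
          by (simp add: algebra_simps)
      qed
    qed
    have b0: "0 \<le> \<beta>" using r \<beta> by simp
    \<comment> \<open>Membership does not depend on the constant used to prove it, so closedness
      removes the truncation as \<open>s\<close> grows.\<close>
    show ?thesis
      by (rule closed_sequentially[OF closed_exp_vectors[OF b0] _ P_tendsto]) (simp add: Pn)
  qed
  have "norm ((A ^^ k) (y 0)) \<le> r ^ k * norm (y 0)" for k
  proof (rule LIMSEQ_le_const)
    have "(\<lambda>n. (r + 1 / Suc n) ^ k * norm (y 0)) \<longlonglongrightarrow> (r + 0) ^ k * norm (y 0)"
      by (intro tendsto_intros LIMSEQ_Suc[OF lim_1_over_n])
    then show "(\<lambda>n. (r + 1 / Suc n) ^ k * norm (y 0)) \<longlonglongrightarrow> r ^ k * norm (y 0)" by simp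
    have "norm ((A ^^ k) (y 0)) \<le> (r + 1 / Suc n) ^ k * norm (y 0)" for n
      by (rule exp_vectorsD(2)[OF mem]) simp
    then show "\<exists>N. \<forall>n\<ge>N. norm ((A ^^ k) (y 0)) \<le> (r + 1 / Suc n) ^ k * norm (y 0)" by blast
  qed
  moreover have "(A ^^ k) (y 0) \<in> D" for k using exp_vectorsD(1)[OF mem[of "r + 1"]] by simp
  ultimately show ?thesis by (simp add: exp_vectors_def)
qed

end

theorem best_approx_eq:
  assumes y: "weak_solution D A y" and r: "0 < r"
  shows "best_approx J D A r y = norm (y 0 - P r (y 0))"
  unfolding best_approx_def
proof (rule cInf_eq_minimum)
  have r0: "0 \<le> r" using r by simp
  let ?u = "\<lambda>t. exp_series (P r (y 0)) (of_real t)"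
  have u: "in_S0_type J D A ?u r" by (rule exp_series_in_S0_type[OF r0 P_mem[OF r0] r])
  then have "S_norm (\<lambda>t. y t - ?u t) = norm (y 0 - ?u 0)"
    by (intro S_norm_diff_weak_solutions y) (simp add: in_S0_type_def)
  also have "?u 0 = P r (y 0)" using exp_series_0[OF r0 P_mem[OF r0]] by simp
  finally show "norm (y 0 - P r (y 0)) \<in> {S_norm (\<lambda>t. y t - y0 t) |y0. in_S0_type J D A y0 r}"
    unfolding mem_Collect_eq using u by (intro exI[of _ ?u]) simp
  fix e assume "e \<in> {S_norm (\<lambda>t. y t - y0 t) |y0. in_S0_type J D A y0 r}"
  then obtain y0 Y where y0: "weak_solution D A y0" and e: "e = S_norm (\<lambda>t. y t - y0 t)"
    and Y: "entire_ext J y0 Y" "exp_type_set Y \<noteq> {}" "exp_type Y \<le> r"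
    by (auto simp: in_S0_type_def)
  have "y0 0 \<in> exp_vectors r" by (rule initial_value_exp_vectors[OF y0 Y r0])
  then show "norm (y 0 - P r (y 0)) \<le> e"
    unfolding e S_norm_diff_weak_solutions[OF y y0] by (rule norm_diff_P_minimal[OF r0])
qed

end

section \<open>Smoothness and the rate of best approximation\<close>

text \<open>Telescoping over the cut-offs R 2^j: each increment lies in the larger spectral
  subspace, where \<open>A\<close> is bounded. The hypothesis has exponent n + 1, and its extra
  power of r makes the sum of n-th powers geometric.\<close>

lemma (in nonneg_self_adjoint) bernstein_inverse:
  assumes R: "1 \<le> R" and K: "0 \<le> K"
    and e: "\<And>r. R \<le> r \<Longrightarrow> r ^ Suc n * norm (f - P r f) \<le> K"
  shows "k < n \<Longrightarrow> (A ^^ k) f \<in> D" and "norm ((A ^^ n) f) \<le> R ^ n * norm f + 2 ^ Suc n * K"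
proof -
  define q where "q = (\<lambda>j::nat. R * 2 ^ j)"
  have qR: "R \<le> q j" for j
    using R mult_left_mono[of 1 "2 ^ j" R] by (simp add: q_def)
  have q1: "1 \<le> q j" and q0: "0 \<le> q j" for j using R qR[of j] by linarith+
  have q2: "2 ^ j \<le> q j" for j using R by (simp add: q_def)
  define F where "F = (\<lambda>j. P (q j) f)"
  have F: "F j \<in> exp_vectors (q j)" for j unfolding F_def by (rule P_mem[OF q0])
  have err: "norm (f - F j) * q j ^ Suc k \<le> K" if "k \<le> n" for j k
  proof -
    have "norm (f - F j) * q j ^ Suc k \<le> norm (f - F j) * q j ^ Suc n"
      using that q1 by (intro mult_left_mono power_increasing) auto
    also have "\<dots> \<le> K" using e[OF qR, of j] by (simp add: F_def mult.commute)
    finally show ?thesis .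
  qed
  have half: "x \<le> K * (1/2) ^ j" if "x * q j \<le> K" "0 \<le> x" for x j
  proof -
    have "x * 2 ^ j \<le> x * q j" using that(2) q2 by (rule mult_left_mono[rotated])
    then have "x * 2 ^ j \<le> K" using that(1) by linarith
    then show ?thesis by (simp add: power_divide field_simps)
  qed
  have Flim: "F \<longlonglongrightarrow> f"
  proof -
    have "norm (F j - f) \<le> K * (1/2) ^ j" for j
      using half[OF _ norm_ge_zero, of "f - F j" j] err[of 0 j] by (simp add: norm_minus_commute)
    moreover have "(\<lambda>j. K * (1/2) ^ j) \<longlonglongrightarrow> 0"
      by (intro tendsto_mult_right_zero LIMSEQ_power_zero) simp
    ultimately have "(\<lambda>j. F j - f) \<longlonglongrightarrow> 0"
      using Lim_null_comparison[OF always_eventually, of "\<lambda>j. F j - f" "\<lambda>j. K * (1/2) ^ j"] by blast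
    then show ?thesis by (rule LIM_zero_cancel)
  qed
  \<comment> \<open>For the increments, k powers of \<open>A\<close> cost
    \<open>q (Suc j) ^ k = 2 ^ k * q j ^ k\<close>; the decay pays for \<open>q j ^ Suc k\<close>,
    leaving at least a factor 2^(-j).\<close>
  have FD: "(A ^^ k) (F j) \<in> D" for k j using exp_vectorsD(1)[OF F] .
  have step: "norm ((A ^^ k) (F (Suc j)) - (A ^^ k) (F j)) \<le> 2 ^ n * K * (1/2) ^ j" if k: "k \<le> n" for k j
  proof -
    have mono: "F j \<in> exp_vectors (q (Suc j))"
      using exp_vectors_mono[OF q0, of j "q (Suc j)"] F R by (auto simp: q_def)
    have mem: "F (Suc j) - F j \<in> exp_vectors (q (Suc j))"
      by (intro subspace_diff subspace_exp_vectors q0 F mono)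
    have sub: "(A ^^ k) (F (Suc j)) = (A ^^ k) (F (Suc j) - F j) + (A ^^ k) (F j)"
      using funpow_A_add[of k "F (Suc j) - F j" "F j"] exp_vectorsD(1)[OF mem] FD by simp
    have "F (Suc j) - F j = P (q (Suc j)) (f - F j)"
      by (simp add: P_diff[OF q0] P_id[OF q0 mono] F_def[symmetric]) (simp add: F_def)
    then have le: "norm (F (Suc j) - F j) \<le> norm (f - F j)"
      using norm_P_le[OF q0] by metis
    have "norm ((A ^^ k) (F (Suc j)) - (A ^^ k) (F j)) \<le> q (Suc j) ^ k * norm (F (Suc j) - F j)"
      unfolding sub using exp_vectorsD(2)[OF mem] by simp
    also have "\<dots> \<le> q (Suc j) ^ k * norm (f - F j)"
      using le q0 by (intro mult_left_mono) auto
    also have "\<dots> = 2 ^ k * (norm (f - F j) * q j ^ k)"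
      by (simp add: q_def power_mult_distrib mult_ac)
    also have "\<dots> \<le> 2 ^ n * (K * (1/2) ^ j)"
    proof (rule mult_mono)
      show "norm (f - F j) * q j ^ k \<le> K * (1/2) ^ j"
        using err[OF k, of j] q0 by (intro half) (auto simp: mult_ac)
      show "(2::real) ^ k \<le> 2 ^ n" using k by (intro power_increasing) auto
    qed (use q0 in auto)
    finally show ?thesis by (simp add: mult.assoc)
  qed
  have geo: "summable (\<lambda>j. 2 ^ n * K * (1/2) ^ j)" "(\<Sum>j. 2 ^ n * K * (1/2) ^ j) = 2 ^ Suc n * K"
    using sums_mult[OF geometric_sums[of "1/2::real"], of "2 ^ n * K"] by (auto simp: sums_iff)
  have tele: "(A ^^ k) (F j) = (A ^^ k) (F 0) + (\<Sum>i<j. (A ^^ k) (F (Suc i)) - (A ^^ k) (F i))" for k j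
    by (simp only: sum_lessThan_telescope[of "\<lambda>i. (A ^^ k) (F i)" j]) simp
  have conv: "convergent (\<lambda>j. (A ^^ k) (F j))" if k: "k \<le> n" for k
  proof -
    have "summable (\<lambda>i. norm ((A ^^ k) (F (Suc i)) - (A ^^ k) (F i)))"
      by (rule summable_comparison_test'[OF geo(1)]) (use step[OF k] in simp)
    from summable_LIMSEQ[OF summable_norm_cancel_complete[OF this]]
    have "(\<lambda>j. (A ^^ k) (F 0) + (\<Sum>i<j. (A ^^ k) (F (Suc i)) - (A ^^ k) (F i)))
        \<longlonglongrightarrow> (A ^^ k) (F 0) + (\<Sum>i. (A ^^ k) (F (Suc i)) - (A ^^ k) (F i))"
      by (intro tendsto_add tendsto_const)
    then show ?thesis unfolding tele[symmetric] convergent_def by blast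
  qed
  \<comment> \<open>Closedness identifies the limits successively; only at step k + 1 does
    \<open>(A ^^ k) f\<close> enter the domain, hence the strict bound on \<open>i\<close>.\<close>
  have lim: "(\<lambda>j. (A ^^ k) (F j)) \<longlonglongrightarrow> (A ^^ k) f \<and> (\<forall>i<k. (A ^^ i) f \<in> D)" if "k \<le> n" for k
    using that
  proof (induction k)
    case (Suc k)
    then have l: "(\<lambda>j. (A ^^ k) (F j)) \<longlonglongrightarrow> (A ^^ k) f" by simp
    obtain z where z: "(\<lambda>j. A ((A ^^ k) (F j))) \<longlonglongrightarrow> z"
      using conv[OF Suc.prems] by (auto simp: convergent_def)
    from A_closed[OF FD l z] z Suc show ?case by (auto simp: less_Suc_eq)
  qed (use Flim in simp)
  show "(A ^^ k) f \<in> D" if "k < n" using lim[of n] that by blast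
  show "norm ((A ^^ n) f) \<le> R ^ n * norm f + 2 ^ Suc n * K"
  proof (rule LIMSEQ_le_const2)
    show "(\<lambda>j. norm ((A ^^ n) (F j))) \<longlonglongrightarrow> norm ((A ^^ n) f)"
      by (intro tendsto_norm) (use lim[of n] in blast)
    have "norm ((A ^^ n) (F j)) \<le> R ^ n * norm f + 2 ^ Suc n * K" for j
    proof -
      have "norm ((A ^^ n) (F j)) \<le> norm ((A ^^ n) (F 0)) +
          norm (\<Sum>i<j. (A ^^ n) (F (Suc i)) - (A ^^ n) (F i))"
        unfolding tele[of n j] by (rule norm_triangle_ineq)
      also have "norm ((A ^^ n) (F 0)) \<le> q 0 ^ n * norm (F 0)" by (rule exp_vectorsD(2)[OF F])
      also have "\<dots> \<le> R ^ n * norm f"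
        using norm_P_le[OF q0, of 0 f] R by (simp add: q_def F_def mult_left_mono)
      also have "norm (\<Sum>i<j. (A ^^ n) (F (Suc i)) - (A ^^ n) (F i)) \<le>
          (\<Sum>i<j. 2 ^ n * K * (1/2) ^ i)"
        by (rule sum_norm_le) (simp add: step)
      also have "\<dots> \<le> 2 ^ Suc n * K"
        unfolding geo(2)[symmetric] using K by (intro sum_le_suminf geo(1)) auto
      finally show ?thesis by simp
    qed
    then show "\<exists>N. \<forall>j\<ge>N. norm ((A ^^ n) (F j)) \<le> R ^ n * norm f + 2 ^ Suc n * K" by blast
  qed
qed

section \<open>Weights and the function classes\<close>

locale weight_sequence =
  fixes m :: "nat \<Rightarrow> real"
  assumes m_pos: "0 < m n"
    and m_superexp: "\<And>\<alpha>. 0 < \<alpha> \<Longrightarrow> \<exists>c>0. \<forall>n. c * \<alpha> ^ n \<le> m n"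
begin

lemma summable_tau: "0 \<le> x \<Longrightarrow> summable (\<lambda>n. x ^ n / m n)"
proof -
  assume x: "0 \<le> x"
  \<comment> \<open>Base \<open>x + 1\<close> gives a geometric majorant with ratio x/(x + 1) <
    1.\<close>
  obtain c where c: "c > 0" "\<And>n. c * (x + 1) ^ n \<le> m n"
    using m_superexp[of "x + 1"] x by auto
  have "summable (\<lambda>n. (1 / c) * (x / (x + 1)) ^ n)"
    using x by (intro summable_mult summable_geometric) simp
  then show ?thesis
  proof (rule summable_comparison_test')
    fix n
    have "x ^ n / m n \<le> x ^ n / (c * (x + 1) ^ n)"
      using c x m_pos by (intro divide_left_mono) auto
    also have "\<dots> = (1 / c) * (x / (x + 1)) ^ n" by (simp add: power_divide)
    finally show "norm (x ^ n / m n) \<le> (1 / c) * (x / (x + 1)) ^ n"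
      using x m_pos[of n] by simp
  qed
qed

lemma tau_ge: "0 \<le> x \<Longrightarrow> x ^ n / m n \<le> tau m x"
  unfolding tau_def
  using sum_le_suminf[OF summable_tau, of x "{n}"] m_pos by (simp add: less_imp_le)

lemma tau_pos: "0 \<le> x \<Longrightarrow> 0 < tau m x"
  using tau_ge[of x 0] m_pos[of 0] by (smt (verit) divide_pos_pos power_0)

end

context complex_nonneg_self_adjoint
begin

lemma C_inf_iff:
  assumes y: "weak_solution D A y"
  shows "C_inf y \<longleftrightarrow> (\<forall>k. (A ^^ k) (y 0) \<in> D)"
  using deriv_seq_weak_solution(2)[OF y] smooth_weak_solution(1)[OF y] unfolding C_inf_def by blast

text \<open>Up to sign the derivatives are \<open>(A ^^ k) (y t)\<close>, with norm largest at t =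
  0, so the uniform condition is one on the initial value.\<close>

lemma C_alpha_iff:
  assumes y: "weak_solution D A y"
  shows "C_alpha m \<alpha> y \<longleftrightarrow>
    (\<forall>k. (A ^^ k) (y 0) \<in> D) \<and> (\<exists>c>0. \<forall>k. norm ((A ^^ k) (y 0)) \<le> c * m k * \<alpha> ^ k)"
proof
  assume "C_alpha m \<alpha> y"
  then obtain Dy c where Dy: "deriv_seq y Dy" and c: "c > 0"
    "\<And>k t. 0 \<le> t \<Longrightarrow> norm (Dy k t) \<le> c * m k * \<alpha> ^ k"
    unfolding C_alpha_def by blast
  have "norm ((A ^^ k) (y 0)) \<le> c * m k * \<alpha> ^ k" for k
    using c(2)[of 0 k] deriv_seq_weak_solution(3)[OF y Dy, of k] by simp
  then show "(\<forall>k. (A ^^ k) (y 0) \<in> D) \<and> (\<exists>c>0. \<forall>k. norm ((A ^^ k) (y 0)) \<le> c * m k * \<alpha> ^ k)"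
    using c(1) deriv_seq_weak_solution(2)[OF y Dy] by blast
next
  assume *: "(\<forall>k. (A ^^ k) (y 0) \<in> D) \<and> (\<exists>c>0. \<forall>k. norm ((A ^^ k) (y 0)) \<le> c * m k * \<alpha> ^ k)"
  then obtain c where c: "c > 0" "\<And>k. norm ((A ^^ k) (y 0)) \<le> c * m k * \<alpha> ^ k" by blast
  have "norm ((-1) ^ k *\<^sub>R (A ^^ k) (y t)) \<le> c * m k * \<alpha> ^ k" if "0 \<le> t" for k t
    using smooth_weak_solution(2)[OF y _ that, of k] c(2)[of k] * by simp
  then show "C_alpha m \<alpha> y"
    unfolding C_alpha_def using smooth_weak_solution(1)[OF y] * c(1) by blast
qed

text \<open>The threshold is normalised to R \<ge> 1: \<open>best_approx_eq\<close> needs positive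
  r, and \<open>bernstein_inverse\<close> starts at R \<ge> 1.\<close>

lemma bigo_best_approx_iff:
  assumes y: "weak_solution D A y"
  shows "(\<lambda>r. best_approx J D A r y) \<in> O[at_top](g) \<longleftrightarrow>
    (\<exists>C\<ge>0. \<exists>R\<ge>1. \<forall>r\<ge>R. norm (y 0 - P r (y 0)) \<le> C * \<bar>g r\<bar>)"
proof
  assume "(\<lambda>r. best_approx J D A r y) \<in> O[at_top](g)"
  then obtain C where C: "C > 0" "\<forall>\<^sub>F r in at_top. norm (best_approx J D A r y) \<le> C * norm (g r)"
    by (rule landau_o.bigE)
  then obtain R where R: "\<And>r. R \<le> r \<Longrightarrow> \<bar>best_approx J D A r y\<bar> \<le> C * \<bar>g r\<bar>"
    unfolding eventually_at_top_linorder by auto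
  have "norm (y 0 - P r (y 0)) \<le> C * \<bar>g r\<bar>" if "max 1 R \<le> r" for r
    using R[of r] best_approx_eq[OF y, of r] that by simp
  then show "\<exists>C\<ge>0. \<exists>R\<ge>1. \<forall>r\<ge>R. norm (y 0 - P r (y 0)) \<le> C * \<bar>g r\<bar>"
    using C(1) by (intro exI[of _ C] conjI exI[of _ "max 1 R"]) auto
next
  assume "\<exists>C\<ge>0. \<exists>R\<ge>1. \<forall>r\<ge>R. norm (y 0 - P r (y 0)) \<le> C * \<bar>g r\<bar>"
  then obtain C R where CR: "R \<ge> 1" "\<And>r. R \<le> r \<Longrightarrow> norm (y 0 - P r (y 0)) \<le> C * \<bar>g r\<bar>"
    by blast
  have "\<forall>\<^sub>F r in at_top. norm (best_approx J D A r y) \<le> C * norm (g r)"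
    unfolding eventually_at_top_linorder
    using CR best_approx_eq[OF y] by (intro exI[of _ R]) auto
  then show "(\<lambda>r. best_approx J D A r y) \<in> O[at_top](g)" by (rule bigoI)
qed

lemma C_inf_iff_bigo:
  assumes y: "weak_solution D A y"
  shows "C_inf y \<longleftrightarrow> (\<forall>\<alpha>>0. (\<lambda>r. best_approx J D A r y) \<in> O[at_top](\<lambda>r. r powr (- \<alpha>)))"
proof
  assume "C_inf y"
  then have dom: "(A ^^ k) (y 0) \<in> D" for k using C_inf_iff[OF y] by blast
  show "\<forall>\<alpha>>0. (\<lambda>r. best_approx J D A r y) \<in> O[at_top](\<lambda>r. r powr (- \<alpha>))"
  proof (intro allI impI)
    fix \<alpha> :: real
    obtain n where n: "\<alpha> \<le> real n" using real_arch_simple by blast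
    have "norm (y 0 - P r (y 0)) \<le> norm ((A ^^ n) (y 0)) * \<bar>r powr (- \<alpha>)\<bar>" if r: "1 \<le> r" for r
    proof -
      have "norm (y 0 - P r (y 0)) \<le> norm ((A ^^ n) (y 0)) * r powr (- real n)"
        using jackson[OF r, of n "y 0"] dom r
        by (simp add: powr_minus powr_realpow field_simps)
      also have "\<dots> \<le> norm ((A ^^ n) (y 0)) * r powr (- \<alpha>)"
        using n r by (intro mult_left_mono powr_mono) auto
      finally show ?thesis by simp
    qed
    then show "(\<lambda>r. best_approx J D A r y) \<in> O[at_top](\<lambda>r. r powr (- \<alpha>))"
      unfolding bigo_best_approx_iff[OF y] by (metis norm_ge_zero order_refl)
  qed
next
  assume bigo: "\<forall>\<alpha>>0. (\<lambda>r. best_approx J D A r y) \<in> O[at_top](\<lambda>r. r powr (- \<alpha>))"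
  have "(A ^^ k) (y 0) \<in> D" for k
  proof -
    \<comment> \<open>The inverse estimate needs decay one order above \<open>?n\<close> and puts
      only powers strictly below \<open>?n\<close> into the domain, so order k + 2 is
      requested.\<close>
    let ?n = "Suc k"
    have "(\<lambda>r. best_approx J D A r y) \<in> O[at_top](\<lambda>r. r powr (- real (Suc ?n)))"
      using bigo by (metis of_nat_0_less_iff zero_less_Suc)
    then obtain C R where CR: "C \<ge> 0" "R \<ge> 1"
      "\<And>r. R \<le> r \<Longrightarrow> norm (y 0 - P r (y 0)) \<le> C * \<bar>r powr (- real (Suc ?n))\<bar>"
      unfolding bigo_best_approx_iff[OF y] by blast
    have "r ^ Suc ?n * norm (y 0 - P r (y 0)) \<le> C" if "R \<le> r" for r
    proof -
      have r: "r > 0" using that CR(2) by simp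
      have "norm (y 0 - P r (y 0)) \<le> C / r ^ Suc ?n"
        using CR(3)[OF that] r
        by (simp add: powr_minus powr_realpow divide_inverse del: of_nat_Suc power_Suc)
      then show ?thesis using r by (simp add: field_simps)
    qed
    from bernstein_inverse(1)[OF CR(2,1) this, of k] show ?thesis by simp
  qed
  then show "C_inf y" using C_inf_iff[OF y] by blast
qed

text \<open>By \<open>jackson\<close> the error is at most c m_n (\<alpha>/r)^n for every n. At r/(2
  \<alpha>) each term of \<open>tau\<close> times the error is thus at most c 2^(-n), and these sum
  to 2 c.\<close>

lemma C_alpha_imp_bigo:
  assumes y: "weak_solution D A y" and m: "weight_sequence m" and \<alpha>: "0 < \<alpha>" and C: "C_alpha m \<alpha> y"
  shows "(\<lambda>r. best_approx J D A r y) \<in> O[at_top](\<lambda>r. 1 / tau m (1 / (2 * \<alpha>) * r))"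
proof -
  interpret weight_sequence m by (rule m)
  obtain c where dom: "\<And>k. (A ^^ k) (y 0) \<in> D" and c: "c > 0"
    "\<And>k. norm ((A ^^ k) (y 0)) \<le> c * m k * \<alpha> ^ k"
    using C unfolding C_alpha_iff[OF y] by blast
  have "norm (y 0 - P r (y 0)) \<le> 2 * c * \<bar>1 / tau m (1 / (2 * \<alpha>) * r)\<bar>" if r: "1 \<le> r" for r
  proof -
    let ?e = "norm (y 0 - P r (y 0))" and ?x = "1 / (2 * \<alpha>) * r"
    have x: "0 \<le> ?x" using \<alpha> r by simp
    have term_le: "?e * (?x ^ n / m n) \<le> c * (1/2) ^ n" for n
    proof -
      have "r ^ n * ?e \<le> c * m n * \<alpha> ^ n"
        using jackson[OF r, of n "y 0"] dom c(2)[of n] by simp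
      then have "r ^ n * ?e / (m n * (2 * \<alpha>) ^ n) \<le> c * m n * \<alpha> ^ n / (m n * (2 * \<alpha>) ^ n)"
        using m_pos[of n] \<alpha> by (intro divide_right_mono) auto
      moreover have "?e * (?x ^ n / m n) = r ^ n * ?e / (m n * (2 * \<alpha>) ^ n)"
        by (simp add: power_divide power_mult_distrib mult_ac)
      moreover have "c * m n * \<alpha> ^ n / (m n * (2 * \<alpha>) ^ n) = c * (1/2) ^ n"
        using m_pos[of n] \<alpha> by (simp add: power_mult_distrib power_divide)
      ultimately show ?thesis by simp
    qed
    have "?e * tau m ?x = (\<Sum>n. ?e * (?x ^ n / m n))"
      unfolding tau_def by (rule suminf_mult[OF summable_tau[OF x], symmetric])
    also have "\<dots> \<le> (\<Sum>n. c * (1/2) ^ n)"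
      by (rule suminf_le[OF term_le summable_mult[OF summable_tau[OF x]]])
         (intro summable_mult summable_geometric, simp)
    also have "\<dots> = 2 * c"
      using sums_mult[OF geometric_sums[of "1/2::real"], of c] by (simp add: sums_iff)
    finally show ?thesis using tau_pos[OF x] by (simp add: field_simps)
  qed
  then show ?thesis
    unfolding bigo_best_approx_iff[OF y] using c(1)
    by (intro exI[of _ "2 * c"] conjI exI[of _ 1]) auto
qed

text \<open>A single term of \<open>tau\<close>, that of index n + 1, already bounds the error. The
  new parameter collects 2^n from the dyadic estimate, h^n from the growth of \<open>m\<close>, and
  \<alpha>^(-n).\<close>

lemma bigo_imp_C_alpha:
  assumes y: "weak_solution D A y" and m: "weight_sequence m" and \<alpha>: "0 < \<alpha>"
    and c1: "0 \<le> c1" and h: "0 < h" and growth: "\<And>n. m (Suc n) \<le> c1 * h ^ n * m n"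
    and bigo: "(\<lambda>r. best_approx J D A r y) \<in> O[at_top](\<lambda>r. 1 / tau m (\<alpha> * r))"
  shows "C_alpha m (2 * h / \<alpha>) y"
proof -
  interpret weight_sequence m by (rule m)
  obtain C R where CR: "C \<ge> 0" "R \<ge> 1"
    "\<And>r. R \<le> r \<Longrightarrow> norm (y 0 - P r (y 0)) \<le> C * \<bar>1 / tau m (\<alpha> * r)\<bar>"
    using bigo unfolding bigo_best_approx_iff[OF y] by blast
  have e: "r ^ Suc n * norm (y 0 - P r (y 0)) \<le> C * m (Suc n) / \<alpha> ^ Suc n" if r: "R \<le> r" for r n
  proof -
    have r0: "r > 0" using r CR(2) by simp
    have x: "0 \<le> \<alpha> * r" using r0 \<alpha> by simp
    have "norm (y 0 - P r (y 0)) * ((\<alpha> * r) ^ Suc n / m (Suc n)) \<le> norm (y 0 - P r (y 0)) * tau m (\<alpha> * r)"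
      by (intro mult_left_mono tau_ge x) simp
    also have "\<dots> \<le> C" using CR(3)[OF r] tau_pos[OF x] by (simp add: field_simps)
    finally show ?thesis using m_pos[of "Suc n"] \<alpha> by (simp add: power_mult_distrib field_simps)
  qed
  have K: "0 \<le> C * m (Suc n) / \<alpha> ^ Suc n" for n using CR(1) m_pos[of "Suc n"] \<alpha> by simp
  have dom: "(A ^^ k) (y 0) \<in> D" for k
    by (rule bernstein_inverse(1)[where n = "Suc k" and f = "y 0", OF CR(2) K e]) auto
  have inv: "norm ((A ^^ n) (y 0)) \<le> R ^ n * norm (y 0) + 2 ^ Suc n * (C * m (Suc n) / \<alpha> ^ Suc n)" for n
    by (rule bernstein_inverse(2)[OF CR(2) K e])
  let ?b = "2 * h / \<alpha>"
  have b: "?b > 0" using h \<alpha> by simp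
  \<comment> \<open>Base \<open>R / ?b\<close> is what bounds the initial term R^n by a multiple of
    \<open>m n * ?b ^ n\<close>.\<close>
  obtain c2 where c2: "c2 > 0" "\<And>n. c2 * (R / ?b) ^ n \<le> m n"
  proof -
    have "0 < R / ?b" using CR(2) by (intro divide_pos_pos[OF _ b]) simp
    from m_superexp[OF this] that show ?thesis by blast
  qed
  let ?c = "norm (y 0) / c2 + 2 * C * c1 / \<alpha> + 1"
  have le: "norm ((A ^^ n) (y 0)) \<le> ?c * m n * ?b ^ n" for n
  proof -
    have "R ^ n \<le> m n * ?b ^ n / c2"
    proof -
      have "(R / x) ^ n * x ^ n = R ^ n" if "x > 0" for x :: real
        using that by (simp add: power_divide)
      then have "c2 * R ^ n = c2 * (R / ?b) ^ n * ?b ^ n" using b by (simp only: mult.assoc)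
      also have "\<dots> \<le> m n * ?b ^ n" using c2(2)[of n] b by (intro mult_right_mono) auto
      finally show ?thesis using c2(1) by (simp only: pos_le_divide_eq mult.commute)
    qed
    then have "R ^ n * norm (y 0) \<le> norm (y 0) / c2 * (m n * ?b ^ n)"
      using mult_right_mono[of "R ^ n" "m n * ?b ^ n / c2" "norm (y 0)"] by (simp add: mult_ac)
    moreover have "2 ^ Suc n * (C * m (Suc n) / \<alpha> ^ Suc n) \<le> 2 * C * c1 / \<alpha> * (m n * ?b ^ n)"
    proof -
      have "2 ^ Suc n * (C * m (Suc n) / \<alpha> ^ Suc n) \<le> 2 ^ Suc n * (C * (c1 * h ^ n * m n) / \<alpha> ^ Suc n)"
        using CR(1) \<alpha> growth[of n] by (intro mult_left_mono divide_right_mono) auto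
      also have "\<dots> = 2 * C * c1 / \<alpha> * (m n * ?b ^ n)"
        by (simp add: power_divide power_mult_distrib)
      finally show ?thesis .
    qed
    moreover have "0 \<le> m n * ?b ^ n" using m_pos[of n] b by simp
    ultimately show ?thesis
      using inv[of n] by (simp only: distrib_right mult_1 mult.assoc)
  qed
  have "?c > 0" using c2(1) CR(1) c1 \<alpha> by (intro add_nonneg_pos add_nonneg_nonneg) auto
  then show ?thesis unfolding C_alpha_iff[OF y] using le dom by blast
qed

end

theorem theorem5:
  fixes J :: "'a::{real_inner,complete_space} \<Rightarrow> 'a"
    and D :: "'a set" and A :: "'a \<Rightarrow> 'a"
    and m :: "nat \<Rightarrow> real" and y :: "real \<Rightarrow> 'a"
  assumes "complex_structure J"
    and "nonneg_selfadjoint J D A"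
    and "\<forall>n. m n > 0"
    and "mono m"
    and "\<forall>\<alpha>>0. \<exists>c>0. \<forall>n. m n \<ge> c * \<alpha> ^ n"
    and "\<exists>c>0. \<exists>h>1. \<forall>n. m (Suc n) \<le> c * h ^ n * m n"
    and "weak_solution D A y"
  shows "(C_inf y \<longleftrightarrow>
            (\<forall>\<alpha>>0. (\<lambda>r. best_approx J D A r y) \<in> O[at_top](\<lambda>r. r powr (- \<alpha>)))) \<and>
         (C_roumieu m y \<longleftrightarrow>
            (\<exists>\<alpha>>0. (\<lambda>r. best_approx J D A r y) \<in> O[at_top](\<lambda>r. 1 / tau m (\<alpha> * r)))) \<and>
         (C_beurling m y \<longleftrightarrow>
            (\<forall>\<alpha>>0. (\<lambda>r. best_approx J D A r y) \<in> O[at_top](\<lambda>r. 1 / tau m (\<alpha> * r))))"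
proof -
  interpret complex_nonneg_self_adjoint D A J
    using assms(1,2) unfolding nonneg_selfadjoint_def by unfold_locales auto
  have m: "weight_sequence m" using assms(3,5) by unfold_locales auto
  note y = assms(7)
  obtain c h where ch: "c > 0" "h > 1" "\<And>n. m (Suc n) \<le> c * h ^ n * m n" using assms(6) by blast
  let ?O = "\<lambda>\<alpha>. (\<lambda>r. best_approx J D A r y) \<in> O[at_top](\<lambda>r. 1 / tau m (\<alpha> * r))"
  have to: "?O (1 / (2 * \<alpha>))" if "0 < \<alpha>" "C_alpha m \<alpha> y" for \<alpha>
    by (rule C_alpha_imp_bigo[OF y m that])
  have from_O: "C_alpha m (2 * h / \<alpha>) y" if "0 < \<alpha>" "?O \<alpha>" for \<alpha>
    using bigo_imp_C_alpha[OF y m that(1) _ _ ch(3) that(2)] ch by simp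
  have "C_roumieu m y \<longleftrightarrow> (\<exists>\<alpha>>0. ?O \<alpha>)"
  proof
    assume "C_roumieu m y"
    then obtain \<alpha> where "\<alpha> > 0" "C_alpha m \<alpha> y" unfolding C_roumieu_def by blast
    with to[of \<alpha>] show "\<exists>\<alpha>>0. ?O \<alpha>" by (intro exI[of _ "1 / (2 * \<alpha>)"]) simp
  next
    assume "\<exists>\<alpha>>0. ?O \<alpha>"
    then obtain \<alpha> where "\<alpha> > 0" "?O \<alpha>" by blast
    with from_O[of \<alpha>] ch(2) show "C_roumieu m y"
      unfolding C_roumieu_def by (intro exI[of _ "2 * h / \<alpha>"]) simp
  qed
  moreover have "C_beurling m y \<longleftrightarrow> (\<forall>\<alpha>>0. ?O \<alpha>)"
  proof (intro iffI allI impI)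
    fix \<alpha> :: real assume "C_beurling m y" "\<alpha> > 0"
    \<comment> \<open>The map from \<alpha> to 1/(2 \<alpha>) is its own inverse on the positive
      reals, as is that from \<beta> to 2 h/\<beta> in the converse, so every parameter is
      reached.\<close>
    then have "C_alpha m (1 / (2 * \<alpha>)) y" unfolding C_beurling_def by simp
    from to[OF _ this] \<open>\<alpha> > 0\<close> show "?O \<alpha>" by simp
  next
    assume O: "\<forall>\<alpha>>0. ?O \<alpha>"
    have "C_alpha m \<beta> y" if "\<beta> > 0" for \<beta>
    proof -
      have pos: "0 < 2 * h / \<beta>" using that ch(2) by simp
      with O have "?O (2 * h / \<beta>)" by blast
      from from_O[OF pos this] ch(2) that show ?thesis by simp
    qed
    then show "C_beurling m y" unfolding C_beurling_def by blast
  qed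
  ultimately show ?thesis using C_inf_iff_bigo[OF y] by blast
qed

end
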